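(* Let $\mathcal C$ be a finite braided tensor category over a field $\Bbbk$ and let $A$ be an algebra in $\mathcal C$. If $A$ is relatively projective as a bimodule, then $A$ is fully exact. In particular, if $A$ is separable, then $A$ is fully exact.
   Context: Conventions. $\Bbbk$ is an arbitrary field. A finite category is a $\Bbbk$-linear category equivalent to finite-dimensional modules over a finite-dimensional $\Bbbk$-algebra. A finite tensor category is a finite category that is (strict) monoidal with $\Bbbk$-bilinear tensor product, left and right duals, and simple unit. The braiding is $\psi_{X,Y}:X\otimes Y\to Y\otimes X$. An algebra $A$ in $\mathcal C$ is relatively projective as a bimodule if the regular $A$-bimodule $A$ is a direct summand, as an $A$-bimodule in $\mathcal C$, of the induced bimodule $A\otimes X\otimes A$ for some $X\in\mathcal C$; it is separable if its multiplication $A\otimes A\to A$ has a section as a morphism of $A$-bimodules in $\mathcal C$. Module categories. Left $\mathcal C$-module categories $\mathcal M$ are finite, with action $\triangleright$ exact in both variables and associator $l$. $\mathcal M$ is exact if $P\triangleright M$ is projective for every projective $P\in\mathcal C$ and $M\in\mathcal M$. $\mathbf{mod}_{\mathcal C}\text{-}A$ is the left $\mathcal C$-module category of right $A$-modules in $\mathcal C$ with $X\triangleright V=X\otimes V$; every finite left $\mathcal C$-module category is of this form up to equivalence. The relative Deligne product $\mathcal N\boxtimes_{\mathcal C}\mathcal M$ (with $\mathcal N$ viewed as a right module by $N\triangleleft X=X\triangleright N$, associator $(\psi_{Y,X}\triangleright N)l_{Y,X,N}$) is the finite category universal for $\mathcal C$-balanced functors on $\mathcal N\times\mathcal M$ right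 exact in each variable, with left action induced by $X\triangleright(N\boxtimes M)=(X\triangleright N)\boxtimes M$; concretely $\mathbf{mod}_{\mathcal C}\text{-}B\boxtimes_{\mathcal C}\mathbf{mod}_{\mathcal C}\text{-}A\simeq\mathbf{mod}_{\mathcal C}\text{-}(B\otimes A)$ with product $(m_B\otimes m_A)(\mathrm{id}_B\otimes\psi_{A,B}\otimes\mathrm{id}_A)$. $\mathcal M$ is fully exact if $\mathcal N\boxtimes_{\mathcal C}\mathcal M$ is exact for every exact left $\mathcal C$-module category $\mathcal N$; an algebra $A$ is fully exact if $\mathbf{mod}_{\mathcal C}\text{-}A$ is fully exact. *)

theory Defs
  imports "Jordan_Normal_Form.Matrix"
begin

section \<open>Linear categories\<close>

text \<open>
  Arrows carry their source and target, so that different hom-sets are disjoint and a functor is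
  a pair of functions, on objects and on arrows. Only the values on \<open>Ob\<close> and \<open>Ar\<close> are meaningful.
\<close>

record ('o, 'a, 'k) lincat =
  Ob :: "'o set"
  Ar :: "'a set"
  Src :: "'a \<Rightarrow> 'o"
  Tgt :: "'a \<Rightarrow> 'o"
  Idn :: "'o \<Rightarrow> 'a"
  Cmp :: "'a \<Rightarrow> 'a \<Rightarrow> 'a"  (infixr "\<cdot>\<index>" 70)
  Zer :: "'o \<Rightarrow> 'o \<Rightarrow> 'a"
  Add :: "'a \<Rightarrow> 'a \<Rightarrow> 'a"
  Scl :: "'k \<Rightarrow> 'a \<Rightarrow> 'a"

definition Hom :: "('o, 'a, 'k, 'z) lincat_scheme \<Rightarrow> 'o \<Rightarrow> 'o \<Rightarrow> 'a set" where
  "Hom C x y = {f \<in> Ar C. Src C f = x \<and> Tgt C f = y}"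

locale linear_category =
  fixes C :: "('o, 'a, 'k::field, 'z) lincat_scheme" (structure)
  assumes src_ob: "f \<in> Ar C \<Longrightarrow> Src C f \<in> Ob C"
    and tgt_ob: "f \<in> Ar C \<Longrightarrow> Tgt C f \<in> Ob C"
    and id_hom: "x \<in> Ob C \<Longrightarrow> Idn C x \<in> Hom C x x"
    and comp_hom: "\<lbrakk>f \<in> Hom C x y; g \<in> Hom C y z\<rbrakk> \<Longrightarrow> g \<cdot> f \<in> Hom C x z"
    and comp_assoc:
      "\<lbrakk>f \<in> Hom C x y; g \<in> Hom C y z; h \<in> Hom C z w\<rbrakk> \<Longrightarrow> (h \<cdot> g) \<cdot> f = h \<cdot> (g \<cdot> f)"
    and comp_id_right: "f \<in> Hom C x y \<Longrightarrow> f \<cdot> Idn C x = f"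
    and comp_id_left: "f \<in> Hom C x y \<Longrightarrow> Idn C y \<cdot> f = f"
    and zero_hom: "\<lbrakk>x \<in> Ob C; y \<in> Ob C\<rbrakk> \<Longrightarrow> Zer C x y \<in> Hom C x y"
    and add_hom: "\<lbrakk>f \<in> Hom C x y; g \<in> Hom C x y\<rbrakk> \<Longrightarrow> Add C f g \<in> Hom C x y"
    and scale_hom: "f \<in> Hom C x y \<Longrightarrow> Scl C c f \<in> Hom C x y"
    and add_assoc: "\<lbrakk>f \<in> Hom C x y; g \<in> Hom C x y; h \<in> Hom C x y\<rbrakk>
      \<Longrightarrow> Add C (Add C f g) h = Add C f (Add C g h)"
    and add_commute: "\<lbrakk>f \<in> Hom C x y; g \<in> Hom C x y\<rbrakk> \<Longrightarrow> Add C f g = Add C g f"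
    and add_zero: "f \<in> Hom C x y \<Longrightarrow> Add C f (Zer C x y) = f"
    and add_neg: "f \<in> Hom C x y \<Longrightarrow> \<exists>g \<in> Hom C x y. Add C f g = Zer C x y"
    and scale_add: "\<lbrakk>f \<in> Hom C x y; g \<in> Hom C x y\<rbrakk>
      \<Longrightarrow> Scl C c (Add C f g) = Add C (Scl C c f) (Scl C c g)"
    and add_scale: "f \<in> Hom C x y \<Longrightarrow> Scl C (c + d) f = Add C (Scl C c f) (Scl C d f)"
    and scale_scale: "f \<in> Hom C x y \<Longrightarrow> Scl C c (Scl C d f) = Scl C (c * d) f"
    and scale_one: "f \<in> Hom C x y \<Longrightarrow> Scl C 1 f = f"
    and comp_add_right: "\<lbrakk>f \<in> Hom C x y; f' \<in> Hom C x y; g \<in> Hom C y z\<rbrakk>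
      \<Longrightarrow> g \<cdot> Add C f f' = Add C (g \<cdot> f) (g \<cdot> f')"
    and comp_add_left: "\<lbrakk>f \<in> Hom C x y; g \<in> Hom C y z; g' \<in> Hom C y z\<rbrakk>
      \<Longrightarrow> Add C g g' \<cdot> f = Add C (g \<cdot> f) (g' \<cdot> f)"
    and comp_scale_right: "\<lbrakk>f \<in> Hom C x y; g \<in> Hom C y z\<rbrakk> \<Longrightarrow> g \<cdot> Scl C c f = Scl C c (g \<cdot> f)"
    and comp_scale_left: "\<lbrakk>f \<in> Hom C x y; g \<in> Hom C y z\<rbrakk> \<Longrightarrow> Scl C c g \<cdot> f = Scl C c (g \<cdot> f)"

definition inverse_arrows :: "('o, 'a, 'k, 'z) lincat_scheme \<Rightarrow> 'a \<Rightarrow> 'a \<Rightarrow> bool" where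
  "inverse_arrows C f g \<longleftrightarrow> f \<in> Ar C \<and> g \<in> Hom C (Tgt C f) (Src C f) \<and>
     g \<cdot>\<^bsub>C\<^esub> f = Idn C (Src C f) \<and> f \<cdot>\<^bsub>C\<^esub> g = Idn C (Tgt C f)"

definition is_iso :: "('o, 'a, 'k, 'z) lincat_scheme \<Rightarrow> 'a \<Rightarrow> bool" where
  "is_iso C f \<longleftrightarrow> (\<exists>g. inverse_arrows C f g)"

definition inv_arrow :: "('o, 'a, 'k, 'z) lincat_scheme \<Rightarrow> 'a \<Rightarrow> 'a" where
  "inv_arrow C f = (THE g. inverse_arrows C f g)"

definition mono_arrow :: "('o, 'a, 'k, 'z) lincat_scheme \<Rightarrow> 'a \<Rightarrow> bool" where
  "mono_arrow C f \<longleftrightarrow> f \<in> Ar C \<and>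
     (\<forall>w \<in> Ob C. \<forall>g \<in> Hom C w (Src C f). \<forall>h \<in> Hom C w (Src C f).
        f \<cdot>\<^bsub>C\<^esub> g = f \<cdot>\<^bsub>C\<^esub> h \<longrightarrow> g = h)"

definition epi_arrow :: "('o, 'a, 'k, 'z) lincat_scheme \<Rightarrow> 'a \<Rightarrow> bool" where
  "epi_arrow C f \<longleftrightarrow> f \<in> Ar C \<and>
     (\<forall>w \<in> Ob C. \<forall>g \<in> Hom C (Tgt C f) w. \<forall>h \<in> Hom C (Tgt C f) w.
        g \<cdot>\<^bsub>C\<^esub> f = h \<cdot>\<^bsub>C\<^esub> f \<longrightarrow> g = h)"

definition zero_object :: "('o, 'a, 'k, 'z) lincat_scheme \<Rightarrow> 'o \<Rightarrow> bool" where
  "zero_object C x \<longleftrightarrow> x \<in> Ob C \<and> Idn C x = Zer C x x"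

definition simple_object :: "('o, 'a, 'k, 'z) lincat_scheme \<Rightarrow> 'o \<Rightarrow> bool" where
  "simple_object C x \<longleftrightarrow> x \<in> Ob C \<and> \<not> zero_object C x \<and>
     (\<forall>f. mono_arrow C f \<and> Tgt C f = x \<longrightarrow> zero_object C (Src C f) \<or> is_iso C f)"

definition projective_object :: "('o, 'a, 'k, 'z) lincat_scheme \<Rightarrow> 'o \<Rightarrow> bool" where
  "projective_object C p \<longleftrightarrow> p \<in> Ob C \<and>
     (\<forall>e f. epi_arrow C e \<and> f \<in> Hom C p (Tgt C e) \<longrightarrow>
        (\<exists>g \<in> Hom C p (Src C e). e \<cdot>\<^bsub>C\<^esub> g = f))"

definition is_cokernel :: "('o, 'a, 'k, 'z) lincat_scheme \<Rightarrow> 'a \<Rightarrow> 'a \<Rightarrow> bool" where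
  "is_cokernel C f q \<longleftrightarrow> f \<in> Ar C \<and> q \<in> Ar C \<and> Src C q = Tgt C f \<and>
     q \<cdot>\<^bsub>C\<^esub> f = Zer C (Src C f) (Tgt C q) \<and>
     (\<forall>w \<in> Ob C. \<forall>g \<in> Hom C (Tgt C f) w. g \<cdot>\<^bsub>C\<^esub> f = Zer C (Src C f) w \<longrightarrow>
        (\<exists>!h. h \<in> Hom C (Tgt C q) w \<and> h \<cdot>\<^bsub>C\<^esub> q = g))"

definition is_kernel :: "('o, 'a, 'k, 'z) lincat_scheme \<Rightarrow> 'a \<Rightarrow> 'a \<Rightarrow> bool" where
  "is_kernel C f j \<longleftrightarrow> f \<in> Ar C \<and> j \<in> Ar C \<and> Tgt C j = Src C f \<and>
     f \<cdot>\<^bsub>C\<^esub> j = Zer C (Src C j) (Tgt C f) \<and>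
     (\<forall>w \<in> Ob C. \<forall>g \<in> Hom C w (Src C f). f \<cdot>\<^bsub>C\<^esub> g = Zer C w (Tgt C f) \<longrightarrow>
        (\<exists>!h. h \<in> Hom C w (Src C j) \<and> j \<cdot>\<^bsub>C\<^esub> h = g))"


section \<open>Functors and natural transformations\<close>

definition linear_functor ::
  "('o, 'a, 'k, 'z) lincat_scheme \<Rightarrow> ('p, 'b, 'k, 'y) lincat_scheme \<Rightarrow>
   ('o \<Rightarrow> 'p) \<Rightarrow> ('a \<Rightarrow> 'b) \<Rightarrow> bool" where
  "linear_functor C D FO FA \<longleftrightarrow>
     (\<forall>x \<in> Ob C. FO x \<in> Ob D \<and> FA (Idn C x) = Idn D (FO x)) \<and>
     (\<forall>x y. \<forall>f \<in> Hom C x y. FA f \<in> Hom D (FO x) (FO y)) \<and>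
     (\<forall>x y z. \<forall>f \<in> Hom C x y. \<forall>g \<in> Hom C y z. FA (g \<cdot>\<^bsub>C\<^esub> f) = FA g \<cdot>\<^bsub>D\<^esub> FA f) \<and>
     (\<forall>x y. \<forall>f \<in> Hom C x y. \<forall>g \<in> Hom C x y. FA (Add C f g) = Add D (FA f) (FA g)) \<and>
     (\<forall>c. \<forall>f \<in> Ar C. FA (Scl C c f) = Scl D c (FA f))"

definition right_exact_functor ::
  "('o, 'a, 'k, 'z) lincat_scheme \<Rightarrow> ('p, 'b, 'k, 'y) lincat_scheme \<Rightarrow>
   ('o \<Rightarrow> 'p) \<Rightarrow> ('a \<Rightarrow> 'b) \<Rightarrow> bool" where
  "right_exact_functor C D FO FA \<longleftrightarrow> linear_functor C D FO FA \<and>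
     (\<forall>f q. is_cokernel C f q \<longrightarrow> is_cokernel D (FA f) (FA q))"

definition left_exact_functor ::
  "('o, 'a, 'k, 'z) lincat_scheme \<Rightarrow> ('p, 'b, 'k, 'y) lincat_scheme \<Rightarrow>
   ('o \<Rightarrow> 'p) \<Rightarrow> ('a \<Rightarrow> 'b) \<Rightarrow> bool" where
  "left_exact_functor C D FO FA \<longleftrightarrow> linear_functor C D FO FA \<and>
     (\<forall>f j. is_kernel C f j \<longrightarrow> is_kernel D (FA f) (FA j))"

definition exact_functor ::
  "('o, 'a, 'k, 'z) lincat_scheme \<Rightarrow> ('p, 'b, 'k, 'y) lincat_scheme \<Rightarrow>
   ('o \<Rightarrow> 'p) \<Rightarrow> ('a \<Rightarrow> 'b) \<Rightarrow> bool" where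
  "exact_functor C D FO FA \<longleftrightarrow> left_exact_functor C D FO FA \<and> right_exact_functor C D FO FA"

definition natural_trans ::
  "('o, 'a, 'k, 'z) lincat_scheme \<Rightarrow> ('p, 'b, 'k, 'y) lincat_scheme \<Rightarrow>
   ('o \<Rightarrow> 'p) \<Rightarrow> ('a \<Rightarrow> 'b) \<Rightarrow> ('o \<Rightarrow> 'p) \<Rightarrow> ('a \<Rightarrow> 'b) \<Rightarrow> ('o \<Rightarrow> 'b) \<Rightarrow> bool" where
  "natural_trans C D FO FA GO GA t \<longleftrightarrow>
     (\<forall>x \<in> Ob C. t x \<in> Hom D (FO x) (GO x)) \<and>
     (\<forall>x y. \<forall>f \<in> Hom C x y. t y \<cdot>\<^bsub>D\<^esub> FA f = GA f \<cdot>\<^bsub>D\<^esub> t x)"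

definition natural_iso ::
  "('o, 'a, 'k, 'z) lincat_scheme \<Rightarrow> ('p, 'b, 'k, 'y) lincat_scheme \<Rightarrow>
   ('o \<Rightarrow> 'p) \<Rightarrow> ('a \<Rightarrow> 'b) \<Rightarrow> ('o \<Rightarrow> 'p) \<Rightarrow> ('a \<Rightarrow> 'b) \<Rightarrow> ('o \<Rightarrow> 'b) \<Rightarrow> bool" where
  "natural_iso C D FO FA GO GA t \<longleftrightarrow>
     natural_trans C D FO FA GO GA t \<and> (\<forall>x \<in> Ob C. is_iso D (t x))"

definition equivalent_categories ::
  "('o, 'a, 'k, 'z) lincat_scheme \<Rightarrow> ('p, 'b, 'k, 'y) lincat_scheme \<Rightarrow> bool" where
  "equivalent_categories C D \<longleftrightarrow>
     (\<exists>FO FA GO GA t u. linear_functor C D FO FA \<and> linear_functor D C GO GA \<and>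
        natural_iso C C (\<lambda>x. x) (\<lambda>f. f) (GO \<circ> FO) (GA \<circ> FA) t \<and>
        natural_iso D D (FO \<circ> GO) (FA \<circ> GA) (\<lambda>x. x) (\<lambda>f. f) u)"

definition bilinear_bifunctor ::
  "('o, 'a, 'k, 'z) lincat_scheme \<Rightarrow> ('p, 'b, 'k, 'y) lincat_scheme \<Rightarrow>
   ('q, 'c, 'k, 'x) lincat_scheme \<Rightarrow> ('o \<Rightarrow> 'p \<Rightarrow> 'q) \<Rightarrow> ('a \<Rightarrow> 'b \<Rightarrow> 'c) \<Rightarrow> bool" where
  "bilinear_bifunctor C D E FO FA \<longleftrightarrow>
     (\<forall>x \<in> Ob C. \<forall>y \<in> Ob D. FO x y \<in> Ob E \<and> FA (Idn C x) (Idn D y) = Idn E (FO x y)) \<and>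
     (\<forall>x x' y y'. \<forall>f \<in> Hom C x x'. \<forall>g \<in> Hom D y y'. FA f g \<in> Hom E (FO x y) (FO x' y')) \<and>
     (\<forall>x x' x'' y y' y''. \<forall>f \<in> Hom C x x'. \<forall>f' \<in> Hom C x' x''.
        \<forall>g \<in> Hom D y y'. \<forall>g' \<in> Hom D y' y''.
        FA (f' \<cdot>\<^bsub>C\<^esub> f) (g' \<cdot>\<^bsub>D\<^esub> g) = FA f' g' \<cdot>\<^bsub>E\<^esub> FA f g) \<and>
     (\<forall>x x'. \<forall>f \<in> Hom C x x'. \<forall>f' \<in> Hom C x x'. \<forall>g \<in> Ar D.
        FA (Add C f f') g = Add E (FA f g) (FA f' g)) \<and>
     (\<forall>y y'. \<forall>f \<in> Ar C. \<forall>g \<in> Hom D y y'. \<forall>g' \<in> Hom D y y'.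
        FA f (Add D g g') = Add E (FA f g) (FA f g')) \<and>
     (\<forall>c. \<forall>f \<in> Ar C. \<forall>g \<in> Ar D.
        FA (Scl C c f) g = Scl E c (FA f g) \<and> FA f (Scl D c g) = Scl E c (FA f g))"

definition biexact ::
  "('o, 'a, 'k, 'z) lincat_scheme \<Rightarrow> ('p, 'b, 'k, 'y) lincat_scheme \<Rightarrow>
   ('q, 'c, 'k, 'x) lincat_scheme \<Rightarrow> ('o \<Rightarrow> 'p \<Rightarrow> 'q) \<Rightarrow> ('a \<Rightarrow> 'b \<Rightarrow> 'c) \<Rightarrow> bool" where
  "biexact C D E FO FA \<longleftrightarrow> bilinear_bifunctor C D E FO FA \<and>
     (\<forall>x \<in> Ob C. exact_functor D E (FO x) (FA (Idn C x))) \<and>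
     (\<forall>y \<in> Ob D. exact_functor C E (\<lambda>x. FO x y) (\<lambda>f. FA f (Idn D y)))"

definition right_biexact ::
  "('o, 'a, 'k, 'z) lincat_scheme \<Rightarrow> ('p, 'b, 'k, 'y) lincat_scheme \<Rightarrow>
   ('q, 'c, 'k, 'x) lincat_scheme \<Rightarrow> ('o \<Rightarrow> 'p \<Rightarrow> 'q) \<Rightarrow> ('a \<Rightarrow> 'b \<Rightarrow> 'c) \<Rightarrow> bool" where
  "right_biexact C D E FO FA \<longleftrightarrow> bilinear_bifunctor C D E FO FA \<and>
     (\<forall>x \<in> Ob C. right_exact_functor D E (FO x) (FA (Idn C x))) \<and>
     (\<forall>y \<in> Ob D. right_exact_functor C E (\<lambda>x. FO x y) (\<lambda>f. FA f (Idn D y)))"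


section \<open>Finite categories\<close>

text \<open>
  A finite-dimensional algebra is given by a basis \<open>b\<^sub>i\<close> (\<open>i < fdim\<close>), structure constants
  \<open>b\<^sub>i b\<^sub>j = (\<Sum>l. sc i j l b\<^sub>l)\<close> and its unit \<open>(\<Sum>i. un i b\<^sub>i)\<close>. A module of dimension \<open>n\<close> is
  the list of the \<open>n \<times> n\<close> matrices by which the basis elements act. Up to isomorphism, every
  finite-dimensional algebra and module arises in this way.
\<close>

record 'k fd_alg =
  fdim :: nat
  sc :: "nat \<Rightarrow> nat \<Rightarrow> nat \<Rightarrow> 'k"
  un :: "nat \<Rightarrow> 'k"

definition is_fd_alg :: "'k::field fd_alg \<Rightarrow> bool" where
  "is_fd_alg R \<longleftrightarrow>
     (\<forall>h < fdim R. \<forall>i < fdim R. \<forall>j < fdim R. \<forall>m < fdim R.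
        (\<Sum>l < fdim R. sc R h i l * sc R l j m) = (\<Sum>l < fdim R. sc R i j l * sc R h l m)) \<and>
     (\<forall>j < fdim R. \<forall>m < fdim R.
        (\<Sum>i < fdim R. un R i * sc R i j m) = (if j = m then 1 else 0) \<and>
        (\<Sum>i < fdim R. un R i * sc R j i m) = (if j = m then 1 else 0))"

type_synonym 'k fd_mod = "nat \<times> 'k mat list"
type_synonym 'k fd_mod_arrow = "'k fd_mod \<times> 'k fd_mod \<times> 'k mat"

definition is_fd_mod :: "'k::field fd_alg \<Rightarrow> 'k fd_mod \<Rightarrow> bool" where
  "is_fd_mod R M \<longleftrightarrow> (case M of (n, \<rho>) \<Rightarrow>
     length \<rho> = fdim R \<and> (\<forall>i < fdim R. \<rho> ! i \<in> carrier_mat n n) \<and>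
     (\<forall>i < fdim R. \<forall>j < fdim R. \<forall>r < n. \<forall>s < n.
        (\<rho> ! i * \<rho> ! j) $$ (r, s) = (\<Sum>l < fdim R. sc R i j l * (\<rho> ! l) $$ (r, s))) \<and>
     (\<forall>r < n. \<forall>s < n.
        (\<Sum>i < fdim R. un R i * (\<rho> ! i) $$ (r, s)) = (if r = s then 1 else 0)))"

definition fd_mod_cat :: "'k::field fd_alg \<Rightarrow> ('k fd_mod, 'k fd_mod_arrow, 'k) lincat" where
  "fd_mod_cat R = \<lparr>
     Ob = {M. is_fd_mod R M},
     Ar = {(M, N, T). is_fd_mod R M \<and> is_fd_mod R N \<and> T \<in> carrier_mat (fst N) (fst M) \<and>
             (\<forall>i < fdim R. T * (snd M ! i) = (snd N ! i) * T)},
     Src = (\<lambda>(M, N, T). M),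
     Tgt = (\<lambda>(M, N, T). N),
     Idn = (\<lambda>M. (M, M, 1\<^sub>m (fst M))),
     Cmp = (\<lambda>(M', N', S) (M, N, T). (M, N', S * T)),
     Zer = (\<lambda>M N. (M, N, 0\<^sub>m (fst N) (fst M))),
     Add = (\<lambda>(M, N, S) (M', N', T). (M, N, S + T)),
     Scl = (\<lambda>c (M, N, T). (M, N, c \<cdot>\<^sub>m T)) \<rparr>"

definition finite_category :: "('o, 'a, 'k::field, 'z) lincat_scheme \<Rightarrow> bool" where
  "finite_category C \<longleftrightarrow> linear_category C \<and>
     (\<exists>R. is_fd_alg R \<and> equivalent_categories C (fd_mod_cat R))"


section \<open>Finite braided tensor categories\<close>

record ('o, 'a, 'k) moncat = "('o, 'a, 'k) lincat" +
  Unit :: 'o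
  TenO :: "'o \<Rightarrow> 'o \<Rightarrow> 'o"  (infixl "\<otimes>\<^sub>O\<index>" 75)
  TenA :: "'a \<Rightarrow> 'a \<Rightarrow> 'a"  (infixl "\<otimes>\<^sub>A\<index>" 75)

definition duality ::
  "('o, 'a, 'k, 'z) moncat_scheme \<Rightarrow> 'o \<Rightarrow> 'o \<Rightarrow> 'a \<Rightarrow> 'a \<Rightarrow> bool" where
  "duality C y x ev coev \<longleftrightarrow> x \<in> Ob C \<and> y \<in> Ob C \<and>
     ev \<in> Hom C (y \<otimes>\<^sub>O\<^bsub>C\<^esub> x) (Unit C) \<and> coev \<in> Hom C (Unit C) (x \<otimes>\<^sub>O\<^bsub>C\<^esub> y) \<and>
     (Idn C x \<otimes>\<^sub>A\<^bsub>C\<^esub> ev) \<cdot>\<^bsub>C\<^esub> (coev \<otimes>\<^sub>A\<^bsub>C\<^esub> Idn C x) = Idn C x \<and>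
     (ev \<otimes>\<^sub>A\<^bsub>C\<^esub> Idn C y) \<cdot>\<^bsub>C\<^esub> (Idn C y \<otimes>\<^sub>A\<^bsub>C\<^esub> coev) = Idn C y"

locale finite_tensor_category =
  fixes C :: "('o, 'a, 'k::field, 'z) moncat_scheme" (structure)
  assumes finite: "finite_category C"
    and tensor_bifunctor: "bilinear_bifunctor C C C (TenO C) (TenA C)"
    and unit_ob: "Unit C \<in> Ob C"
    and tensor_assoc_ob: "\<lbrakk>x \<in> Ob C; y \<in> Ob C; z \<in> Ob C\<rbrakk>
      \<Longrightarrow> (x \<otimes>\<^sub>O y) \<otimes>\<^sub>O z = x \<otimes>\<^sub>O (y \<otimes>\<^sub>O z)"
    and tensor_assoc_ar: "\<lbrakk>f \<in> Ar C; g \<in> Ar C; h \<in> Ar C\<rbrakk>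
      \<Longrightarrow> (f \<otimes>\<^sub>A g) \<otimes>\<^sub>A h = f \<otimes>\<^sub>A (g \<otimes>\<^sub>A h)"
    and tensor_unit_ob: "x \<in> Ob C \<Longrightarrow> Unit C \<otimes>\<^sub>O x = x \<and> x \<otimes>\<^sub>O Unit C = x"
    and tensor_unit_ar:
      "f \<in> Ar C \<Longrightarrow> Idn C (Unit C) \<otimes>\<^sub>A f = f \<and> f \<otimes>\<^sub>A Idn C (Unit C) = f"
    and left_dual: "x \<in> Ob C \<Longrightarrow> \<exists>y ev coev. duality C y x ev coev"
    and right_dual: "x \<in> Ob C \<Longrightarrow> \<exists>y ev coev. duality C x y ev coev"
    and unit_simple: "simple_object C (Unit C)"

record ('o, 'a, 'k) brmoncat = "('o, 'a, 'k) moncat" +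
  Brd :: "'o \<Rightarrow> 'o \<Rightarrow> 'a"

locale finite_braided_tensor_category = finite_tensor_category C
  for C :: "('o, 'a, 'k::field, 'z) brmoncat_scheme" (structure) +
  assumes braid_hom: "\<lbrakk>x \<in> Ob C; y \<in> Ob C\<rbrakk> \<Longrightarrow> Brd C x y \<in> Hom C (x \<otimes>\<^sub>O y) (y \<otimes>\<^sub>O x)"
    and braid_iso: "\<lbrakk>x \<in> Ob C; y \<in> Ob C\<rbrakk> \<Longrightarrow> is_iso C (Brd C x y)"
    and braid_natural: "\<lbrakk>f \<in> Hom C x x'; g \<in> Hom C y y'\<rbrakk>
      \<Longrightarrow> Brd C x' y' \<cdot> (f \<otimes>\<^sub>A g) = (g \<otimes>\<^sub>A f) \<cdot> Brd C x y"
    and hexagon1: "\<lbrakk>x \<in> Ob C; y \<in> Ob C; z \<in> Ob C\<rbrakk>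
      \<Longrightarrow> Brd C x (y \<otimes>\<^sub>O z) = (Idn C y \<otimes>\<^sub>A Brd C x z) \<cdot> (Brd C x y \<otimes>\<^sub>A Idn C z)"
    and hexagon2: "\<lbrakk>x \<in> Ob C; y \<in> Ob C; z \<in> Ob C\<rbrakk>
      \<Longrightarrow> Brd C (x \<otimes>\<^sub>O y) z = (Brd C x z \<otimes>\<^sub>A Idn C y) \<cdot> (Idn C x \<otimes>\<^sub>A Brd C y z)"


section \<open>Module categories\<close>

text \<open>
  The associator is directed as \<open>l\<^sub>X\<^sub>,\<^sub>Y\<^sub>,\<^sub>m : X \<rhd> (Y \<rhd> m) \<rightarrow> (X \<otimes> Y) \<rhd> m\<close>, the unit constraint
  as \<open>1 \<rhd> m \<rightarrow> m\<close>.
\<close>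

record ('n, 'b, 'k, 'o, 'a) modcat = "('n, 'b, 'k) lincat" +
  ActO :: "'o \<Rightarrow> 'n \<Rightarrow> 'n"  (infixr "\<rhd>\<^sub>O\<index>" 72)
  ActA :: "'a \<Rightarrow> 'b \<Rightarrow> 'b"  (infixr "\<rhd>\<^sub>A\<index>" 72)
  Asc :: "'o \<Rightarrow> 'o \<Rightarrow> 'n \<Rightarrow> 'b"
  Unt :: "'n \<Rightarrow> 'b"

locale module_category =
  fixes C :: "('o, 'a, 'k::field, 'z) moncat_scheme"
    and M :: "('n, 'b, 'k, 'o, 'a, 'y) modcat_scheme" (structure)
  assumes finite: "finite_category M"
    and action_biexact: "biexact C M M (ActO M) (ActA M)"
    and asc_hom: "\<lbrakk>X \<in> Ob C; Y \<in> Ob C; m \<in> Ob M\<rbrakk>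
      \<Longrightarrow> Asc M X Y m \<in> Hom M (X \<rhd>\<^sub>O (Y \<rhd>\<^sub>O m)) ((X \<otimes>\<^sub>O\<^bsub>C\<^esub> Y) \<rhd>\<^sub>O m)"
    and asc_iso: "\<lbrakk>X \<in> Ob C; Y \<in> Ob C; m \<in> Ob M\<rbrakk> \<Longrightarrow> is_iso M (Asc M X Y m)"
    and asc_natural: "\<lbrakk>f \<in> Hom C X X'; g \<in> Hom C Y Y'; h \<in> Hom M m m'\<rbrakk>
      \<Longrightarrow> Asc M X' Y' m' \<cdot> (f \<rhd>\<^sub>A (g \<rhd>\<^sub>A h)) = ((f \<otimes>\<^sub>A\<^bsub>C\<^esub> g) \<rhd>\<^sub>A h) \<cdot> Asc M X Y m"
    and unt_hom: "m \<in> Ob M \<Longrightarrow> Unt M m \<in> Hom M (Unit C \<rhd>\<^sub>O m) m"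
    and unt_iso: "m \<in> Ob M \<Longrightarrow> is_iso M (Unt M m)"
    and unt_natural: "h \<in> Hom M m m'
      \<Longrightarrow> Unt M m' \<cdot> (Idn C (Unit C) \<rhd>\<^sub>A h) = h \<cdot> Unt M m"
    and pentagon: "\<lbrakk>X \<in> Ob C; Y \<in> Ob C; Z \<in> Ob C; m \<in> Ob M\<rbrakk>
      \<Longrightarrow> Asc M (X \<otimes>\<^sub>O\<^bsub>C\<^esub> Y) Z m \<cdot> Asc M X Y (Z \<rhd>\<^sub>O m)
        = Asc M X (Y \<otimes>\<^sub>O\<^bsub>C\<^esub> Z) m \<cdot> (Idn C X \<rhd>\<^sub>A Asc M Y Z m)"
    and triangle: "\<lbrakk>X \<in> Ob C; m \<in> Ob M\<rbrakk>
      \<Longrightarrow> Idn C X \<rhd>\<^sub>A Unt M m = Asc M X (Unit C) m"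

definition exact_module_category ::
  "('o, 'a, 'k::field, 'z) moncat_scheme \<Rightarrow> ('n, 'b, 'k, 'o, 'a, 'y) modcat_scheme \<Rightarrow> bool" where
  "exact_module_category C M \<longleftrightarrow> module_category C M \<and>
     (\<forall>p m. projective_object C p \<and> m \<in> Ob M \<longrightarrow> projective_object M (p \<rhd>\<^sub>O\<^bsub>M\<^esub> m))"


section \<open>Relative Deligne products\<close>

text \<open>
  A left module category \<open>N\<close> is viewed as a right one by \<open>n \<lhd> X = X \<rhd> n\<close>, with associator
  \<open>(n \<lhd> X) \<lhd> Y \<rightarrow> n \<lhd> (X \<otimes> Y)\<close>.
\<close>

definition right_asc ::
  "('o, 'a, 'k, 'z) brmoncat_scheme \<Rightarrow> ('n, 'b, 'k, 'o, 'a, 'y) modcat_scheme \<Rightarrow>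
   'n \<Rightarrow> 'o \<Rightarrow> 'o \<Rightarrow> 'b" where
  "right_asc C N n X Y = (Brd C Y X \<rhd>\<^sub>A\<^bsub>N\<^esub> Idn N n) \<cdot>\<^bsub>N\<^esub> Asc N Y X n"

text \<open>
  The constraint \<open>X \<rhd> (n \<lhd> Y) \<rightarrow> (X \<rhd> n) \<lhd> Y\<close> by which the endofunctor \<open>X \<rhd> _\<close> of \<open>N\<close>
  commutes with the right action, as the composite
  \<open>X \<rhd> (Y \<rhd> n) \<rightarrow> (X \<otimes> Y) \<rhd> n = n \<lhd> (X \<otimes> Y) \<rightarrow> (n \<lhd> X) \<lhd> Y\<close>.
  Up to associators it is the inverse of the braiding of \<open>Y\<close> and \<open>X\<close>. With this choice the action
  induced on right \<open>B \<otimes> A\<close>-modules, where \<open>B \<otimes> A\<close> is multiplied by means of the braiding of \<open>A\<close>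
  and \<open>B\<close>, is the usual \<open>X \<rhd> V = X \<otimes> V\<close>.
\<close>

definition mid_asc ::
  "('o, 'a, 'k, 'z) brmoncat_scheme \<Rightarrow> ('n, 'b, 'k, 'o, 'a, 'y) modcat_scheme \<Rightarrow>
   'o \<Rightarrow> 'n \<Rightarrow> 'o \<Rightarrow> 'b" where
  "mid_asc C N X n Y = inv_arrow N (right_asc C N n X Y) \<cdot>\<^bsub>N\<^esub> Asc N X Y n"

text \<open>
  A balanced functor has a balancing \<open>b\<^sub>n\<^sub>,\<^sub>X\<^sub>,\<^sub>m : G (n \<lhd> X, m) \<rightarrow> G (n, X \<rhd> m)\<close>.
\<close>

definition balanced_functor ::
  "('o, 'a, 'k, 'z) brmoncat_scheme \<Rightarrow> ('n, 'b, 'k, 'o, 'a, 'y) modcat_scheme \<Rightarrow>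
   ('m, 'c, 'k, 'o, 'a, 'x) modcat_scheme \<Rightarrow> ('d, 'e, 'k, 'w) lincat_scheme \<Rightarrow>
   ('n \<Rightarrow> 'm \<Rightarrow> 'd) \<Rightarrow> ('b \<Rightarrow> 'c \<Rightarrow> 'e) \<Rightarrow> ('n \<Rightarrow> 'o \<Rightarrow> 'm \<Rightarrow> 'e) \<Rightarrow> bool" where
  "balanced_functor C N M D GO GA b \<longleftrightarrow>
     right_biexact N M D GO GA \<and>
     (\<forall>n \<in> Ob N. \<forall>X \<in> Ob C. \<forall>m \<in> Ob M.
        b n X m \<in> Hom D (GO (X \<rhd>\<^sub>O\<^bsub>N\<^esub> n) m) (GO n (X \<rhd>\<^sub>O\<^bsub>M\<^esub> m)) \<and> is_iso D (b n X m)) \<and>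
     (\<forall>n n' X X' m m'. \<forall>f \<in> Hom N n n'. \<forall>g \<in> Hom C X X'. \<forall>h \<in> Hom M m m'.
        b n' X' m' \<cdot>\<^bsub>D\<^esub> GA (g \<rhd>\<^sub>A\<^bsub>N\<^esub> f) h = GA f (g \<rhd>\<^sub>A\<^bsub>M\<^esub> h) \<cdot>\<^bsub>D\<^esub> b n X m) \<and>
     (\<forall>n \<in> Ob N. \<forall>X \<in> Ob C. \<forall>Y \<in> Ob C. \<forall>m \<in> Ob M.
        b n (X \<otimes>\<^sub>O\<^bsub>C\<^esub> Y) m \<cdot>\<^bsub>D\<^esub> GA (right_asc C N n X Y) (Idn M m)
        = GA (Idn N n) (Asc M X Y m) \<cdot>\<^bsub>D\<^esub> b n X (Y \<rhd>\<^sub>O\<^bsub>M\<^esub> m) \<cdot>\<^bsub>D\<^esub> b (X \<rhd>\<^sub>O\<^bsub>N\<^esub> n) Y m) \<and>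
     (\<forall>n \<in> Ob N. \<forall>m \<in> Ob M.
        GA (Idn N n) (Unt M m) \<cdot>\<^bsub>D\<^esub> b n (Unit C) m = GA (Unt N n) (Idn M m))"

definition balanced_trans ::
  "('o, 'a, 'k, 'z) brmoncat_scheme \<Rightarrow> ('n, 'b, 'k, 'o, 'a, 'y) modcat_scheme \<Rightarrow>
   ('m, 'c, 'k, 'o, 'a, 'x) modcat_scheme \<Rightarrow> ('d, 'e, 'k, 'w) lincat_scheme \<Rightarrow>
   ('n \<Rightarrow> 'm \<Rightarrow> 'd) \<Rightarrow> ('b \<Rightarrow> 'c \<Rightarrow> 'e) \<Rightarrow> ('n \<Rightarrow> 'o \<Rightarrow> 'm \<Rightarrow> 'e) \<Rightarrow>
   ('n \<Rightarrow> 'm \<Rightarrow> 'd) \<Rightarrow> ('b \<Rightarrow> 'c \<Rightarrow> 'e) \<Rightarrow> ('n \<Rightarrow> 'o \<Rightarrow> 'm \<Rightarrow> 'e) \<Rightarrow>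
   ('n \<Rightarrow> 'm \<Rightarrow> 'e) \<Rightarrow> bool" where
  "balanced_trans C N M D GO GA b HO HA c t \<longleftrightarrow>
     (\<forall>n \<in> Ob N. \<forall>m \<in> Ob M. t n m \<in> Hom D (GO n m) (HO n m)) \<and>
     (\<forall>n n' m m'. \<forall>f \<in> Hom N n n'. \<forall>h \<in> Hom M m m'.
        t n' m' \<cdot>\<^bsub>D\<^esub> GA f h = HA f h \<cdot>\<^bsub>D\<^esub> t n m) \<and>
     (\<forall>n \<in> Ob N. \<forall>X \<in> Ob C. \<forall>m \<in> Ob M.
        c n X m \<cdot>\<^bsub>D\<^esub> t (X \<rhd>\<^sub>O\<^bsub>N\<^esub> n) m = t n (X \<rhd>\<^sub>O\<^bsub>M\<^esub> m) \<cdot>\<^bsub>D\<^esub> b n X m)"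

text \<open>
  Universality of a balanced functor \<open>B : N \<times> M \<rightarrow> P\<close>: for each finite category \<open>D\<close>, composition
  with \<open>B\<close> is an equivalence from right exact functors \<open>P \<rightarrow> D\<close> to balanced functors
  \<open>N \<times> M \<rightarrow> D\<close>. The two conjuncts under the quantifier over \<open>D\<close> are essential surjectivity and
  full faithfulness. HOL cannot quantify over the types of \<open>D\<close> here. The types of \<open>fd_mod_cat\<close>
  lose nothing, since by definition every finite category is equivalent to one on these types.
\<close>

definition universal_balanced ::
  "('o, 'a, 'k::field, 'z) brmoncat_scheme \<Rightarrow> ('n, 'b, 'k, 'o, 'a, 'y) modcat_scheme \<Rightarrow>
   ('m, 'c, 'k, 'o, 'a, 'x) modcat_scheme \<Rightarrow> ('p, 'q, 'k, 'w) lincat_scheme \<Rightarrow>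
   ('n \<Rightarrow> 'm \<Rightarrow> 'p) \<Rightarrow> ('b \<Rightarrow> 'c \<Rightarrow> 'q) \<Rightarrow> ('n \<Rightarrow> 'o \<Rightarrow> 'm \<Rightarrow> 'q) \<Rightarrow> bool" where
  "universal_balanced C N M P BO BA b \<longleftrightarrow>
     finite_category P \<and> balanced_functor C N M P BO BA b \<and>
     (\<forall>D :: ('k fd_mod, 'k fd_mod_arrow, 'k) lincat. finite_category D \<longrightarrow>
        (\<forall>GO GA g. balanced_functor C N M D GO GA g \<longrightarrow>
           (\<exists>FO FA t. right_exact_functor P D FO FA \<and>
              balanced_trans C N M D
                (\<lambda>n m. FO (BO n m)) (\<lambda>f h. FA (BA f h)) (\<lambda>n X m. FA (b n X m)) GO GA g t \<and>
              (\<forall>n \<in> Ob N. \<forall>m \<in> Ob M. is_iso D (t n m)))) \<and>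
        (\<forall>FO FA FO' FA' t. right_exact_functor P D FO FA \<and> right_exact_functor P D FO' FA' \<and>
           balanced_trans C N M D
             (\<lambda>n m. FO (BO n m)) (\<lambda>f h. FA (BA f h)) (\<lambda>n X m. FA (b n X m))
             (\<lambda>n m. FO' (BO n m)) (\<lambda>f h. FA' (BA f h)) (\<lambda>n X m. FA' (b n X m)) t \<longrightarrow>
           (\<exists>s. natural_trans P D FO FA FO' FA' s \<and>
              (\<forall>n \<in> Ob N. \<forall>m \<in> Ob M. s (BO n m) = t n m) \<and>
              (\<forall>s'. natural_trans P D FO FA FO' FA' s' \<and>
                 (\<forall>n \<in> Ob N. \<forall>m \<in> Ob M. s' (BO n m) = t n m) \<longrightarrow>
                 (\<forall>p \<in> Ob P. s' p = s p)))))"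

text \<open>
  The left action on the product is induced by the one on \<open>N\<close> through
  \<open>s\<^sub>X\<^sub>,\<^sub>n\<^sub>,\<^sub>m : X \<rhd> B (n, m) \<rightarrow> B (X \<rhd> n, m)\<close>, compatible with the module constraints and,
  in the last conjunct, with the balancing.
\<close>

definition induced_action ::
  "('o, 'a, 'k, 'z) brmoncat_scheme \<Rightarrow> ('n, 'b, 'k, 'o, 'a, 'y) modcat_scheme \<Rightarrow>
   ('m, 'c, 'k, 'o, 'a, 'x) modcat_scheme \<Rightarrow> ('p, 'q, 'k, 'o, 'a, 'w) modcat_scheme \<Rightarrow>
   ('n \<Rightarrow> 'm \<Rightarrow> 'p) \<Rightarrow> ('b \<Rightarrow> 'c \<Rightarrow> 'q) \<Rightarrow> ('n \<Rightarrow> 'o \<Rightarrow> 'm \<Rightarrow> 'q) \<Rightarrow>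
   ('o \<Rightarrow> 'n \<Rightarrow> 'm \<Rightarrow> 'q) \<Rightarrow> bool" where
  "induced_action C N M P BO BA b s \<longleftrightarrow>
     (\<forall>X \<in> Ob C. \<forall>n \<in> Ob N. \<forall>m \<in> Ob M.
        s X n m \<in> Hom P (X \<rhd>\<^sub>O\<^bsub>P\<^esub> BO n m) (BO (X \<rhd>\<^sub>O\<^bsub>N\<^esub> n) m) \<and> is_iso P (s X n m)) \<and>
     (\<forall>X X' n n' m m'. \<forall>g \<in> Hom C X X'. \<forall>f \<in> Hom N n n'. \<forall>h \<in> Hom M m m'.
        s X' n' m' \<cdot>\<^bsub>P\<^esub> (g \<rhd>\<^sub>A\<^bsub>P\<^esub> BA f h) = BA (g \<rhd>\<^sub>A\<^bsub>N\<^esub> f) h \<cdot>\<^bsub>P\<^esub> s X n m) \<and>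
     (\<forall>X \<in> Ob C. \<forall>Y \<in> Ob C. \<forall>n \<in> Ob N. \<forall>m \<in> Ob M.
        BA (Asc N X Y n) (Idn M m) \<cdot>\<^bsub>P\<^esub> s X (Y \<rhd>\<^sub>O\<^bsub>N\<^esub> n) m \<cdot>\<^bsub>P\<^esub> (Idn C X \<rhd>\<^sub>A\<^bsub>P\<^esub> s Y n m)
        = s (X \<otimes>\<^sub>O\<^bsub>C\<^esub> Y) n m \<cdot>\<^bsub>P\<^esub> Asc P X Y (BO n m)) \<and>
     (\<forall>n \<in> Ob N. \<forall>m \<in> Ob M.
        BA (Unt N n) (Idn M m) \<cdot>\<^bsub>P\<^esub> s (Unit C) n m = Unt P (BO n m)) \<and>
     (\<forall>X \<in> Ob C. \<forall>Y \<in> Ob C. \<forall>n \<in> Ob N. \<forall>m \<in> Ob M.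
        b (X \<rhd>\<^sub>O\<^bsub>N\<^esub> n) Y m \<cdot>\<^bsub>P\<^esub> BA (mid_asc C N X n Y) (Idn M m) \<cdot>\<^bsub>P\<^esub> s X (Y \<rhd>\<^sub>O\<^bsub>N\<^esub> n) m
        = s X n (Y \<rhd>\<^sub>O\<^bsub>M\<^esub> m) \<cdot>\<^bsub>P\<^esub> (Idn C X \<rhd>\<^sub>A\<^bsub>P\<^esub> b n Y m))"

definition relative_deligne_product ::
  "('o, 'a, 'k::field, 'z) brmoncat_scheme \<Rightarrow> ('n, 'b, 'k, 'o, 'a, 'y) modcat_scheme \<Rightarrow>
   ('m, 'c, 'k, 'o, 'a, 'x) modcat_scheme \<Rightarrow> ('p, 'q, 'k, 'o, 'a, 'w) modcat_scheme \<Rightarrow> bool"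
  where
  "relative_deligne_product C N M P \<longleftrightarrow> module_category C P \<and>
     (\<exists>BO BA b s. universal_balanced C N M P BO BA b \<and> induced_action C N M P BO BA b s)"

text \<open>
  The relative product is determined up to equivalence, so \<open>P\<close> ranges over all its realisations.
  HOL definitions cannot quantify over types. The type argument fixes those of the objects and
  arrows of \<open>N\<close> and \<open>P\<close>; in a conclusion with free type variables it is universally quantified.
\<close>

definition fully_exact ::
  "('n \<times> 'b \<times> 'p \<times> 'q) itself \<Rightarrow> ('o, 'a, 'k::field, 'z) brmoncat_scheme \<Rightarrow>
   ('m, 'c, 'k, 'o, 'a, 'x) modcat_scheme \<Rightarrow> bool" where
  "fully_exact \<tau> C M \<longleftrightarrow>
     (\<forall>(N :: ('n, 'b, 'k, 'o, 'a) modcat) (P :: ('p, 'q, 'k, 'o, 'a) modcat).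
        exact_module_category C N \<and> relative_deligne_product C N M P \<longrightarrow>
        exact_module_category C P)"


section \<open>Algebras and their modules\<close>

record ('o, 'a) alg =
  Carr :: 'o
  Mul :: 'a
  One :: 'a

definition is_algebra :: "('o, 'a, 'k, 'z) moncat_scheme \<Rightarrow> ('o, 'a) alg \<Rightarrow> bool" where
  "is_algebra C A \<longleftrightarrow> Carr A \<in> Ob C \<and>
     Mul A \<in> Hom C (Carr A \<otimes>\<^sub>O\<^bsub>C\<^esub> Carr A) (Carr A) \<and> One A \<in> Hom C (Unit C) (Carr A) \<and>
     Mul A \<cdot>\<^bsub>C\<^esub> (Mul A \<otimes>\<^sub>A\<^bsub>C\<^esub> Idn C (Carr A)) = Mul A \<cdot>\<^bsub>C\<^esub> (Idn C (Carr A) \<otimes>\<^sub>A\<^bsub>C\<^esub> Mul A) \<and>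
     Mul A \<cdot>\<^bsub>C\<^esub> (One A \<otimes>\<^sub>A\<^bsub>C\<^esub> Idn C (Carr A)) = Idn C (Carr A) \<and>
     Mul A \<cdot>\<^bsub>C\<^esub> (Idn C (Carr A) \<otimes>\<^sub>A\<^bsub>C\<^esub> One A) = Idn C (Carr A)"

definition is_right_module ::
  "('o, 'a, 'k, 'z) moncat_scheme \<Rightarrow> ('o, 'a) alg \<Rightarrow> 'o \<times> 'a \<Rightarrow> bool" where
  "is_right_module C A V \<longleftrightarrow> (case V of (v, r) \<Rightarrow>
     v \<in> Ob C \<and> r \<in> Hom C (v \<otimes>\<^sub>O\<^bsub>C\<^esub> Carr A) v \<and>
     r \<cdot>\<^bsub>C\<^esub> (r \<otimes>\<^sub>A\<^bsub>C\<^esub> Idn C (Carr A)) = r \<cdot>\<^bsub>C\<^esub> (Idn C v \<otimes>\<^sub>A\<^bsub>C\<^esub> Mul A) \<and>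
     r \<cdot>\<^bsub>C\<^esub> (Idn C v \<otimes>\<^sub>A\<^bsub>C\<^esub> One A) = Idn C v)"

definition right_module_hom ::
  "('o, 'a, 'k, 'z) moncat_scheme \<Rightarrow> ('o, 'a) alg \<Rightarrow> 'o \<times> 'a \<Rightarrow> 'o \<times> 'a \<Rightarrow> 'a set" where
  "right_module_hom C A V W = {f \<in> Hom C (fst V) (fst W).
     f \<cdot>\<^bsub>C\<^esub> snd V = snd W \<cdot>\<^bsub>C\<^esub> (f \<otimes>\<^sub>A\<^bsub>C\<^esub> Idn C (Carr A))}"

definition right_modules ::
  "('o, 'a, 'k, 'z) moncat_scheme \<Rightarrow> ('o, 'a) alg \<Rightarrow>
   ('o \<times> 'a, ('o \<times> 'a) \<times> ('o \<times> 'a) \<times> 'a, 'k, 'o, 'a) modcat" where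
  "right_modules C A = \<lparr>
     Ob = {V. is_right_module C A V},
     Ar = {(V, W, f). is_right_module C A V \<and> is_right_module C A W \<and>
             f \<in> right_module_hom C A V W},
     Src = (\<lambda>(V, W, f). V),
     Tgt = (\<lambda>(V, W, f). W),
     Idn = (\<lambda>V. (V, V, Idn C (fst V))),
     Cmp = (\<lambda>(V', W', g) (V, W, f). (V, W', g \<cdot>\<^bsub>C\<^esub> f)),
     Zer = (\<lambda>V W. (V, W, Zer C (fst V) (fst W))),
     Add = (\<lambda>(V, W, f) (V', W', g). (V, W, Add C f g)),
     Scl = (\<lambda>c (V, W, f). (V, W, Scl C c f)),
     ActO = (\<lambda>X (v, r). (X \<otimes>\<^sub>O\<^bsub>C\<^esub> v, Idn C X \<otimes>\<^sub>A\<^bsub>C\<^esub> r)),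
     ActA = (\<lambda>g ((v, r), (w, r'), f).
        ((Src C g \<otimes>\<^sub>O\<^bsub>C\<^esub> v, Idn C (Src C g) \<otimes>\<^sub>A\<^bsub>C\<^esub> r),
         (Tgt C g \<otimes>\<^sub>O\<^bsub>C\<^esub> w, Idn C (Tgt C g) \<otimes>\<^sub>A\<^bsub>C\<^esub> r'), g \<otimes>\<^sub>A\<^bsub>C\<^esub> f)),
     Asc = (\<lambda>X Y (v, r).
        let W = ((X \<otimes>\<^sub>O\<^bsub>C\<^esub> Y) \<otimes>\<^sub>O\<^bsub>C\<^esub> v, Idn C (X \<otimes>\<^sub>O\<^bsub>C\<^esub> Y) \<otimes>\<^sub>A\<^bsub>C\<^esub> r) in (W, W, Idn C (fst W))),
     Unt = (\<lambda>V. (V, V, Idn C (fst V))) \<rparr>"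

definition fully_exact_algebra ::
  "('n \<times> 'b \<times> 'p \<times> 'q) itself \<Rightarrow> ('o, 'a, 'k::field, 'z) brmoncat_scheme \<Rightarrow>
   ('o, 'a) alg \<Rightarrow> bool" where
  "fully_exact_algebra \<tau> C A \<longleftrightarrow> fully_exact \<tau> C (right_modules C A)"

record ('o, 'a) bimod =
  BCarr :: 'o
  LAct :: 'a
  RAct :: 'a

definition is_bimodule ::
  "('o, 'a, 'k, 'z) moncat_scheme \<Rightarrow> ('o, 'a) alg \<Rightarrow> ('o, 'a) bimod \<Rightarrow> bool" where
  "is_bimodule C A V \<longleftrightarrow> is_right_module C A (BCarr V, RAct V) \<and>
     LAct V \<in> Hom C (Carr A \<otimes>\<^sub>O\<^bsub>C\<^esub> BCarr V) (BCarr V) \<and>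
     LAct V \<cdot>\<^bsub>C\<^esub> (Idn C (Carr A) \<otimes>\<^sub>A\<^bsub>C\<^esub> LAct V) = LAct V \<cdot>\<^bsub>C\<^esub> (Mul A \<otimes>\<^sub>A\<^bsub>C\<^esub> Idn C (BCarr V)) \<and>
     LAct V \<cdot>\<^bsub>C\<^esub> (One A \<otimes>\<^sub>A\<^bsub>C\<^esub> Idn C (BCarr V)) = Idn C (BCarr V) \<and>
     RAct V \<cdot>\<^bsub>C\<^esub> (LAct V \<otimes>\<^sub>A\<^bsub>C\<^esub> Idn C (Carr A)) = LAct V \<cdot>\<^bsub>C\<^esub> (Idn C (Carr A) \<otimes>\<^sub>A\<^bsub>C\<^esub> RAct V)"

definition bimodule_hom ::
  "('o, 'a, 'k, 'z) moncat_scheme \<Rightarrow> ('o, 'a) alg \<Rightarrow> ('o, 'a) bimod \<Rightarrow> ('o, 'a) bimod \<Rightarrow> 'a set"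
  where
  "bimodule_hom C A V W = {f \<in> Hom C (BCarr V) (BCarr W).
     f \<cdot>\<^bsub>C\<^esub> LAct V = LAct W \<cdot>\<^bsub>C\<^esub> (Idn C (Carr A) \<otimes>\<^sub>A\<^bsub>C\<^esub> f) \<and>
     f \<cdot>\<^bsub>C\<^esub> RAct V = RAct W \<cdot>\<^bsub>C\<^esub> (f \<otimes>\<^sub>A\<^bsub>C\<^esub> Idn C (Carr A))}"

definition bimodule_summand ::
  "('o, 'a, 'k, 'z) moncat_scheme \<Rightarrow> ('o, 'a) alg \<Rightarrow> ('o, 'a) bimod \<Rightarrow> ('o, 'a) bimod \<Rightarrow> bool"
  where
  "bimodule_summand C A U V \<longleftrightarrow> is_bimodule C A U \<and> is_bimodule C A V \<and>
     (\<exists>W i p j q. is_bimodule C A W \<and>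
        i \<in> bimodule_hom C A U V \<and> p \<in> bimodule_hom C A V U \<and>
        j \<in> bimodule_hom C A W V \<and> q \<in> bimodule_hom C A V W \<and>
        p \<cdot>\<^bsub>C\<^esub> i = Idn C (BCarr U) \<and> q \<cdot>\<^bsub>C\<^esub> j = Idn C (BCarr W) \<and>
        Add C (i \<cdot>\<^bsub>C\<^esub> p) (j \<cdot>\<^bsub>C\<^esub> q) = Idn C (BCarr V))"

definition regular_bimodule :: "('o, 'a) alg \<Rightarrow> ('o, 'a) bimod" where
  "regular_bimodule A = \<lparr>BCarr = Carr A, LAct = Mul A, RAct = Mul A\<rparr>"

definition induced_bimodule ::
  "('o, 'a, 'k, 'z) moncat_scheme \<Rightarrow> ('o, 'a) alg \<Rightarrow> 'o \<Rightarrow> ('o, 'a) bimod" where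
  "induced_bimodule C A X = \<lparr>
     BCarr = Carr A \<otimes>\<^sub>O\<^bsub>C\<^esub> X \<otimes>\<^sub>O\<^bsub>C\<^esub> Carr A,
     LAct = Mul A \<otimes>\<^sub>A\<^bsub>C\<^esub> Idn C X \<otimes>\<^sub>A\<^bsub>C\<^esub> Idn C (Carr A),
     RAct = Idn C (Carr A) \<otimes>\<^sub>A\<^bsub>C\<^esub> Idn C X \<otimes>\<^sub>A\<^bsub>C\<^esub> Mul A\<rparr>"

definition relatively_projective ::
  "('o, 'a, 'k, 'z) moncat_scheme \<Rightarrow> ('o, 'a) alg \<Rightarrow> bool" where
  "relatively_projective C A \<longleftrightarrow>
     (\<exists>X \<in> Ob C. bimodule_summand C A (regular_bimodule A) (induced_bimodule C A X))"

definition tensor_square_bimodule ::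
  "('o, 'a, 'k, 'z) moncat_scheme \<Rightarrow> ('o, 'a) alg \<Rightarrow> ('o, 'a) bimod" where
  "tensor_square_bimodule C A = \<lparr>
     BCarr = Carr A \<otimes>\<^sub>O\<^bsub>C\<^esub> Carr A,
     LAct = Mul A \<otimes>\<^sub>A\<^bsub>C\<^esub> Idn C (Carr A),
     RAct = Idn C (Carr A) \<otimes>\<^sub>A\<^bsub>C\<^esub> Mul A\<rparr>"

definition separable :: "('o, 'a, 'k, 'z) moncat_scheme \<Rightarrow> ('o, 'a) alg \<Rightarrow> bool" where
  "separable C A \<longleftrightarrow>
     (\<exists>s \<in> bimodule_hom C A (regular_bimodule A) (tensor_square_bimodule C A).
        Mul A \<cdot>\<^bsub>C\<^esub> s = Idn C (Carr A))"

end

theory Submission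
  imports Defs
begin

text \<open>
  A relatively projective algebra is separable: a bimodule map \<open>a \<otimes> X \<otimes> a \<rightarrow> a\<close> factors through
  the multiplication \<open>a \<otimes> a \<rightarrow> a\<close>. Let \<open>P\<close> be a relative Deligne product \<open>N \<boxtimes> mod-A\<close> with
  balanced functor \<open>B\<close>. The balanced functor \<open>(n, v) \<mapsto> v \<rhd> n\<close> induces a right exact functor
  \<open>U : P \<rightarrow> N\<close> whose left adjoint is \<open>F = B (_, A)\<close>. So \<open>F\<close> preserves projective objects. If \<open>A\<close>
  is separable, then the action maps \<open>v \<otimes> a \<rightarrow> v\<close> have natural sections, and full faithfulness in
  the universal property turns these into a section of the counit \<open>F \<circ> U \<rightarrow> Id\<close>. For \<open>q\<close> projective
  in \<open>C\<close> and \<open>p\<close> in \<open>P\<close>, the object \<open>q \<rhd> p\<close> is thus a retract of \<open>q \<rhd> F (U p) \<cong> F (q \<rhd> U p)\<close>, which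
  is projective because \<open>N\<close> is exact.
\<close>

section \<open>Linear categories\<close>

text \<open>The obstacle is that \<open>P\<close> is known only through its universal property: its
  objects need not have the form \<open>BO n m\<close>, so nothing can be defined or checked on them
  directly. Natural transformations on \<open>P\<close> are therefore prescribed on the objects
  \<open>BO n m\<close>, subject to compatibility with the balancing, and equations between them
  follow from the uniqueness half of full faithfulness. The balancing is the reason why the action
  maps and their sections must commute with the action of \<open>C\<close>.

  On \<open>BO n v\<close> the composite of \<open>U\<close> and \<open>F\<close> is
  \<open>B (v \<rhd> n, A)\<close>, which the balancing identifies with
  \<open>B (n, v \<otimes> A)\<close>; hence a counit induced by the action of \<open>A\<close> on
  \<open>v\<close>. That \<open>(n, v) \<mapsto> v \<rhd> n\<close> is balanced rests on the
  pentagon of \<open>N\<close> and the Yang-Baxter equation; that it is right exact in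
  \<open>v\<close> rests on a left dual of \<open>A\<close>. For \<open>F\<close> to preserve
  projectives, \<open>U\<close> must preserve epimorphisms, which right exactness gives because an
  epimorphism is an arrow whose cokernel is zero; of the adjunction, the counit, a unit arrow at
  each projective object and one triangle identity are enough.\<close>

lemma Hom_iff: "f \<in> Hom C x y \<longleftrightarrow> f \<in> Ar C \<and> Src C f = x \<and> Tgt C f = y"
  by (simp add: Hom_def)

context linear_category
begin

lemma id_simps [simp]:
  assumes "x \<in> Ob C"
  shows "Idn C x \<in> Ar C" "Src C (Idn C x) = x" "Tgt C (Idn C x) = x"
  using id_hom[OF assms] by (simp_all add: Hom_iff)

lemma ob_simps [simp]:
  assumes "f \<in> Ar C"
  shows "Src C f \<in> Ob C" "Tgt C f \<in> Ob C"
  using assms src_ob tgt_ob by simp_all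

lemma comp_simps [simp]:
  assumes "f \<in> Ar C" "g \<in> Ar C" "Tgt C f = Src C g"
  shows "g \<cdot> f \<in> Ar C" "Src C (g \<cdot> f) = Src C f" "Tgt C (g \<cdot> f) = Tgt C g"
  using comp_hom[of f "Src C f" "Tgt C f" g "Tgt C g"] assms by (simp_all add: Hom_iff)

lemma comp_assoc_ar [simp]:
  assumes "f \<in> Ar C" "g \<in> Ar C" "h \<in> Ar C" "Tgt C f = Src C g" "Tgt C g = Src C h"
  shows "(h \<cdot> g) \<cdot> f = h \<cdot> (g \<cdot> f)"
  using comp_assoc[of f "Src C f" "Tgt C f" g "Tgt C g" h "Tgt C h"] assms
  by (simp add: Hom_iff)

lemma comp_id [simp]:
  assumes "f \<in> Ar C"
  shows "Src C f = x \<Longrightarrow> f \<cdot> Idn C x = f" "Tgt C f = y \<Longrightarrow> Idn C y \<cdot> f = f"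
  using assms comp_id_right[of f "Src C f" "Tgt C f"] comp_id_left[of f "Src C f" "Tgt C f"]
  by (auto simp: Hom_iff)

lemma zero_simps [simp]:
  assumes "x \<in> Ob C" "y \<in> Ob C"
  shows "Zer C x y \<in> Ar C" "Src C (Zer C x y) = x" "Tgt C (Zer C x y) = y"
  using zero_hom[OF assms] by (simp_all add: Hom_iff)

lemma hom_ob: "f \<in> Hom C x y \<Longrightarrow> x \<in> Ob C \<and> y \<in> Ob C"
  by (auto simp: Hom_iff)

text \<open>Source of all rules about zero arrows. The axioms give additivity and scaling of
  composition; \<open>0 f + 0 f = 0 f\<close> identifies the multiple by 0 with \<open>Zer\<close>,
  and composition with zero arrows then reduces to scaling.\<close>

lemma add_idem_zero:
  assumes f: "f \<in> Hom C x y" and "Add C f f = f"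
  shows "f = Zer C x y"
proof -
  obtain g where g: "g \<in> Hom C x y" "Add C f g = Zer C x y"
    using add_neg[OF f] by blast
  have "Add C (Add C f f) g = f"
    using add_assoc[OF f f g(1)] g(2) add_zero[OF f] by simp
  then show ?thesis
    using assms g(2) by simp
qed

lemma scale_zero: "f \<in> Hom C x y \<Longrightarrow> Scl C 0 f = Zer C x y"
  using add_idem_zero[OF scale_hom[of f x y 0]] add_scale[of f x y 0 0] by simp

lemma comp_zero_right:
  assumes "g \<in> Hom C y z" "x \<in> Ob C"
  shows "g \<cdot> Zer C x y = Zer C x z"
proof -
  have z: "Zer C x y \<in> Hom C x y"
    using assms hom_ob[of g] by (simp add: zero_hom)
  show ?thesis
    using comp_scale_right[OF z assms(1), of 0] scale_zero[OF z] scale_zero[OF comp_hom[OF z assms(1)]]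
    by simp
qed

lemma comp_zero_left:
  assumes "f \<in> Hom C x y" "z \<in> Ob C"
  shows "Zer C y z \<cdot> f = Zer C x z"
proof -
  have z: "Zer C y z \<in> Hom C y z"
    using assms hom_ob[of f] by (simp add: zero_hom)
  show ?thesis
    using comp_scale_left[OF assms(1) z, of 0] scale_zero[OF z] scale_zero[OF comp_hom[OF assms(1) z]]
    by simp
qed

lemma scale_neg_add: "f \<in> Hom C x y \<Longrightarrow> Add C f (Scl C (-1) f) = Zer C x y"
  using add_scale[of f x y 1 "-1"] scale_one[of f x y] scale_zero[of f x y] by simp

section \<open>Epimorphisms, cokernels and zero objects\<close>

lemma diff_zero_imp_eq:
  assumes f: "f \<in> Hom C x y" and g: "g \<in> Hom C x y" and d: "Add C f (Scl C (-1) g) = Zer C x y"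
  shows "f = g"
proof -
  let ?n = "Scl C (-1) g"
  have n: "?n \<in> Hom C x y"
    using g by (rule scale_hom)
  have "f = Add C f (Add C ?n g)"
    using scale_neg_add[OF g] add_commute[OF g n] add_zero[OF f] by simp
  also have "\<dots> = Add C (Zer C x y) g"
    using add_assoc[OF f n g] d by simp
  also have "\<dots> = g"
    using add_commute[OF zero_hom g] add_zero[OF g] hom_ob[OF g] by simp
  finally show ?thesis .
qed

text \<open>Since hom-sets are groups, cancellation need only be tested against zero: the hypothesis
  is applied to the difference of the two arrows.\<close>

lemma epi_arrowI_zero:
  assumes e: "e \<in> Hom C x y"
    and cancel: "\<And>w g. \<lbrakk>g \<in> Hom C y w; g \<cdot> e = Zer C x w\<rbrakk> \<Longrightarrow> g = Zer C y w"
  shows "epi_arrow C e"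
  unfolding epi_arrow_def
proof (intro conjI ballI impI)
  show "e \<in> Ar C"
    using e by (simp add: Hom_iff)
  fix w g h
  assume w: "w \<in> Ob C" and g: "g \<in> Hom C (Tgt C e) w" and h: "h \<in> Hom C (Tgt C e) w"
    and eq: "g \<cdot> e = h \<cdot> e"
  have gh: "g \<in> Hom C y w" "h \<in> Hom C y w"
    using g h e by (simp_all add: Hom_iff)
  let ?d = "Add C g (Scl C (-1) h)"
  have "?d \<cdot> e = Add C (g \<cdot> e) (Scl C (-1) (g \<cdot> e))"
    using comp_add_left[OF e gh(1) scale_hom[OF gh(2)]] comp_scale_left[OF e gh(2)] eq by simp
  also have "\<dots> = Zer C x w"
    using scale_neg_add[OF comp_hom[OF e gh(1)]] .
  finally have "?d = Zer C y w"
    by (rule cancel[OF add_hom[OF gh(1) scale_hom[OF gh(2)]]])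
  then show "g = h"
    by (rule diff_zero_imp_eq[OF gh])
qed

lemma zero_object_hom:
  assumes "zero_object C z" "f \<in> Hom C z w"
  shows "f = Zer C z w"
  using assms comp_zero_right[of f z w z] by (auto simp: zero_object_def Hom_iff dest: sym)

lemma cokernel_epi:
  assumes "is_cokernel C f q"
  shows "epi_arrow C q"
  unfolding epi_arrow_def
proof (intro conjI ballI impI)
  show q: "q \<in> Ar C"
    using assms by (simp add: is_cokernel_def)
  fix w g h
  assume w: "w \<in> Ob C" and g: "g \<in> Hom C (Tgt C q) w" and h: "h \<in> Hom C (Tgt C q) w"
    and eq: "g \<cdot> q = h \<cdot> q"
  have f: "f \<in> Ar C" "Src C q = Tgt C f" "q \<cdot> f = Zer C (Src C f) (Tgt C q)"
    using assms by (simp_all add: is_cokernel_def)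
  have "(g \<cdot> q) \<cdot> f = g \<cdot> q \<cdot> f"
    using q f(1,2) g by (intro comp_assoc_ar) (auto simp: Hom_iff)
  also have "\<dots> = Zer C (Src C f) w"
    using comp_zero_right[OF g, of "Src C f"] f by simp
  finally have "(g \<cdot> q) \<cdot> f = Zer C (Src C f) w" .
  moreover have "g \<cdot> q \<in> Hom C (Tgt C f) w"
    using q f g by (simp add: Hom_iff)
  ultimately have "\<exists>!k. k \<in> Hom C (Tgt C q) w \<and> k \<cdot> q = g \<cdot> q"
    using assms w by (simp add: is_cokernel_def)
  then show "g = h"
    using g h eq by auto
qed

text \<open>This expresses an epimorphism through a cokernel, so that a functor preserving cokernels
  can be seen to preserve epimorphisms.\<close>

lemma epi_cokernel_zero:
  assumes e: "epi_arrow C e" and z: "zero_object C z"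
  shows "is_cokernel C e (Zer C (Tgt C e) z)"
  unfolding is_cokernel_def
proof (intro conjI ballI impI)
  have ar: "e \<in> Ar C" and zo: "z \<in> Ob C"
    using e z by (simp_all add: epi_arrow_def zero_object_def)
  then show "e \<in> Ar C" "Zer C (Tgt C e) z \<in> Ar C" "Src C (Zer C (Tgt C e) z) = Tgt C e"
    "Zer C (Tgt C e) z \<cdot> e = Zer C (Src C e) (Tgt C (Zer C (Tgt C e) z))"
    using comp_zero_left[of e "Src C e" "Tgt C e" z] by (simp_all add: Hom_iff)
  fix w g
  assume w: "w \<in> Ob C" and g: "g \<in> Hom C (Tgt C e) w" and "g \<cdot> e = Zer C (Src C e) w"
  then have "g \<cdot> e = Zer C (Tgt C e) w \<cdot> e"
    using comp_zero_left[of e "Src C e" "Tgt C e" w] ar by (simp add: Hom_iff)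
  then have g0: "g = Zer C (Tgt C e) w"
    using e w g zero_hom[of "Tgt C e" w] ar unfolding epi_arrow_def by auto
  show "\<exists>!h. h \<in> Hom C (Tgt C (Zer C (Tgt C e) z)) w \<and> h \<cdot> Zer C (Tgt C e) z = g"
  proof (rule ex1I[of _ "Zer C z w"])
    show "Zer C z w \<in> Hom C (Tgt C (Zer C (Tgt C e) z)) w \<and> Zer C z w \<cdot> Zer C (Tgt C e) z = g"
      using g0 w zo ar zero_hom[of z w] comp_zero_right[OF zero_hom[of z w], of "Tgt C e"] by simp
  qed (use zero_object_hom[OF z] zo ar in auto)
qed

section \<open>Isomorphisms, inverses and retracts\<close>

lemma isoI:
  assumes "f \<in> Ar C" "g \<in> Ar C" "Src C g = Tgt C f" "Tgt C g = Src C f"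
    "g \<cdot> f = Idn C (Src C f)" "f \<cdot> g = Idn C (Tgt C f)"
  shows "is_iso C f"
  using assms by (auto simp: is_iso_def inverse_arrows_def Hom_iff)

text \<open>\<open>inv_arrow\<close> is a definite description, so its properties depend on inverses
  being unique, which is the usual sandwich \<open>g = g (f h) = (g f) h = h\<close>.\<close>

lemma iso_inv:
  assumes "is_iso C f"
  shows "f \<in> Ar C" "inv_arrow C f \<in> Ar C" "Src C (inv_arrow C f) = Tgt C f"
    "Tgt C (inv_arrow C f) = Src C f"
    "inv_arrow C f \<cdot> f = Idn C (Src C f)" "f \<cdot> inv_arrow C f = Idn C (Tgt C f)"
proof -
  have "g = h" if g: "inverse_arrows C f g" and h: "inverse_arrows C f h" for g h
  proof -
    have "g = g \<cdot> (f \<cdot> h)"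
      using g h by (simp add: inverse_arrows_def Hom_iff)
    also have "\<dots> = (g \<cdot> f) \<cdot> h"
      using g h by (intro comp_assoc_ar[symmetric]) (auto simp: inverse_arrows_def Hom_iff)
    also have "\<dots> = h"
      using g h by (simp add: inverse_arrows_def Hom_iff)
    finally show ?thesis .
  qed
  then have "inverse_arrows C f (inv_arrow C f)"
    using assms unfolding is_iso_def inv_arrow_def by (metis theI)
  then show "f \<in> Ar C" "inv_arrow C f \<in> Ar C" "Src C (inv_arrow C f) = Tgt C f"
    "Tgt C (inv_arrow C f) = Src C f"
    "inv_arrow C f \<cdot> f = Idn C (Src C f)" "f \<cdot> inv_arrow C f = Idn C (Tgt C f)"
    by (simp_all add: inverse_arrows_def Hom_iff)
qed

lemma iso_inv_iso: "is_iso C f \<Longrightarrow> is_iso C (inv_arrow C f)"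
  by (rule isoI[of _ f]) (simp_all add: iso_inv)

lemma iso_inv_comp:
  assumes "is_iso C f" "h \<in> Ar C"
  shows "Tgt C h = Src C f \<Longrightarrow> inv_arrow C f \<cdot> f \<cdot> h = h"
    "Tgt C h = Tgt C f \<Longrightarrow> f \<cdot> inv_arrow C f \<cdot> h = h"
proof -
  note inv = iso_inv[OF assms(1)]
  show "inv_arrow C f \<cdot> f \<cdot> h = h" if "Tgt C h = Src C f"
    using comp_assoc_ar[of h f "inv_arrow C f"] inv assms(2) that by (metis comp_id(2))
  show "f \<cdot> inv_arrow C f \<cdot> h = h" if "Tgt C h = Tgt C f"
    using comp_assoc_ar[of h "inv_arrow C f" f] inv assms(2) that by (metis comp_id(2))
qed

lemma iso_comp:
  assumes "is_iso C f" "is_iso C g" "Tgt C f = Src C g"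
  shows "is_iso C (g \<cdot> f)"
  by (rule isoI[of _ "inv_arrow C f \<cdot> inv_arrow C g"])
    (use assms iso_inv[OF assms(1)] iso_inv[OF assms(2)] in \<open>simp_all add: iso_inv_comp\<close>)

lemma iso_id: "x \<in> Ob C \<Longrightarrow> is_iso C (Idn C x)"
  by (rule isoI[of _ "Idn C x"]) simp_all

lemma iso_cancel_left:
  assumes "is_iso C i" "f \<in> Ar C" "g \<in> Ar C" "Tgt C f = Src C i" "Tgt C g = Src C i"
    and "i \<cdot> f = i \<cdot> g"
  shows "f = g"
  using assms iso_inv_comp(1)[OF assms(1)] by metis

lemma iso_cancel_right:
  assumes i: "is_iso C i" and fg: "f \<in> Ar C" "g \<in> Ar C" "Src C f = Tgt C i" "Src C g = Tgt C i"
    and eq: "f \<cdot> i = g \<cdot> i"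
  shows "f = g"
proof -
  have "f = (f \<cdot> i) \<cdot> inv_arrow C i"
    using iso_inv[OF i] fg by simp
  also have "\<dots> = g"
    using iso_inv[OF i] fg eq by simp
  finally show ?thesis .
qed

text \<open>Applied to a naturality square of isomorphisms, this is naturality of the inverse
  family.\<close>

lemma iso_square:
  assumes i: "is_iso C i" and j: "is_iso C j" and f: "f \<in> Hom C (Src C i) (Src C j)"
    and g: "g \<in> Hom C (Tgt C i) (Tgt C j)" and eq: "j \<cdot> f = g \<cdot> i"
  shows "inv_arrow C j \<cdot> g = f \<cdot> inv_arrow C i"
proof -
  note inv = iso_inv[OF i] iso_inv[OF j]
  have "inv_arrow C j \<cdot> g = inv_arrow C j \<cdot> (g \<cdot> i) \<cdot> inv_arrow C i"
    using f g inv by (simp add: Hom_iff)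
  also have "\<dots> = f \<cdot> inv_arrow C i"
    unfolding eq[symmetric] using f g inv by (simp add: Hom_iff iso_inv_comp[OF j])
  finally show ?thesis .
qed

text \<open>To lift \<open>f\<close> from the retract, lift \<open>f \<cdot> r\<close> from
  \<open>y\<close> and restrict the result along \<open>i\<close>.\<close>

lemma projective_retract:
  assumes y: "projective_object C y" and i: "i \<in> Hom C x y" and r: "r \<in> Hom C y x"
    and ri: "r \<cdot> i = Idn C x"
  shows "projective_object C x"
  unfolding projective_object_def
proof (intro conjI allI impI)
  show "x \<in> Ob C"
    using hom_ob[OF i] by simp
  fix e f
  assume ef: "epi_arrow C e \<and> f \<in> Hom C x (Tgt C e)"
  then have "f \<cdot> r \<in> Hom C y (Tgt C e)"
    using r by (simp add: Hom_iff)
  then obtain g where g: "g \<in> Hom C y (Src C e)" "e \<cdot> g = f \<cdot> r"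
    using y ef unfolding projective_object_def by blast
  have "e \<cdot> (g \<cdot> i) = (e \<cdot> g) \<cdot> i"
    using ef g i by (intro comp_assoc_ar[symmetric]) (auto simp: Hom_iff epi_arrow_def)
  also have "\<dots> = f"
    using g(2) ef r i ri by (simp add: Hom_iff)
  finally show "\<exists>g \<in> Hom C x (Src C e). e \<cdot> g = f"
    using comp_hom[OF i g(1)] by blast
qed

end


section \<open>Functors and equivalences\<close>

locale lin_functor = A: linear_category A + B: linear_category B
  for A :: "('o, 'a, 'k::field, 'z) lincat_scheme" and B :: "('p, 'b, 'k, 'y) lincat_scheme" +
  fixes FO :: "'o \<Rightarrow> 'p" and FA :: "'a \<Rightarrow> 'b"
  assumes linear: "linear_functor A B FO FA"
begin

lemma map_ob [simp]: "x \<in> Ob A \<Longrightarrow> FO x \<in> Ob B"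
  and map_id [simp]: "x \<in> Ob A \<Longrightarrow> FA (Idn A x) = Idn B (FO x)"
  using linear by (simp_all add: linear_functor_def)

lemma map_hom: "f \<in> Hom A x y \<Longrightarrow> FA f \<in> Hom B (FO x) (FO y)"
  using linear by (simp add: linear_functor_def)

lemma map_simps [simp]:
  assumes "f \<in> Ar A"
  shows "FA f \<in> Ar B" "Src B (FA f) = FO (Src A f)" "Tgt B (FA f) = FO (Tgt A f)"
  using map_hom[of f "Src A f" "Tgt A f"] assms by (simp_all add: Hom_iff)

lemma map_comp [simp]:
  assumes "f \<in> Ar A" "g \<in> Ar A" "Tgt A f = Src A g"
  shows "FA (g \<cdot>\<^bsub>A\<^esub> f) = FA g \<cdot>\<^bsub>B\<^esub> FA f"
proof -
  have "f \<in> Hom A (Src A f) (Src A g)" "g \<in> Hom A (Src A g) (Tgt A g)"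
    using assms by (simp_all add: Hom_iff)
  then show ?thesis
    using linear unfolding linear_functor_def by blast
qed

lemma map_zero:
  assumes "x \<in> Ob A" "y \<in> Ob A"
  shows "FA (Zer A x y) = Zer B (FO x) (FO y)"
proof -
  have z: "Zer A x y \<in> Hom A x y"
    using assms by (rule A.zero_hom)
  have "FA (Scl A 0 (Zer A x y)) = Scl B 0 (FA (Zer A x y))"
    using z linear by (simp add: linear_functor_def Hom_iff)
  then show ?thesis
    using A.scale_zero[OF z] B.scale_zero[OF map_hom[OF z]] by simp
qed

lemma map_iso:
  assumes "is_iso A f"
  shows "is_iso B (FA f)"
proof -
  note f = A.iso_inv[OF assms]
  show ?thesis
    using map_comp[of f "inv_arrow A f"] map_comp[of "inv_arrow A f" f] f
    by (intro B.isoI[of _ "FA (inv_arrow A f)"]) simp_all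
qed

lemma map_zero_object: "zero_object A z \<Longrightarrow> zero_object B (FO z)"
  using map_zero[of z z] map_id[of z] by (simp add: zero_object_def)

text \<open>The cokernel of \<open>e\<close> is the arrow to a zero object. Its image is a cokernel
  of \<open>FA e\<close> and still ends in a zero object, so every arrow that kills
  \<open>FA e\<close> factors through zero.\<close>

lemma right_exact_epi:
  assumes "right_exact_functor A B FO FA" "zero_object A z" "epi_arrow A e"
  shows "epi_arrow B (FA e)"
proof -
  have e: "e \<in> Ar A" and z: "z \<in> Ob A"
    using assms by (simp_all add: epi_arrow_def zero_object_def)
  let ?y = "FO (Tgt A e)" and ?q = "Zer B (FO (Tgt A e)) (FO z)"
  have "is_cokernel B (FA e) (FA (Zer A (Tgt A e) z))"
    using A.epi_cokernel_zero[OF assms(3,2)] assms(1) by (simp add: right_exact_functor_def)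
  then have c: "is_cokernel B (FA e) ?q"
    using map_zero e z by simp
  show ?thesis
  proof (rule B.epi_arrowI_zero)
    show "FA e \<in> Hom B (FO (Src A e)) ?y"
      using e by (simp add: Hom_iff)
    fix w g
    assume g: "g \<in> Hom B ?y w" and "g \<cdot>\<^bsub>B\<^esub> FA e = Zer B (FO (Src A e)) w"
    then have "\<exists>!h. h \<in> Hom B (FO z) w \<and> h \<cdot>\<^bsub>B\<^esub> ?q = g"
      using c e z B.hom_ob[OF g] by (simp add: is_cokernel_def)
    then obtain h where h: "h \<in> Hom B (FO z) w" "h \<cdot>\<^bsub>B\<^esub> ?q = g"
      by blast
    have "h = Zer B (FO z) w"
      using B.zero_object_hom[OF map_zero_object[OF assms(2)] h(1)] .
    then show "g = Zer B ?y w"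
      using h B.comp_zero_right[OF h(1), of ?y] e by simp
  qed
qed

text \<open>The universal property of a cokernel is tested on arrows into an arbitrary
  \<open>w\<close>. Essential surjectivity moves \<open>w\<close> into the image, fullness lifts the
  test arrow to \<open>A\<close>, and faithfulness lifts the equation saying that it vanishes on
  \<open>f\<close>.\<close>

lemma equivalence_right_exact:
  assumes faithful: "\<And>x y f g. \<lbrakk>f \<in> Hom A x y; g \<in> Hom A x y; FA f = FA g\<rbrakk> \<Longrightarrow> f = g"
    and full: "\<And>x y h. \<lbrakk>x \<in> Ob A; y \<in> Ob A; h \<in> Hom B (FO x) (FO y)\<rbrakk>
      \<Longrightarrow> \<exists>f \<in> Hom A x y. FA f = h"
    and ess_surj: "\<And>w. w \<in> Ob B \<Longrightarrow> \<exists>z \<in> Ob A. \<exists>i \<in> Hom B w (FO z). is_iso B i"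
  shows "right_exact_functor A B FO FA"
  unfolding right_exact_functor_def
proof (intro conjI allI impI)
  show "linear_functor A B FO FA"
    by (rule linear)
  fix f q
  assume c: "is_cokernel A f q"
  have f: "f \<in> Ar A" "q \<in> Ar A" "Src A q = Tgt A f"
    and qf: "q \<cdot>\<^bsub>A\<^esub> f = Zer A (Src A f) (Tgt A q)"
    using c by (simp_all add: is_cokernel_def)
  have lift: "\<exists>!h. h \<in> Hom B (FO (Tgt A q)) w \<and> h \<cdot>\<^bsub>B\<^esub> FA q = g"
    if w: "w \<in> Ob B" and g: "g \<in> Hom B (FO (Tgt A f)) w"
      and gf: "g \<cdot>\<^bsub>B\<^esub> FA f = Zer B (FO (Src A f)) w" for w g
  proof -
    obtain z i where z: "z \<in> Ob A" and i: "i \<in> Hom B w (FO z)" and iso: "is_iso B i"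
      using ess_surj[OF w] by blast
    note inv = B.iso_inv[OF iso]
    have "i \<cdot>\<^bsub>B\<^esub> g \<in> Hom B (FO (Tgt A f)) (FO z)"
      using i g by (simp add: Hom_iff)
    then obtain g' where g': "g' \<in> Hom A (Tgt A f) z" "FA g' = i \<cdot>\<^bsub>B\<^esub> g"
      using full[of "Tgt A f" z] z f by auto
    have "FA (g' \<cdot>\<^bsub>A\<^esub> f) = i \<cdot>\<^bsub>B\<^esub> g \<cdot>\<^bsub>B\<^esub> FA f"
      using f g' g i by (simp add: Hom_iff)
    also have "\<dots> = FA (Zer A (Src A f) z)"
      using gf B.comp_zero_right[OF i, of "FO (Src A f)"] f z map_zero by simp
    finally have "g' \<cdot>\<^bsub>A\<^esub> f = Zer A (Src A f) z"
      using f g' z by (intro faithful[of _ "Src A f" z]) (simp_all add: Hom_iff)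
    then obtain h' where h': "h' \<in> Hom A (Tgt A q) z" "h' \<cdot>\<^bsub>A\<^esub> q = g'"
      using c g' z unfolding is_cokernel_def by blast
    have "(inv_arrow B i \<cdot>\<^bsub>B\<^esub> FA h') \<cdot>\<^bsub>B\<^esub> FA q = inv_arrow B i \<cdot>\<^bsub>B\<^esub> FA (h' \<cdot>\<^bsub>A\<^esub> q)"
      using map_comp[of q h'] h' f inv i by (simp add: Hom_iff)
    also have "\<dots> = g"
      using h' g' B.iso_inv_comp[OF iso, of g] g i by (simp add: Hom_iff)
    finally have 1: "inv_arrow B i \<cdot>\<^bsub>B\<^esub> FA h' \<in> Hom B (FO (Tgt A q)) w \<and>
        (inv_arrow B i \<cdot>\<^bsub>B\<^esub> FA h') \<cdot>\<^bsub>B\<^esub> FA q = g"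
      using h' inv i by (simp add: Hom_iff)
    \<comment> \<open>Uniqueness is also decided in \<open>A\<close>: the lifts of the two arrows
      agree after \<open>q\<close>, which is an epimorphism there.\<close>
    have "h1 = h2" if h1: "h1 \<in> Hom B (FO (Tgt A q)) w" and h2: "h2 \<in> Hom B (FO (Tgt A q)) w"
      and eq: "h1 \<cdot>\<^bsub>B\<^esub> FA q = h2 \<cdot>\<^bsub>B\<^esub> FA q" for h1 h2
    proof -
      have "i \<cdot>\<^bsub>B\<^esub> h1 \<in> Hom B (FO (Tgt A q)) (FO z)" "i \<cdot>\<^bsub>B\<^esub> h2 \<in> Hom B (FO (Tgt A q)) (FO z)"
        using i h1 h2 by (simp_all add: Hom_iff)
      then obtain k1 k2 where k1: "k1 \<in> Hom A (Tgt A q) z" "FA k1 = i \<cdot>\<^bsub>B\<^esub> h1"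
        and k2: "k2 \<in> Hom A (Tgt A q) z" "FA k2 = i \<cdot>\<^bsub>B\<^esub> h2"
        using full[of "Tgt A q" z] z f by (metis A.ob_simps(2))
      have "FA (k1 \<cdot>\<^bsub>A\<^esub> q) = FA (k2 \<cdot>\<^bsub>A\<^esub> q)"
        using k1 k2 f i h1 h2 eq by (simp add: Hom_iff)
      then have "k1 \<cdot>\<^bsub>A\<^esub> q = k2 \<cdot>\<^bsub>A\<^esub> q"
        using k1 k2 f by (intro faithful[of _ "Src A q" z]) (simp_all add: Hom_iff)
      then have "k1 = k2"
        using A.cokernel_epi[OF c] k1 k2 z unfolding epi_arrow_def by blast
      then show ?thesis
        using B.iso_cancel_left[OF iso, of h1 h2] k1 k2 h1 h2 i by (simp add: Hom_iff)
    qed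
    then show ?thesis
      using 1 by blast
  qed
  have "FA q \<cdot>\<^bsub>B\<^esub> FA f = Zer B (FO (Src A f)) (FO (Tgt A q))"
    using map_comp[of f q] f qf map_zero by simp
  then show "is_cokernel B (FA f) (FA q)"
    using f lift by (simp add: is_cokernel_def)
qed

end

section \<open>Composites of functors, inverse transformations and equivalences\<close>

lemma lin_functor_comp:
  assumes "lin_functor A B FO FA" "lin_functor B D GO GA"
  shows "lin_functor A D (\<lambda>x. GO (FO x)) (\<lambda>f. GA (FA f))"
proof -
  interpret F: lin_functor A B FO FA by fact
  interpret G: lin_functor B D GO GA by fact
  show ?thesis
  proof
    show "linear_functor A D (\<lambda>x. GO (FO x)) (\<lambda>f. GA (FA f))"
      using F.linear G.linear unfolding linear_functor_def by (simp add: Hom_iff)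
  qed
qed

lemma right_exact_functor_comp:
  assumes "lin_functor A B FO FA" "lin_functor B D GO GA"
    and "right_exact_functor A B FO FA" "right_exact_functor B D GO GA"
  shows "right_exact_functor A D (\<lambda>x. GO (FO x)) (\<lambda>f. GA (FA f))"
  using assms lin_functor.linear[OF lin_functor_comp[OF assms(1,2)]]
  by (simp add: right_exact_functor_def)

lemma right_exact_id: "right_exact_functor A A (\<lambda>x. x) (\<lambda>f. f)"
  by (simp add: right_exact_functor_def linear_functor_def)

lemma natural_iso_inv:
  assumes "lin_functor A B FO FA" "lin_functor A B GO GA" and t: "natural_iso A B FO FA GO GA t"
  shows "natural_iso A B GO GA FO FA (\<lambda>x. inv_arrow B (t x))"
proof -
  interpret F: lin_functor A B FO FA by fact
  interpret G: lin_functor A B GO GA by fact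
  have iso: "is_iso B (t x)" "t x \<in> Ar B" "Src B (t x) = FO x" "Tgt B (t x) = GO x"
    if "x \<in> Ob A" for x
    using t that by (simp_all add: natural_iso_def natural_trans_def Hom_iff)
  note inv = F.B.iso_inv[OF iso(1)]
  have nat: "inv_arrow B (t y) \<cdot>\<^bsub>B\<^esub> GA f = FA f \<cdot>\<^bsub>B\<^esub> inv_arrow B (t x)"
    if f: "f \<in> Hom A x y" for x y f
    using f F.A.hom_ob[OF f] iso t F.map_hom[OF f] G.map_hom[OF f]
    by (intro F.B.iso_square) (simp_all add: natural_iso_def natural_trans_def)
  show ?thesis
    unfolding natural_iso_def natural_trans_def
    using iso inv F.B.iso_inv_iso[OF iso(1)] by (intro conjI ballI allI nat) (simp_all add: Hom_iff)
qed

lemma equivalence_faithful: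
  assumes "lin_functor A B FO FA" "lin_functor B A GO GA"
    and t: "natural_iso A A (\<lambda>x. x) (\<lambda>f. f) (\<lambda>x. GO (FO x)) (\<lambda>f. GA (FA f)) t"
    and f: "f \<in> Hom A x y" and g: "g \<in> Hom A x y" and eq: "FA f = FA g"
  shows "f = g"
proof -
  interpret F: lin_functor A B FO FA by fact
  have "t y \<cdot>\<^bsub>A\<^esub> f = GA (FA f) \<cdot>\<^bsub>A\<^esub> t x" "t y \<cdot>\<^bsub>A\<^esub> g = GA (FA g) \<cdot>\<^bsub>A\<^esub> t x"
    and "is_iso A (t y)" "Src A (t y) = y"
    using t f g F.A.hom_ob[OF f] by (simp_all add: natural_iso_def natural_trans_def Hom_iff)
  then show ?thesis
    using F.A.iso_cancel_left[of "t y" f g] f g eq by (simp add: Hom_iff)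
qed

text \<open>Both transformations point away from the identity, so the hypotheses are symmetric in
  the two functors and \<open>equivalence_faithful\<close> applies to each of them.\<close>

lemma equivalence_functor_right_exact:
  assumes "lin_functor A B FO FA" "lin_functor B A GO GA"
    and t: "natural_iso A A (\<lambda>x. x) (\<lambda>f. f) (\<lambda>x. GO (FO x)) (\<lambda>f. GA (FA f)) t"
    and u: "natural_iso B B (\<lambda>x. x) (\<lambda>f. f) (\<lambda>x. FO (GO x)) (\<lambda>f. FA (GA f)) u"
  shows "right_exact_functor A B FO FA"
proof -
  interpret F: lin_functor A B FO FA by fact
  interpret G: lin_functor B A GO GA by fact
  have iso: "is_iso A (t x)" "t x \<in> Ar A" "Src A (t x) = x" "Tgt A (t x) = GO (FO x)"
    if "x \<in> Ob A" for x
    using t that by (simp_all add: natural_iso_def natural_trans_def Hom_iff)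
  note inv = F.A.iso_inv[OF iso(1)]
  show ?thesis
  proof (rule F.equivalence_right_exact)
    show "f = g" if "f \<in> Hom A x y" "g \<in> Hom A x y" "FA f = FA g" for x y f g
      using equivalence_faithful[OF assms(1,2) t that] .
    show "\<exists>f \<in> Hom A x y. FA f = h" if xy: "x \<in> Ob A" "y \<in> Ob A" and h: "h \<in> Hom B (FO x) (FO y)"
      for x y h
    proof
      \<comment> \<open>A preimage of \<open>h\<close> is \<open>GA h\<close> conjugated by the
        unit. Naturality gives only \<open>GA (FA ?f) = GA h\<close>; faithfulness of
        \<open>GA\<close> removes the outer functor.\<close>
      let ?f = "inv_arrow A (t y) \<cdot>\<^bsub>A\<^esub> GA h \<cdot>\<^bsub>A\<^esub> t x"
      show f: "?f \<in> Hom A x y"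
        using xy h iso inv by (simp add: Hom_iff)
      have "GA (FA ?f) \<cdot>\<^bsub>A\<^esub> t x = t y \<cdot>\<^bsub>A\<^esub> ?f"
        using t f by (simp add: natural_iso_def natural_trans_def)
      also have "\<dots> = GA h \<cdot>\<^bsub>A\<^esub> t x"
        using xy h iso inv by (simp add: Hom_iff F.A.iso_inv_comp)
      finally have eq: "GA (FA ?f) \<cdot>\<^bsub>A\<^esub> t x = GA h \<cdot>\<^bsub>A\<^esub> t x" .
      have "GA (FA ?f) = GA h"
        by (rule F.A.iso_cancel_right[OF iso(1)[OF xy(1)] _ _ _ _ eq])
          (use G.map_hom[OF F.map_hom[OF f]] xy iso h f in \<open>simp_all del: F.map_comp add: Hom_iff\<close>)
      then show "FA ?f = h"
        using equivalence_faithful[OF assms(2,1) u F.map_hom[OF f] h] by blast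
    qed
    show "\<exists>z \<in> Ob A. \<exists>i \<in> Hom B w (FO z). is_iso B i" if "w \<in> Ob B" for w
      using u that by (auto simp: natural_iso_def natural_trans_def intro!: bexI[of _ "GO w"])
  qed
qed

lemma equivalent_categoriesE:
  assumes "equivalent_categories A B" "linear_category A" "linear_category B"
  obtains FO FA GO GA t where "lin_functor A B FO FA" "lin_functor B A GO GA"
    "right_exact_functor A B FO FA" "right_exact_functor B A GO GA"
    "natural_iso A A (\<lambda>x. x) (\<lambda>f. f) (\<lambda>x. GO (FO x)) (\<lambda>f. GA (FA f)) t"
proof -
  obtain FO FA GO GA t u where lin: "linear_functor A B FO FA" "linear_functor B A GO GA"
    and t: "natural_iso A A (\<lambda>x. x) (\<lambda>f. f) (\<lambda>x. GO (FO x)) (\<lambda>f. GA (FA f)) t"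
    and u: "natural_iso B B (\<lambda>x. FO (GO x)) (\<lambda>f. FA (GA f)) (\<lambda>x. x) (\<lambda>f. f) u"
    using assms(1) unfolding equivalent_categories_def comp_def by blast
  have F: "lin_functor A B FO FA" and G: "lin_functor B A GO GA"
    using assms(2,3) lin by (simp_all add: lin_functor_def lin_functor_axioms_def)
  have B: "lin_functor B B (\<lambda>x. x) (\<lambda>f. f)"
    using assms(3) by (simp add: lin_functor_def lin_functor_axioms_def linear_functor_def)
  \<comment> \<open>The definition directs the second isomorphism towards the identity; it is
    inverted to restore the symmetry between the two functors.\<close>
  note u' = natural_iso_inv[OF lin_functor_comp[OF G F] B u]
  show ?thesis
    using that[OF F G equivalence_functor_right_exact[OF F G t u']
        equivalence_functor_right_exact[OF G F u' t] t] .
qed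


section \<open>Finite categories\<close>

lemma linear_category_fd_mod_cat: "linear_category (fd_mod_cat R)"
proof -
  have c: "snd M ! i \<in> carrier_mat (fst M) (fst M)"
    if "is_fd_mod R M" "i < fdim R" for M :: "'a fd_mod" and i
    using that by (cases M) (auto simp: is_fd_mod_def)
  show ?thesis
  proof
    fix f g x y z
    assume f: "f \<in> Hom (fd_mod_cat R) x y" and g: "g \<in> Hom (fd_mod_cat R) y z"
    obtain S T where fg: "f = (x, y, S)" "g = (y, z, T)"
      using f g by (cases f; cases g) (auto simp: Hom_iff fd_mod_cat_def)
    have S: "S \<in> carrier_mat (fst y) (fst x)" and T: "T \<in> carrier_mat (fst z) (fst y)"
      and mods: "is_fd_mod R x" "is_fd_mod R y" "is_fd_mod R z"
      and SS: "\<And>i. i < fdim R \<Longrightarrow> S * (snd x ! i) = (snd y ! i) * S"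
      and TT: "\<And>i. i < fdim R \<Longrightarrow> T * (snd y ! i) = (snd z ! i) * T"
      using f g fg by (auto simp: Hom_iff fd_mod_cat_def)
    have "T * S * (snd x ! i) = (snd z ! i) * (T * S)" if i: "i < fdim R" for i
    proof -
      have "T * S * (snd x ! i) = T * (snd y ! i * S)"
        using assoc_mult_mat[OF T S c[OF mods(1) i]] SS[OF i] by simp
      also have "\<dots> = snd z ! i * T * S"
        using assoc_mult_mat[OF T c[OF mods(2) i] S] TT[OF i] by simp
      finally show ?thesis
        using assoc_mult_mat[OF c[OF mods(3) i] T S] by simp
    qed
    then show "g \<cdot>\<^bsub>fd_mod_cat R\<^esub> f \<in> Hom (fd_mod_cat R) x z"
      using fg S T mods by (auto simp: Hom_iff fd_mod_cat_def)
  next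
    fix f g x y
    assume f: "f \<in> Hom (fd_mod_cat R) x y" and g: "g \<in> Hom (fd_mod_cat R) x y"
    then obtain S T where fg: "f = (x, y, S)" "g = (x, y, T)"
      by (cases f; cases g) (auto simp: Hom_iff fd_mod_cat_def)
    have ST: "S \<in> carrier_mat (fst y) (fst x)" "T \<in> carrier_mat (fst y) (fst x)"
      and mods: "is_fd_mod R x" "is_fd_mod R y"
      and comm: "\<And>i. i < fdim R \<Longrightarrow> S * (snd x ! i) = (snd y ! i) * S"
        "\<And>i. i < fdim R \<Longrightarrow> T * (snd x ! i) = (snd y ! i) * T"
      using f g fg by (auto simp: Hom_iff fd_mod_cat_def)
    have "(S + T) * (snd x ! i) = (snd y ! i) * (S + T)" if i: "i < fdim R" for i
      using add_mult_distrib_mat[OF ST c[OF mods(1) i]] mult_add_distrib_mat[OF c[OF mods(2) i] ST]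
        comm[OF i] by simp
    then show "Add (fd_mod_cat R) f g \<in> Hom (fd_mod_cat R) x y"
      using fg ST mods by (simp add: Hom_iff fd_mod_cat_def)
    from f g show "Add (fd_mod_cat R) f g = Add (fd_mod_cat R) g f"
      by (auto simp: Hom_iff fd_mod_cat_def intro: comm_add_mat)
  next
    fix f x y
    assume f: "f \<in> Hom (fd_mod_cat R) x y"
    obtain S where S: "f = (x, y, S)"
      using f by (cases f) (auto simp: Hom_iff fd_mod_cat_def)
    have c': "S \<in> carrier_mat (fst y) (fst x)" and mods: "is_fd_mod R x" "is_fd_mod R y"
      using f S by (auto simp: Hom_iff fd_mod_cat_def)
    have "- S * (snd x ! i) = - (S * (snd x ! i))" "(snd y ! i) * - S = - ((snd y ! i) * S)"
      if "i < fdim R" for i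
      using uminus_mult_left_mat[of S "snd x ! i"] uminus_mult_right_mat[of "snd y ! i" S]
        c' c[OF mods(1) that] c[OF mods(2) that] by auto
    then
    have "(x, y, - S) \<in> Hom (fd_mod_cat R) x y \<and>
        Add (fd_mod_cat R) f (x, y, - S) = Zer (fd_mod_cat R) x y"
      using f S c' by (auto simp: Hom_iff fd_mod_cat_def)
    then show "\<exists>g \<in> Hom (fd_mod_cat R) x y. Add (fd_mod_cat R) f g = Zer (fd_mod_cat R) x y"
      by blast
    fix k
    have "k \<cdot>\<^sub>m S * (snd x ! i) = (snd y ! i) * (k \<cdot>\<^sub>m S)" if "i < fdim R" for i
      using mult_smult_assoc_mat[OF c' c[OF mods(1) that]]
        mult_smult_distrib[OF c[OF mods(2) that] c'] f S that by (simp add: Hom_iff fd_mod_cat_def)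
    then show "Scl (fd_mod_cat R) k f \<in> Hom (fd_mod_cat R) x y"
      using f S c' by (simp add: Hom_iff fd_mod_cat_def)
  next
    fix x
    assume "x \<in> Ob (fd_mod_cat R)"
    then show "Idn (fd_mod_cat R) x \<in> Hom (fd_mod_cat R) x x"
      using left_mult_one_mat[OF c[of x]] right_mult_one_mat[OF c[of x]]
      by (auto simp: Hom_iff fd_mod_cat_def)
  next
    fix x y
    assume "x \<in> Ob (fd_mod_cat R)" "y \<in> Ob (fd_mod_cat R)"
    then show "Zer (fd_mod_cat R) x y \<in> Hom (fd_mod_cat R) x y"
      using left_mult_zero_mat[OF c[of x]] right_mult_zero_mat[OF c[of y]]
      by (auto simp: Hom_iff fd_mod_cat_def)
  qed (auto simp: Hom_iff fd_mod_cat_def add_smult_distrib_left_mat add_smult_distrib_right_mat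
      mult_add_distrib_mat add_mult_distrib_mat)
qed

lemma finite_category_fd_mod_cat:
  assumes "is_fd_alg R"
  shows "finite_category (fd_mod_cat R)"
proof -
  interpret linear_category "fd_mod_cat R"
    by (rule linear_category_fd_mod_cat)
  let ?D = "fd_mod_cat R"
  have "linear_functor ?D ?D (\<lambda>x. x) (\<lambda>f. f)"
    by (simp add: linear_functor_def)
  moreover have "natural_iso ?D ?D (\<lambda>x. x) (\<lambda>f. f) (\<lambda>x. x) (\<lambda>f. f) (Idn ?D)"
    by (simp add: natural_iso_def natural_trans_def Hom_iff iso_id)
  ultimately have "equivalent_categories ?D ?D"
    unfolding equivalent_categories_def comp_def by blast
  then show ?thesis
    using assms linear_category_axioms unfolding finite_category_def by blast
qed

text \<open>The zero-dimensional module: each of the \<open>fdim R\<close> basis elements acts by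
  the 0 by 0 matrix.\<close>

lemma zero_object_fd_mod_cat:
  "zero_object (fd_mod_cat R) (0, replicate (fdim R) (0\<^sub>m 0 0))"
  by (auto simp: zero_object_def fd_mod_cat_def is_fd_mod_def)

text \<open>Replaces a finite category of arbitrary types by an equivalent one on the types over
  which universality quantifies. The functors in both directions are right exact, so balanced
  functors and factorisations can be carried back and forth.\<close>

lemma finite_categoryE:
  fixes E :: "('d, 'e, 'k::field, 'w) lincat_scheme"
  assumes "finite_category E"
  obtains D :: "('k fd_mod, 'k fd_mod_arrow, 'k) lincat" and KO KA LO LA \<alpha>
  where "finite_category D" "lin_functor E D KO KA" "lin_functor D E LO LA"
    "right_exact_functor E D KO KA" "right_exact_functor D E LO LA"
    "natural_iso E E (\<lambda>x. x) (\<lambda>f. f) (\<lambda>x. LO (KO x)) (\<lambda>f. LA (KA f)) \<alpha>"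
proof -
  obtain R where R: "is_fd_alg R" "equivalent_categories E (fd_mod_cat R)" "linear_category E"
    using assms by (auto simp: finite_category_def)
  show ?thesis
    by (rule equivalent_categoriesE[OF R(2,3) linear_category_fd_mod_cat])
      (rule that[OF finite_category_fd_mod_cat[OF R(1)]])
qed

text \<open>Existence of zero objects is not an axiom of \<open>linear_category\<close>; it is
  transported from the module category and supplies the hypothesis of
  \<open>right_exact_epi\<close>.\<close>

lemma finite_category_zero_object:
  assumes "finite_category E"
  shows "\<exists>z. zero_object E z"
proof -
  obtain R where R: "equivalent_categories E (fd_mod_cat R)" "linear_category E"
    using assms by (auto simp: finite_category_def)
  then obtain GO GA where "lin_functor (fd_mod_cat R) E GO GA"
    using equivalent_categoriesE[OF _ _ linear_category_fd_mod_cat, of E R] by blast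
  then show ?thesis
    using lin_functor.map_zero_object[OF _ zero_object_fd_mod_cat] by blast
qed

section \<open>Tensor categories\<close>

locale bilin_functor = A: linear_category A + B: linear_category B + D: linear_category D
  for A :: "('o, 'a, 'k::field, 'z) lincat_scheme" and B :: "('p, 'b, 'k, 'y) lincat_scheme"
    and D :: "('q, 'c, 'k, 'x) lincat_scheme" +
  fixes FO :: "'o \<Rightarrow> 'p \<Rightarrow> 'q" and FA :: "'a \<Rightarrow> 'b \<Rightarrow> 'c"
  assumes bilinear: "bilinear_bifunctor A B D FO FA"
begin

lemma bmap_ob [simp]: "\<lbrakk>x \<in> Ob A; y \<in> Ob B\<rbrakk> \<Longrightarrow> FO x y \<in> Ob D"
  and bmap_id [simp]: "\<lbrakk>x \<in> Ob A; y \<in> Ob B\<rbrakk> \<Longrightarrow> FA (Idn A x) (Idn B y) = Idn D (FO x y)"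
  using bilinear by (simp_all add: bilinear_bifunctor_def)

lemma bmap_simps [simp]:
  assumes "f \<in> Ar A" "g \<in> Ar B"
  shows "FA f g \<in> Ar D" "Src D (FA f g) = FO (Src A f) (Src B g)"
    "Tgt D (FA f g) = FO (Tgt A f) (Tgt B g)"
proof -
  have "f \<in> Hom A (Src A f) (Tgt A f)" "g \<in> Hom B (Src B g) (Tgt B g)"
    using assms by (simp_all add: Hom_iff)
  then have "FA f g \<in> Hom D (FO (Src A f) (Src B g)) (FO (Tgt A f) (Tgt B g))"
    using bilinear[unfolded bilinear_bifunctor_def, THEN conjunct2, THEN conjunct1] by blast
  then show "FA f g \<in> Ar D" "Src D (FA f g) = FO (Src A f) (Src B g)"
    "Tgt D (FA f g) = FO (Tgt A f) (Tgt B g)"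
    by (simp_all add: Hom_iff)
qed

lemma bmap_comp:
  assumes "f \<in> Ar A" "f' \<in> Ar A" "Tgt A f = Src A f'" "g \<in> Ar B" "g' \<in> Ar B" "Tgt B g = Src B g'"
  shows "FA f' g' \<cdot>\<^bsub>D\<^esub> FA f g = FA (f' \<cdot>\<^bsub>A\<^esub> f) (g' \<cdot>\<^bsub>B\<^esub> g)"
proof -
  have "f \<in> Hom A (Src A f) (Src A f')" "f' \<in> Hom A (Src A f') (Tgt A f')"
    "g \<in> Hom B (Src B g) (Src B g')" "g' \<in> Hom B (Src B g') (Tgt B g')"
    using assms by (simp_all add: Hom_iff)
  then show ?thesis
    using bilinear[unfolded bilinear_bifunctor_def, THEN conjunct2, THEN conjunct2, THEN conjunct1]
    by metis
qed

text \<open>Composites are normalised to the right, so the interchange law has to reach two factors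
  at the head of a longer composite; hence the trailing \<open>h\<close>.\<close>

lemma bmap_comp_assoc:
  assumes "f \<in> Ar A" "f' \<in> Ar A" "Tgt A f = Src A f'" "g \<in> Ar B" "g' \<in> Ar B" "Tgt B g = Src B g'"
    and "h \<in> Ar D" "Tgt D h = FO (Src A f) (Src B g)"
  shows "FA f' g' \<cdot>\<^bsub>D\<^esub> FA f g \<cdot>\<^bsub>D\<^esub> h = FA (f' \<cdot>\<^bsub>A\<^esub> f) (g' \<cdot>\<^bsub>B\<^esub> g) \<cdot>\<^bsub>D\<^esub> h"
  using D.comp_assoc_ar[of h "FA f g" "FA f' g'"] bmap_comp[of f f' g g'] assms by simp

lemma bmap_left_functor:
  assumes "y \<in> Ob B"
  shows "lin_functor A D (\<lambda>x. FO x y) (\<lambda>f. FA f (Idn B y))"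
proof
  have id: "Idn B y \<in> Ar B" "Src B (Idn B y) = y" "Tgt B (Idn B y) = y"
    using assms by simp_all
  show "linear_functor A D (\<lambda>x. FO x y) (\<lambda>f. FA f (Idn B y))"
    unfolding linear_functor_def
  proof (intro conjI allI ballI)
    fix x x' x'' f g
    assume "f \<in> Hom A x x'" "g \<in> Hom A x' x''"
    then show "FA (g \<cdot>\<^bsub>A\<^esub> f) (Idn B y) = FA g (Idn B y) \<cdot>\<^bsub>D\<^esub> FA f (Idn B y)"
      using assms by (simp add: bmap_comp Hom_iff)
  next
    fix x x' f g
    assume "f \<in> Hom A x x'" "g \<in> Hom A x x'"
    then show "FA (Add A f g) (Idn B y) = Add D (FA f (Idn B y)) (FA g (Idn B y))"
      using bilinear id unfolding bilinear_bifunctor_def by blast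
  next
    fix c f
    assume "f \<in> Ar A"
    then show "FA (Scl A c f) (Idn B y) = Scl D c (FA f (Idn B y))"
      using bilinear id unfolding bilinear_bifunctor_def by blast
  qed (use assms in \<open>auto simp: Hom_iff\<close>)
qed

lemma bmap_right_functor:
  assumes "x \<in> Ob A"
  shows "lin_functor B D (FO x) (FA (Idn A x))"
proof
  have id: "Idn A x \<in> Ar A" "Src A (Idn A x) = x" "Tgt A (Idn A x) = x"
    using assms by simp_all
  show "linear_functor B D (FO x) (FA (Idn A x))"
    unfolding linear_functor_def
  proof (intro conjI allI ballI)
    fix y y' y'' f g
    assume "f \<in> Hom B y y'" "g \<in> Hom B y' y''"
    then show "FA (Idn A x) (g \<cdot>\<^bsub>B\<^esub> f) = FA (Idn A x) g \<cdot>\<^bsub>D\<^esub> FA (Idn A x) f"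
      using assms by (simp add: bmap_comp Hom_iff)
  next
    fix y y' f g
    assume "f \<in> Hom B y y'" "g \<in> Hom B y y'"
    then show "FA (Idn A x) (Add B f g) = Add D (FA (Idn A x) f) (FA (Idn A x) g)"
      using bilinear id unfolding bilinear_bifunctor_def by blast
  next
    fix c f
    assume "f \<in> Ar B"
    then show "FA (Idn A x) (Scl B c f) = Scl D c (FA (Idn A x) f)"
      using bilinear id unfolding bilinear_bifunctor_def by blast
  qed (use assms in \<open>auto simp: Hom_iff\<close>)
qed

end

sublocale finite_tensor_category \<subseteq> linear_category C
  using finite by (simp add: finite_category_def)

sublocale finite_tensor_category \<subseteq> T: bilin_functor C C C "TenO C" "TenA C"
  by unfold_locales (rule tensor_bifunctor)

context finite_tensor_category
begin

declare unit_ob [simp] tensor_assoc_ob [simp] tensor_unit_ob [simp] tensor_unit_ar [simp]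

lemmas tensor_comp = T.bmap_comp T.bmap_comp_assoc

text \<open>Interchange combined with strictness of the unit: when one factor ends in the unit
  object, the other can be performed after it.\<close>

lemma tensor_to_unit:
  assumes "f \<in> Ar C" "g \<in> Ar C" "Tgt C g = Unit C"
  shows "f \<otimes>\<^sub>A g = f \<cdot> (Idn C (Src C f) \<otimes>\<^sub>A g)" "g \<otimes>\<^sub>A f = f \<cdot> (g \<otimes>\<^sub>A Idn C (Src C f))"
  using T.bmap_comp[of "Idn C (Src C f)" f g "Idn C (Unit C)"]
    T.bmap_comp[of g "Idn C (Unit C)" "Idn C (Src C f)" f] assms by simp_all

lemma tensor_from_unit:
  assumes "f \<in> Ar C" "g \<in> Ar C" "Src C g = Unit C"
  shows "f \<otimes>\<^sub>A g = (Idn C (Tgt C f) \<otimes>\<^sub>A g) \<cdot> f" "g \<otimes>\<^sub>A f = (g \<otimes>\<^sub>A Idn C (Tgt C f)) \<cdot> f"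
  using T.bmap_comp[of f "Idn C (Tgt C f)" "Idn C (Unit C)" g]
    T.bmap_comp[of "Idn C (Unit C)" g f "Idn C (Tgt C f)"] assms by simp_all

text \<open>
  Under the adjunction \<open>_ \<otimes> x \<stileturn> _ \<otimes> z\<close> for a left dual \<open>z\<close> of \<open>x\<close>, \<open>flat\<close> and \<open>sharp\<close> are the
  two transpositions.
\<close>

definition flat :: "'o \<Rightarrow> 'o \<Rightarrow> 'a \<Rightarrow> 'a \<Rightarrow> 'a" where
  "flat x y ev f = (Idn C y \<otimes>\<^sub>A ev) \<cdot> (f \<otimes>\<^sub>A Idn C x)"

definition sharp :: "'o \<Rightarrow> 'o \<Rightarrow> 'a \<Rightarrow> 'a \<Rightarrow> 'a" where
  "sharp w z coev k = (k \<otimes>\<^sub>A Idn C z) \<cdot> (Idn C w \<otimes>\<^sub>A coev)"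

lemma flat_hom:
  assumes "duality C z x ev coev" "y \<in> Ob C" "f \<in> Hom C w (y \<otimes>\<^sub>O z)"
  shows "flat x y ev f \<in> Hom C (w \<otimes>\<^sub>O x) y"
  using assms hom_ob[OF assms(3)] by (simp add: flat_def duality_def Hom_iff)

lemma sharp_hom:
  assumes "duality C z x ev coev" "w \<in> Ob C" "k \<in> Hom C (w \<otimes>\<^sub>O x) y"
  shows "sharp w z coev k \<in> Hom C w (y \<otimes>\<^sub>O z)"
  using assms by (simp add: sharp_def duality_def Hom_iff)

lemma flat_comp:
  assumes "duality C z x ev coev" "y \<in> Ob C" "f \<in> Hom C w (y \<otimes>\<^sub>O z)" "g \<in> Hom C u w"
  shows "flat x y ev (f \<cdot> g) = flat x y ev f \<cdot> (g \<otimes>\<^sub>A Idn C x)"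
proof -
  have "(f \<cdot> g) \<otimes>\<^sub>A Idn C x = (f \<otimes>\<^sub>A Idn C x) \<cdot> (g \<otimes>\<^sub>A Idn C x)"
    using assms by (simp add: T.bmap_comp duality_def Hom_iff)
  then show ?thesis
    using assms by (simp add: flat_def duality_def Hom_iff)
qed

text \<open>\<open>ev\<close> and \<open>k\<close> act on disjoint tensor factors, so interchange
  lets \<open>ev\<close> act before \<open>k\<close>, where it meets \<open>coev\<close> and the
  snake identity for \<open>x\<close> applies. The opposite composite uses the snake identity for
  \<open>z\<close>.\<close>

lemma flat_sharp:
  assumes d: "duality C z x ev coev" and "w \<in> Ob C" "k \<in> Hom C (w \<otimes>\<^sub>O x) y"
  shows "flat x y ev (sharp w z coev k) = k"
proof -
  have e: "x \<in> Ob C" "z \<in> Ob C" "ev \<in> Ar C" "Src C ev = z \<otimes>\<^sub>O x" "Tgt C ev = Unit C"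
    "coev \<in> Ar C" "Src C coev = Unit C" "Tgt C coev = x \<otimes>\<^sub>O z"
    and snake: "(Idn C x \<otimes>\<^sub>A ev) \<cdot> (coev \<otimes>\<^sub>A Idn C x) = Idn C x"
    using d by (simp_all add: duality_def Hom_iff)
  have k: "k \<in> Ar C" "Src C k = w \<otimes>\<^sub>O x" "Tgt C k = y" and w: "w \<in> Ob C" and y: "y \<in> Ob C"
    using assms by (auto simp: Hom_iff)
  have "flat x y ev (sharp w z coev k)
      = (Idn C y \<otimes>\<^sub>A ev) \<cdot> (((k \<otimes>\<^sub>A Idn C z) \<otimes>\<^sub>A Idn C x) \<cdot> ((Idn C w \<otimes>\<^sub>A coev) \<otimes>\<^sub>A Idn C x))"
    using e k w y by (simp add: flat_def sharp_def T.bmap_comp)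
  also have "\<dots> = (Idn C y \<otimes>\<^sub>A ev) \<cdot> (k \<otimes>\<^sub>A Idn C (z \<otimes>\<^sub>O x)) \<cdot> (Idn C w \<otimes>\<^sub>A (coev \<otimes>\<^sub>A Idn C x))"
    using e k w y by (simp add: tensor_assoc_ar)
  also have "\<dots> = (k \<otimes>\<^sub>A ev) \<cdot> (Idn C w \<otimes>\<^sub>A (coev \<otimes>\<^sub>A Idn C x))"
    using e k w y by (simp add: tensor_comp)
  also have "\<dots> = k \<cdot> (Idn C w \<otimes>\<^sub>A (Idn C x \<otimes>\<^sub>A ev)) \<cdot> (Idn C w \<otimes>\<^sub>A (coev \<otimes>\<^sub>A Idn C x))"
    using e k w y tensor_to_unit(1)[of k ev] tensor_assoc_ar[of "Idn C w" "Idn C x" ev]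
    by simp
  also have "\<dots> = k"
    using e k w y snake by (simp add: T.bmap_comp)
  finally show ?thesis .
qed

lemma sharp_flat:
  assumes d: "duality C z x ev coev" and "y \<in> Ob C" "f \<in> Hom C w (y \<otimes>\<^sub>O z)"
  shows "sharp w z coev (flat x y ev f) = f"
proof -
  have e: "x \<in> Ob C" "z \<in> Ob C" "ev \<in> Ar C" "Src C ev = z \<otimes>\<^sub>O x" "Tgt C ev = Unit C"
    "coev \<in> Ar C" "Src C coev = Unit C" "Tgt C coev = x \<otimes>\<^sub>O z"
    and snake: "(ev \<otimes>\<^sub>A Idn C z) \<cdot> (Idn C z \<otimes>\<^sub>A coev) = Idn C z"
    using d by (simp_all add: duality_def Hom_iff)
  have f: "f \<in> Ar C" "Src C f = w" "Tgt C f = y \<otimes>\<^sub>O z" and y: "y \<in> Ob C" and w: "w \<in> Ob C"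
    using assms by (auto simp: Hom_iff)
  have "sharp w z coev (flat x y ev f)
      = (((Idn C y \<otimes>\<^sub>A ev) \<otimes>\<^sub>A Idn C z) \<cdot> ((f \<otimes>\<^sub>A Idn C x) \<otimes>\<^sub>A Idn C z)) \<cdot> (Idn C w \<otimes>\<^sub>A coev)"
    using e f y w by (simp add: flat_def sharp_def T.bmap_comp)
  also have "\<dots> = (Idn C y \<otimes>\<^sub>A (ev \<otimes>\<^sub>A Idn C z)) \<cdot> (f \<otimes>\<^sub>A Idn C (x \<otimes>\<^sub>O z)) \<cdot> (Idn C w \<otimes>\<^sub>A coev)"
    using e f y w by (simp add: tensor_assoc_ar)
  also have "\<dots> = (Idn C y \<otimes>\<^sub>A (ev \<otimes>\<^sub>A Idn C z)) \<cdot> (f \<otimes>\<^sub>A coev)"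
    using e f y w by (simp add: tensor_comp)
  also have "\<dots> = (Idn C y \<otimes>\<^sub>A (ev \<otimes>\<^sub>A Idn C z)) \<cdot> (Idn C y \<otimes>\<^sub>A (Idn C z \<otimes>\<^sub>A coev)) \<cdot> f"
    using e f y w tensor_from_unit(1)[of f coev] tensor_assoc_ar[of "Idn C y" "Idn C z" coev]
    by simp
  also have "\<dots> = f"
    using e f y w snake by (simp add: tensor_comp)
  finally show ?thesis .
qed

end


section \<open>Modules over an algebra\<close>

locale tensor_algebra = finite_tensor_category C
  for C :: "('o, 'a, 'k::field, 'z) moncat_scheme" (structure) +
  fixes A :: "('o, 'a) alg"
  assumes algebra: "is_algebra C A"
begin

abbreviation "a \<equiv> Carr A"
abbreviation "mA \<equiv> Mul A"
abbreviation "M \<equiv> right_modules C A"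

lemma alg_simps [simp]:
  "a \<in> Ob C" "mA \<in> Ar C" "Src C mA = a \<otimes>\<^sub>O a" "Tgt C mA = a"
  "One A \<in> Ar C" "Src C (One A) = Unit C" "Tgt C (One A) = a"
  using algebra by (simp_all add: is_algebra_def Hom_iff)

lemma alg_eqs:
  "mA \<cdot> (mA \<otimes>\<^sub>A Idn C a) = mA \<cdot> (Idn C a \<otimes>\<^sub>A mA)"
  "mA \<cdot> (One A \<otimes>\<^sub>A Idn C a) = Idn C a"
  "mA \<cdot> (Idn C a \<otimes>\<^sub>A One A) = Idn C a"
  using algebra by (simp_all add: is_algebra_def)

text \<open>\<open>y \<otimes> d\<close> plays the role of the internal hom from \<open>a\<close> to
  \<open>y\<close>, and \<open>\<rho>\<close> lets \<open>a\<close> act on the argument: in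
  elements, \<open>(f x) (x') = f (x x')\<close>. The module axioms are equations between arrows
  into \<open>y \<otimes> d\<close>; as \<open>flat\<close> is injective, they may be checked after
  it, where they become associativity and the left unit law of \<open>A\<close>.\<close>

lemma coinduced_module:
  assumes d: "duality C d a ev coev" and y: "y \<in> Ob C"
  defines "\<rho> \<equiv> sharp (y \<otimes>\<^sub>O d \<otimes>\<^sub>O a) d coev ((Idn C y \<otimes>\<^sub>A ev) \<cdot> (Idn C (y \<otimes>\<^sub>O d) \<otimes>\<^sub>A mA))"
  shows "flat a y ev \<rho> = (Idn C y \<otimes>\<^sub>A ev) \<cdot> (Idn C (y \<otimes>\<^sub>O d) \<otimes>\<^sub>A mA)"
    and "is_right_module C A (y \<otimes>\<^sub>O d, \<rho>)"
proof -
  have e: "d \<in> Ob C" "ev \<in> Ar C" "Src C ev = d \<otimes>\<^sub>O a" "Tgt C ev = Unit C"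
    using d by (simp_all add: duality_def Hom_iff)
  let ?k = "(Idn C y \<otimes>\<^sub>A ev) \<cdot> (Idn C (y \<otimes>\<^sub>O d) \<otimes>\<^sub>A mA)"
  have k: "?k \<in> Hom C ((y \<otimes>\<^sub>O d \<otimes>\<^sub>O a) \<otimes>\<^sub>O a) y"
    using y e by (simp add: Hom_iff)
  have \<rho>: "\<rho> \<in> Hom C (y \<otimes>\<^sub>O d \<otimes>\<^sub>O a) (y \<otimes>\<^sub>O d)"
    using sharp_hom[OF d _ k] y e by (simp add: \<rho>_def)
  then have \<rho>': "\<rho> \<in> Ar C" "Src C \<rho> = y \<otimes>\<^sub>O (d \<otimes>\<^sub>O a)" "Tgt C \<rho> = y \<otimes>\<^sub>O d"
    using y e by (simp_all add: Hom_iff)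
  show flat: "flat a y ev \<rho> = ?k"
    using flat_sharp[OF d _ k] y e by (simp add: \<rho>_def)
  let ?yd = "y \<otimes>\<^sub>O d"
  have inj: "f = g" if "f \<in> Hom C w ?yd" "g \<in> Hom C w ?yd" "flat a y ev f = flat a y ev g" for f g w
    using that sharp_flat[OF d y] by metis
  have l1: "flat a y ev (\<rho> \<cdot> (\<rho> \<otimes>\<^sub>A Idn C a)) = ?k \<cdot> (Idn C (?yd \<otimes>\<^sub>O a) \<otimes>\<^sub>A mA)"
  proof -
    have "flat a y ev (\<rho> \<cdot> (\<rho> \<otimes>\<^sub>A Idn C a)) = ?k \<cdot> ((\<rho> \<otimes>\<^sub>A Idn C a) \<otimes>\<^sub>A Idn C a)"
      using flat_comp[OF d y \<rho>, of "\<rho> \<otimes>\<^sub>A Idn C a"] flat \<rho>' y e by (simp add: Hom_iff)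
    also have "\<dots> = (Idn C y \<otimes>\<^sub>A ev) \<cdot> (\<rho> \<otimes>\<^sub>A mA)"
      using \<rho>' y e by (simp add: tensor_assoc_ar tensor_comp)
    also have "\<dots> = (Idn C y \<otimes>\<^sub>A ev) \<cdot> (\<rho> \<otimes>\<^sub>A Idn C a) \<cdot> (Idn C (?yd \<otimes>\<^sub>O a) \<otimes>\<^sub>A mA)"
      using \<rho>' y e by (simp add: tensor_comp)
    also have "\<dots> = flat a y ev \<rho> \<cdot> (Idn C (?yd \<otimes>\<^sub>O a) \<otimes>\<^sub>A mA)"
      using \<rho>' y e by (simp add: flat_def)
    finally show ?thesis
      using flat by simp
  qed
  have l2: "flat a y ev (\<rho> \<cdot> (Idn C ?yd \<otimes>\<^sub>A mA)) = ?k \<cdot> ((Idn C ?yd \<otimes>\<^sub>A mA) \<otimes>\<^sub>A Idn C a)"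
    using flat_comp[OF d y \<rho>, of "Idn C ?yd \<otimes>\<^sub>A mA"] flat y e by (simp add: Hom_iff)
  have "Idn C (?yd \<otimes>\<^sub>O a) \<otimes>\<^sub>A mA = Idn C ?yd \<otimes>\<^sub>A (Idn C a \<otimes>\<^sub>A mA)"
    using y e tensor_assoc_ar[of "Idn C ?yd" "Idn C a" mA] by simp
  then have "?k \<cdot> (Idn C (?yd \<otimes>\<^sub>O a) \<otimes>\<^sub>A mA) = ?k \<cdot> ((Idn C ?yd \<otimes>\<^sub>A mA) \<otimes>\<^sub>A Idn C a)"
    using y e tensor_assoc_ar[of "Idn C ?yd" mA "Idn C a"] alg_eqs(1)
      T.bmap_comp[of "Idn C ?yd" "Idn C ?yd" "Idn C a \<otimes>\<^sub>A mA" mA]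
      T.bmap_comp[of "Idn C ?yd" "Idn C ?yd" "mA \<otimes>\<^sub>A Idn C a" mA] by simp
  then have "flat a y ev (\<rho> \<cdot> (\<rho> \<otimes>\<^sub>A Idn C a)) = flat a y ev (\<rho> \<cdot> (Idn C ?yd \<otimes>\<^sub>A mA))"
    using l1 l2 by simp
  then have assoc: "\<rho> \<cdot> (\<rho> \<otimes>\<^sub>A Idn C a) = \<rho> \<cdot> (Idn C ?yd \<otimes>\<^sub>A mA)"
    by (rule inj[of _ "?yd \<otimes>\<^sub>O a \<otimes>\<^sub>O a", rotated 2]) (use \<rho>' y e in \<open>simp_all add: Hom_iff\<close>)
  have "flat a y ev (\<rho> \<cdot> (Idn C ?yd \<otimes>\<^sub>A One A)) = ?k \<cdot> ((Idn C ?yd \<otimes>\<^sub>A One A) \<otimes>\<^sub>A Idn C a)"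
    using flat_comp[OF d y \<rho>, of "Idn C ?yd \<otimes>\<^sub>A One A"] flat y e by (simp add: Hom_iff)
  also have "\<dots> = (Idn C y \<otimes>\<^sub>A ev) \<cdot> (Idn C ?yd \<otimes>\<^sub>A Idn C a)"
    using y e tensor_assoc_ar[of "Idn C ?yd" "One A" "Idn C a"] alg_eqs(2)
      T.bmap_comp[of "Idn C ?yd" "Idn C ?yd" "One A \<otimes>\<^sub>A Idn C a" mA] by simp
  finally have "flat a y ev (\<rho> \<cdot> (Idn C ?yd \<otimes>\<^sub>A One A)) = flat a y ev (Idn C ?yd)"
    by (simp add: flat_def)
  then have "\<rho> \<cdot> (Idn C ?yd \<otimes>\<^sub>A One A) = Idn C ?yd"
    by (rule inj[of _ ?yd, rotated 2]) (use \<rho>' y e in \<open>simp_all add: Hom_iff\<close>)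
  then show "is_right_module C A (?yd, \<rho>)"
    using assoc \<rho> y e by (simp add: is_right_module_def)
qed

section \<open>The linear category of right modules and its forgetful functor\<close>

lemma module_simps:
  assumes "is_right_module C A V"
  shows "fst V \<in> Ob C" "snd V \<in> Ar C" "Src C (snd V) = fst V \<otimes>\<^sub>O a" "Tgt C (snd V) = fst V"
    "snd V \<cdot> (snd V \<otimes>\<^sub>A Idn C a) = snd V \<cdot> (Idn C (fst V) \<otimes>\<^sub>A mA)"
    "snd V \<cdot> (Idn C (fst V) \<otimes>\<^sub>A One A) = Idn C (fst V)"
  using assms by (simp_all add: is_right_module_def Hom_iff case_prod_beta)

lemma Ob_M [simp]: "V \<in> Ob M \<longleftrightarrow> is_right_module C A V"
  by (simp add: right_modules_def)

lemma Hom_M: "f \<in> Hom M V W \<longleftrightarrow> (\<exists>\<phi>. f = (V, W, \<phi>) \<and> is_right_module C A V \<and>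
    is_right_module C A W \<and> \<phi> \<in> Hom C (fst V) (fst W) \<and> \<phi> \<cdot> snd V = snd W \<cdot> (\<phi> \<otimes>\<^sub>A Idn C a))"
  by (cases f) (auto simp: Hom_def right_modules_def right_module_hom_def)

lemma M_simps [simp]:
  "Src M (V, W, \<phi>) = V" "Tgt M (V, W, \<phi>) = W" "Idn M V = (V, V, Idn C (fst V))"
  "(V', W', \<psi>) \<cdot>\<^bsub>M\<^esub> (V, W, \<phi>) = (V, W', \<psi> \<cdot> \<phi>)" "Zer M V W = (V, W, Zer C (fst V) (fst W))"
  "Add M (V, W, \<phi>) (V', W', \<psi>) = (V, W, Add C \<phi> \<psi>)" "Scl M c (V, W, \<phi>) = (V, W, Scl C c \<phi>)"
  "ActO M X V = (X \<otimes>\<^sub>O fst V, Idn C X \<otimes>\<^sub>A snd V)"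
  "ActA M g (V, W, \<phi>) = (ActO M (Src C g) V, ActO M (Tgt C g) W, g \<otimes>\<^sub>A \<phi>)"
  "Asc M X Y V = (ActO M (X \<otimes>\<^sub>O Y) V, ActO M (X \<otimes>\<^sub>O Y) V, Idn C (X \<otimes>\<^sub>O Y \<otimes>\<^sub>O fst V))"
  "Unt M V = (V, V, Idn C (fst V))"
  by (simp_all add: right_modules_def case_prod_beta Let_def)

sublocale M: linear_category M
proof -
  note L = lin_functor.linear[OF T.bmap_left_functor[of a], unfolded linear_functor_def, OF alg_simps(1)]
  have tadd: "Add C \<phi> \<psi> \<otimes>\<^sub>A Idn C a = Add C (\<phi> \<otimes>\<^sub>A Idn C a) (\<psi> \<otimes>\<^sub>A Idn C a)"
    if "\<phi> \<in> Hom C x y" "\<psi> \<in> Hom C x y" for \<phi> \<psi> x y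
    using L that by blast
  have tscl: "Scl C c \<phi> \<otimes>\<^sub>A Idn C a = Scl C c (\<phi> \<otimes>\<^sub>A Idn C a)" if "\<phi> \<in> Hom C x y" for \<phi> c x y
    using L that unfolding Hom_iff by blast
  have scl: "Scl M c f \<in> Hom M V W" if "f \<in> Hom M V W" for c f V W
  proof -
    obtain \<phi> where f: "f = (V, W, \<phi>)" and V: "is_right_module C A V" and W: "is_right_module C A W"
      and \<phi>: "\<phi> \<in> Hom C (fst V) (fst W)" and e: "\<phi> \<cdot> snd V = snd W \<cdot> (\<phi> \<otimes>\<^sub>A Idn C a)"
      using \<open>f \<in> Hom M V W\<close> by (auto simp: Hom_M)
    have r: "snd V \<in> Hom C (fst V \<otimes>\<^sub>O a) (fst V)" "snd W \<in> Hom C (fst W \<otimes>\<^sub>O a) (fst W)"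
      using module_simps V W by (simp_all add: Hom_iff)
    have "\<phi> \<otimes>\<^sub>A Idn C a \<in> Hom C (fst V \<otimes>\<^sub>O a) (fst W \<otimes>\<^sub>O a)"
      using \<phi> by (simp add: Hom_iff)
    then have "Scl C c \<phi> \<cdot> snd V = snd W \<cdot> (Scl C c \<phi> \<otimes>\<^sub>A Idn C a)"
      using comp_scale_left[OF r(1) \<phi>, of c] comp_scale_right[OF _ r(2), of _ _ c] e tscl[OF \<phi>]
      by simp
    then show ?thesis
      using f V W scale_hom[OF \<phi>] by (simp add: Hom_M)
  qed
  have add: "Add M f g \<in> Hom M V W" if fg: "f \<in> Hom M V W" "g \<in> Hom M V W" for f g V W
  proof -
    obtain \<phi> \<psi> where f: "f = (V, W, \<phi>)" "g = (V, W, \<psi>)"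
      and V: "is_right_module C A V" and W: "is_right_module C A W"
      and \<phi>: "\<phi> \<in> Hom C (fst V) (fst W)" "\<psi> \<in> Hom C (fst V) (fst W)"
      and e: "\<phi> \<cdot> snd V = snd W \<cdot> (\<phi> \<otimes>\<^sub>A Idn C a)" "\<psi> \<cdot> snd V = snd W \<cdot> (\<psi> \<otimes>\<^sub>A Idn C a)"
      using fg by (auto simp: Hom_M)
    have r: "snd V \<in> Hom C (fst V \<otimes>\<^sub>O a) (fst V)" "snd W \<in> Hom C (fst W \<otimes>\<^sub>O a) (fst W)"
      using module_simps V W by (simp_all add: Hom_iff)
    have "\<phi> \<otimes>\<^sub>A Idn C a \<in> Hom C (fst V \<otimes>\<^sub>O a) (fst W \<otimes>\<^sub>O a)"
      "\<psi> \<otimes>\<^sub>A Idn C a \<in> Hom C (fst V \<otimes>\<^sub>O a) (fst W \<otimes>\<^sub>O a)"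
      using \<phi> by (simp_all add: Hom_iff)
    then have "Add C \<phi> \<psi> \<cdot> snd V = snd W \<cdot> (Add C \<phi> \<psi> \<otimes>\<^sub>A Idn C a)"
      using comp_add_left[OF r(1) \<phi>] comp_add_right[OF _ _ r(2)] e tadd[OF \<phi>] by simp
    then show ?thesis
      using f V W add_hom[OF \<phi>] by (simp add: Hom_M)
  qed
  have zer: "Zer M V W \<in> Hom M V W" if "V \<in> Ob M" "W \<in> Ob M" for V W
  proof -
    have V: "is_right_module C A V" and W: "is_right_module C A W"
      using that by simp_all
    have r: "snd V \<in> Hom C (fst V \<otimes>\<^sub>O a) (fst V)" "snd W \<in> Hom C (fst W \<otimes>\<^sub>O a) (fst W)"
      using module_simps V W by (simp_all add: Hom_iff)
    have "Zer C (fst V) (fst W) \<cdot> snd V = snd W \<cdot> (Zer C (fst V) (fst W) \<otimes>\<^sub>A Idn C a)"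
      using comp_zero_left[OF r(1)] comp_zero_right[OF r(2)] module_simps(1)[OF V]
        module_simps(1)[OF W] lin_functor.map_zero[OF T.bmap_left_functor[of a]]
      by simp
    then show ?thesis
      using zero_hom[of "fst V" "fst W"] module_simps(1) V W by (simp add: Hom_M)
  qed
  show "linear_category M"
  proof
    fix f x y
    assume f: "f \<in> Hom M x y"
    show "\<exists>g \<in> Hom M x y. Add M f g = Zer M x y"
      using f scale_neg_add by (intro bexI[OF _ scl[OF f, of "-1"]]) (auto simp: Hom_M)
  next
    fix f g x y z
    assume "f \<in> Hom M x y" "g \<in> Hom M y z"
    then obtain \<phi> \<psi> where f: "f = (x, y, \<phi>)" "g = (y, z, \<psi>)"
      and V: "is_right_module C A x" "is_right_module C A y" "is_right_module C A z"
      and \<phi>: "\<phi> \<in> Hom C (fst x) (fst y)" "\<psi> \<in> Hom C (fst y) (fst z)"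
      and e: "\<phi> \<cdot> snd x = snd y \<cdot> (\<phi> \<otimes>\<^sub>A Idn C a)" "\<psi> \<cdot> snd y = snd z \<cdot> (\<psi> \<otimes>\<^sub>A Idn C a)"
      by (auto simp: Hom_M)
    note \<phi>' = \<phi>[unfolded Hom_iff] and V' = module_simps[OF V(1)] module_simps[OF V(2)] module_simps[OF V(3)]
    have "(\<psi> \<cdot> \<phi>) \<cdot> snd x = \<psi> \<cdot> snd y \<cdot> (\<phi> \<otimes>\<^sub>A Idn C a)"
      using \<phi>' V' e(1) by simp
    also have "\<dots> = (\<psi> \<cdot> snd y) \<cdot> (\<phi> \<otimes>\<^sub>A Idn C a)"
      using \<phi>' V' by simp
    also have "\<dots> = snd z \<cdot> ((\<psi> \<cdot> \<phi>) \<otimes>\<^sub>A Idn C a)"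
      unfolding e(2) using \<phi>' V' by (simp add: T.bmap_comp)
    finally show "g \<cdot>\<^bsub>M\<^esub> f \<in> Hom M x z"
      using f V comp_hom[OF \<phi>] by (simp add: Hom_M)
  next
    fix x
    assume "x \<in> Ob M"
    then show "Idn M x \<in> Hom M x x"
      using module_simps[of x] id_hom[of "fst x"] by (simp add: Hom_M)
  next
    show "f \<in> Ar M \<Longrightarrow> Src M f \<in> Ob M" "f \<in> Ar M \<Longrightarrow> Tgt M f \<in> Ob M" for f
      by (auto simp: right_modules_def)
  next
    fix f g x y
    assume "f \<in> Hom M x y" "g \<in> Hom M x y"
    then show "Add M f g = Add M g f"
      using add_commute by (auto simp: Hom_M)
  qed (use scl add zer in \<open>auto simp: Hom_M comp_assoc comp_id_right comp_id_left add_assoc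
      add_zero scale_add add_scale scale_scale scale_one comp_add_right
      comp_add_left comp_scale_right comp_scale_left\<close>)
qed

lemma forgetful_functor: "lin_functor M C fst (\<lambda>f. snd (snd f))"
proof
  show "linear_functor M C fst (\<lambda>f. snd (snd f))"
    unfolding linear_functor_def
  proof (intro conjI allI ballI)
    fix c f
    show "snd (snd (Scl M c f)) = Scl C c (snd (snd f))"
      by (cases f) simp
  qed (use module_simps in \<open>auto simp: Hom_M\<close>)
qed

text \<open>
  The forgetful functor has the coinduction \<open>y \<mapsto> y \<otimes> d\<close>, for a left dual \<open>d\<close> of \<open>a\<close>, as right
  adjoint, and therefore preserves cokernels.
\<close>

lemma coinduction_adjoint:
  assumes d: "duality C d a ev coev" and y: "y \<in> Ob C" and W: "is_right_module C A W"
    and g: "g \<in> Hom C (fst W) y"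
  defines "\<rho> \<equiv> sharp (y \<otimes>\<^sub>O d \<otimes>\<^sub>O a) d coev ((Idn C y \<otimes>\<^sub>A ev) \<cdot> (Idn C (y \<otimes>\<^sub>O d) \<otimes>\<^sub>A mA))"
    and "g' \<equiv> sharp (fst W) d coev (g \<cdot> snd W)"
  shows "(W, (y \<otimes>\<^sub>O d, \<rho>), g') \<in> Hom M W (y \<otimes>\<^sub>O d, \<rho>)"
    and "flat a y ev g' \<cdot> (Idn C (fst W) \<otimes>\<^sub>A One A) = g"
proof -
  note W' = module_simps[OF W] and g1 = g[unfolded Hom_iff]
  have e: "d \<in> Ob C" "ev \<in> Ar C" "Src C ev = d \<otimes>\<^sub>O a" "Tgt C ev = Unit C"
    using d by (simp_all add: duality_def Hom_iff)
  let ?yd = "y \<otimes>\<^sub>O d"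
  have mod: "is_right_module C A (?yd, \<rho>)"
    and fl\<rho>: "flat a y ev \<rho> = (Idn C y \<otimes>\<^sub>A ev) \<cdot> (Idn C ?yd \<otimes>\<^sub>A mA)"
    using coinduced_module[OF d y] by (simp_all add: \<rho>_def)
  have \<rho>: "\<rho> \<in> Ar C" "Src C \<rho> = y \<otimes>\<^sub>O (d \<otimes>\<^sub>O a)" "Tgt C \<rho> = ?yd"
    using module_simps[OF mod] y e by simp_all
  have k: "g \<cdot> snd W \<in> Hom C (fst W \<otimes>\<^sub>O a) y"
    using g1 W' by (simp add: Hom_iff)
  have g': "g' \<in> Hom C (fst W) ?yd"
    using sharp_hom[OF d _ k] W' by (simp add: g'_def)
  have fl: "flat a y ev g' = g \<cdot> snd W"
    using flat_sharp[OF d _ k] W' by (simp add: g'_def)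
  show "flat a y ev g' \<cdot> (Idn C (fst W) \<otimes>\<^sub>A One A) = g"
    using fl W' g1 by simp
  have 1: "flat a y ev (g' \<cdot> snd W) = (g \<cdot> snd W) \<cdot> (snd W \<otimes>\<^sub>A Idn C a)"
    using flat_comp[OF d y g', of "snd W"] fl W' by (simp add: Hom_iff)
  have 2: "flat a y ev (\<rho> \<cdot> (g' \<otimes>\<^sub>A Idn C a)) = (g \<cdot> snd W) \<cdot> (Idn C (fst W) \<otimes>\<^sub>A mA)"
  proof -
    note g2 = g'[unfolded Hom_iff]
    have "flat a y ev (\<rho> \<cdot> (g' \<otimes>\<^sub>A Idn C a))
        = ((Idn C y \<otimes>\<^sub>A ev) \<cdot> (Idn C ?yd \<otimes>\<^sub>A mA)) \<cdot> ((g' \<otimes>\<^sub>A Idn C a) \<otimes>\<^sub>A Idn C a)"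
      using flat_comp[OF d y, of \<rho> "?yd \<otimes>\<^sub>O a" "g' \<otimes>\<^sub>A Idn C a"] fl\<rho> g2 \<rho> y e
      by (simp add: Hom_iff)
    also have "\<dots> = (Idn C y \<otimes>\<^sub>A ev) \<cdot> (g' \<otimes>\<^sub>A mA)"
      using g2 y e by (simp add: tensor_assoc_ar tensor_comp)
    also have "\<dots> = ((Idn C y \<otimes>\<^sub>A ev) \<cdot> (g' \<otimes>\<^sub>A Idn C a)) \<cdot> (Idn C (fst W) \<otimes>\<^sub>A mA)"
      using g2 y e W' by (simp add: tensor_comp)
    finally show ?thesis
      using fl by (simp add: flat_def)
  qed
  \<comment> \<open>The two transposes agree by associativity of the action on \<open>W\<close>;
    injectivity of \<open>flat\<close> turns this into linearity of \<open>g'\<close>.\<close>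
  have "flat a y ev (g' \<cdot> snd W) = flat a y ev (\<rho> \<cdot> (g' \<otimes>\<^sub>A Idn C a))"
    using 1 2 W' g1 by simp
  moreover have "g' \<cdot> snd W \<in> Hom C (fst W \<otimes>\<^sub>O a) ?yd" "\<rho> \<cdot> (g' \<otimes>\<^sub>A Idn C a) \<in> Hom C (fst W \<otimes>\<^sub>O a) ?yd"
    using g' \<rho> W' y e by (simp_all add: Hom_iff)
  ultimately have "g' \<cdot> snd W = \<rho> \<cdot> (g' \<otimes>\<^sub>A Idn C a)"
    using sharp_flat[OF d y] by metis
  then show "(W, (?yd, \<rho>), g') \<in> Hom M W (?yd, \<rho>)"
    using W mod g' by (simp add: Hom_M)
qed

text \<open>Naturality of the transposition in the module variable. It transfers equations after
  composition with an underlying arrow, such as \<open>g \<cdot> \<phi> = 0\<close>, to equations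
  between module maps.\<close>

lemma coinduction_natural:
  assumes d: "duality C d a ev coev" and f: "(V, W, \<phi>) \<in> Hom M V W" and g: "g \<in> Hom C (fst W) y"
  shows "sharp (fst W) d coev (g \<cdot> snd W) \<cdot> \<phi> = sharp (fst V) d coev ((g \<cdot> \<phi>) \<cdot> snd V)"
proof -
  have V: "is_right_module C A V" and W: "is_right_module C A W"
    and \<phi>: "\<phi> \<in> Hom C (fst V) (fst W)" and e: "\<phi> \<cdot> snd V = snd W \<cdot> (\<phi> \<otimes>\<^sub>A Idn C a)"
    using f by (auto simp: Hom_M)
  note V' = module_simps[OF V] and W' = module_simps[OF W] and \<phi>' = \<phi>[unfolded Hom_iff]
    and g' = g[unfolded Hom_iff]
  have y: "y \<in> Ob C"
    using hom_ob[OF g] by simp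
  have k: "g \<cdot> snd W \<in> Hom C (fst W \<otimes>\<^sub>O a) y" "(g \<cdot> \<phi>) \<cdot> snd V \<in> Hom C (fst V \<otimes>\<^sub>O a) y"
    using g' \<phi>' W' V' by (simp_all add: Hom_iff)
  let ?s = "sharp (fst W) d coev (g \<cdot> snd W)" and ?t = "sharp (fst V) d coev ((g \<cdot> \<phi>) \<cdot> snd V)"
  have s: "?s \<in> Hom C (fst W) (y \<otimes>\<^sub>O d)"
    by (rule sharp_hom[OF d W'(1) k(1)])
  have "flat a y ev (?s \<cdot> \<phi>) = (g \<cdot> snd W) \<cdot> (\<phi> \<otimes>\<^sub>A Idn C a)"
    using flat_comp[OF d y s \<phi>] flat_sharp[OF d W'(1) k(1)] by simp
  also have "\<dots> = (g \<cdot> \<phi>) \<cdot> snd V"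
    using g' \<phi>' W' V' e by simp
  finally have "flat a y ev (?s \<cdot> \<phi>) = (g \<cdot> \<phi>) \<cdot> snd V" .
  then show ?thesis
    using sharp_flat[OF d y comp_hom[OF \<phi> s]] by simp
qed

text \<open>An arrow out of \<open>fst W\<close> that kills \<open>\<phi>\<close> transposes to a
  module map into the coinduced module that kills \<open>f\<close>. The cokernel in the module
  category factors this map, and transposing back factors the original arrow.\<close>

lemma forgetful_right_exact: "right_exact_functor M C fst (\<lambda>f. snd (snd f))"
  unfolding right_exact_functor_def
proof (intro conjI allI impI)
  interpret U: lin_functor M C fst "\<lambda>f. snd (snd f)"
    by (rule forgetful_functor)
  show "linear_functor M C fst (\<lambda>f. snd (snd f))"
    by (rule U.linear)
  fix f q
  assume c: "is_cokernel M f q"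
  obtain V W \<phi> where f: "f = (V, W, \<phi>)"
    by (cases f)
  obtain Q \<theta> where q: "q = (W, Q, \<theta>)"
    using c f by (cases q) (auto simp: is_cokernel_def)
  have fH: "(V, W, \<phi>) \<in> Hom M V W" and qH: "(W, Q, \<theta>) \<in> Hom M W Q"
    using c f q by (auto simp: is_cokernel_def Hom_iff)
  have V: "is_right_module C A V" and W: "is_right_module C A W" and Q: "is_right_module C A Q"
    and \<phi>: "\<phi> \<in> Hom C (fst V) (fst W)" and \<theta>: "\<theta> \<in> Hom C (fst W) (fst Q)"
    using fH qH by (auto simp: Hom_M)
  note V' = module_simps[OF V] and W' = module_simps[OF W] and Q' = module_simps[OF Q]
    and \<phi>' = \<phi>[unfolded Hom_iff] and \<theta>' = \<theta>[unfolded Hom_iff]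
  have q0: "\<theta> \<cdot> \<phi> = Zer C (fst V) (fst Q)"
    using c f q by (simp add: is_cokernel_def)
  obtain d ev coev where d: "duality C d a ev coev"
    using left_dual[OF alg_simps(1)] by blast
  have univ: "\<exists>!h. h \<in> Hom C (fst Q) y \<and> h \<cdot> \<theta> = g"
    if y: "y \<in> Ob C" and g: "g \<in> Hom C (fst W) y" and g0: "g \<cdot> \<phi> = Zer C (fst V) y" for y g
  proof -
    let ?\<rho> = "sharp (y \<otimes>\<^sub>O d \<otimes>\<^sub>O a) d coev ((Idn C y \<otimes>\<^sub>A ev) \<cdot> (Idn C (y \<otimes>\<^sub>O d) \<otimes>\<^sub>A mA))"
    let ?Y = "(y \<otimes>\<^sub>O d, ?\<rho>)"
    let ?g = "sharp (fst W) d coev (g \<cdot> snd W)"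
    have gM: "(W, ?Y, ?g) \<in> Hom M W ?Y"
      by (rule coinduction_adjoint(1)[OF d y W g])
    have "?g \<cdot> \<phi> = sharp (fst V) d coev (Zer C (fst V) y \<cdot> snd V)"
      using coinduction_natural[OF d fH g] g0 by simp
    \<comment> \<open>Naturality is read backwards for the zero arrow on \<open>fst W\<close>, so
      that the vanishing of the transpose has to be computed only there.\<close>
    also have "\<dots> = sharp (fst W) d coev (Zer C (fst W) y \<cdot> snd W) \<cdot> \<phi>"
      using coinduction_natural[OF d fH zero_hom[OF W'(1) y]] comp_zero_left[OF \<phi> y] by simp
    also have "\<dots> = sharp (fst W) d coev (Zer C (fst W \<otimes>\<^sub>O a) y) \<cdot> \<phi>"
      using comp_zero_left[of "snd W" "fst W \<otimes>\<^sub>O a" "fst W" y] W' y by (simp add: Hom_iff)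
    also have "sharp (fst W) d coev (Zer C (fst W \<otimes>\<^sub>O a) y) = Zer C (fst W) (y \<otimes>\<^sub>O d)"
    proof -
      have e: "d \<in> Ob C" "coev \<in> Ar C" "Src C coev = Unit C" "Tgt C coev = a \<otimes>\<^sub>O d"
        using d by (simp_all add: duality_def Hom_iff)
      have "Zer C (fst W \<otimes>\<^sub>O a) y \<otimes>\<^sub>A Idn C d = Zer C ((fst W \<otimes>\<^sub>O a) \<otimes>\<^sub>O d) (y \<otimes>\<^sub>O d)"
        using lin_functor.map_zero[OF T.bmap_left_functor[OF e(1)]] W' y by simp
      then show ?thesis
        using comp_zero_left[of "Idn C (fst W) \<otimes>\<^sub>A coev" "fst W" "fst W \<otimes>\<^sub>O a \<otimes>\<^sub>O d" "y \<otimes>\<^sub>O d"] W' y e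
        by (simp add: sharp_def Hom_iff)
    qed
    also have "Zer C (fst W) (y \<otimes>\<^sub>O d) \<cdot> \<phi> = Zer C (fst V) (y \<otimes>\<^sub>O d)"
      using comp_zero_left[OF \<phi>] d y by (simp add: duality_def)
    finally have "(W, ?Y, ?g) \<cdot>\<^bsub>M\<^esub> f = Zer M V ?Y"
      using f by simp
    then have "\<exists>!h'. h' \<in> Hom M (Tgt M q) ?Y \<and> h' \<cdot>\<^bsub>M\<^esub> q = (W, ?Y, ?g)"
      using c[unfolded is_cokernel_def] gM M.hom_ob[OF gM] f by (metis M_simps(1,2))
    then obtain h' where "h' \<in> Hom M (Tgt M q) ?Y" and h'q: "h' \<cdot>\<^bsub>M\<^esub> q = (W, ?Y, ?g)"
      by blast
    then have h': "h' \<in> Hom M Q ?Y"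
      unfolding q by simp
    then obtain \<eta> where \<eta>: "h' = (Q, ?Y, \<eta>)" "\<eta> \<in> Hom C (fst Q) (y \<otimes>\<^sub>O d)" "\<eta> \<cdot> \<theta> = ?g"
      using h'q q by (auto simp: Hom_M)
    \<comment> \<open>Transposing back means evaluating at the unit of \<open>A\<close>.\<close>
    let ?h = "flat a y ev \<eta> \<cdot> (Idn C (fst Q) \<otimes>\<^sub>A One A)"
    have fl\<eta>: "flat a y ev \<eta> \<in> Ar C" "Src C (flat a y ev \<eta>) = fst Q \<otimes>\<^sub>O a" "Tgt C (flat a y ev \<eta>) = y"
      using flat_hom[OF d y \<eta>(2)] by (simp_all add: Hom_iff)
    have h: "?h \<in> Hom C (fst Q) y"
      using fl\<eta> Q' by (simp add: Hom_iff)
    have "?h \<cdot> \<theta> = flat a y ev \<eta> \<cdot> (\<theta> \<otimes>\<^sub>A Idn C a) \<cdot> (Idn C (fst W) \<otimes>\<^sub>A One A)"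
      using fl\<eta> Q' \<theta>' W' tensor_from_unit(1)[of \<theta> "One A"] by (simp add: tensor_comp)
    also have "\<dots> = flat a y ev ?g \<cdot> (Idn C (fst W) \<otimes>\<^sub>A One A)"
      using flat_comp[OF d y \<eta>(2) \<theta>] \<eta>(3) fl\<eta> \<theta>' W' by simp
    finally have h\<theta>: "?h \<cdot> \<theta> = g"
      using coinduction_adjoint(2)[OF d y W g] by simp
    \<comment> \<open>Uniqueness holds because \<open>q\<close> is an epimorphism of modules and
      evaluation at the unit recovers an arrow from its transpose.\<close>
    have "h1 = h2" if h1: "h1 \<in> Hom C (fst Q) y" and h2: "h2 \<in> Hom C (fst Q) y"
      and eq: "h1 \<cdot> \<theta> = h2 \<cdot> \<theta>" for h1 h2
    proof -
      let ?s = "\<lambda>h. sharp (fst Q) d coev (h \<cdot> snd Q)"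
      have "?s h1 \<cdot> \<theta> = ?s h2 \<cdot> \<theta>"
        using coinduction_natural[OF d qH] h1 h2 eq by simp
      then have "(Q, ?Y, ?s h1) \<cdot>\<^bsub>M\<^esub> q = (Q, ?Y, ?s h2) \<cdot>\<^bsub>M\<^esub> q"
        using q by simp
      moreover have "?Y \<in> Ob M" "(Q, ?Y, ?s h1) \<in> Hom M (Tgt M q) ?Y"
        "(Q, ?Y, ?s h2) \<in> Hom M (Tgt M q) ?Y"
        using M.hom_ob[OF gM] coinduction_adjoint(1)[OF d y Q h1] coinduction_adjoint(1)[OF d y Q h2]
        unfolding q M_simps(2) by blast+
      ultimately have "(Q, ?Y, ?s h1) = (Q, ?Y, ?s h2)"
        using M.cokernel_epi[OF c] unfolding epi_arrow_def by blast
      then have "?s h1 = ?s h2"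
        by blast
      then show ?thesis
        using coinduction_adjoint(2)[OF d y Q h1] coinduction_adjoint(2)[OF d y Q h2] by metis
    qed
    then show ?thesis
      using h h\<theta> by blast
  qed
  show "is_cokernel C (snd (snd f)) (snd (snd q))"
    using univ q0 f q \<phi>' \<theta>' by (simp add: is_cokernel_def)
qed

section \<open>The action of \<open>C\<close> on right modules\<close>

lemma id_tensor_assoc:
  assumes "x \<in> Ob C" "y \<in> Ob C" "f \<in> Ar C"
  shows "Idn C (x \<otimes>\<^sub>O y) \<otimes>\<^sub>A f = Idn C x \<otimes>\<^sub>A (Idn C y \<otimes>\<^sub>A f)"
    "(f \<otimes>\<^sub>A Idn C x) \<otimes>\<^sub>A Idn C y = f \<otimes>\<^sub>A Idn C (x \<otimes>\<^sub>O y)"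
    "(Idn C x \<otimes>\<^sub>A f) \<otimes>\<^sub>A Idn C y = Idn C x \<otimes>\<^sub>A (f \<otimes>\<^sub>A Idn C y)"
  using assms tensor_assoc_ar[of "Idn C x" "Idn C y" f] tensor_assoc_ar[of f "Idn C x" "Idn C y"]
    tensor_assoc_ar[of "Idn C x" f "Idn C y"] by simp_all

lemma Ar_M: "(V, W, \<phi>) \<in> Ar M \<longleftrightarrow> is_right_module C A V \<and> is_right_module C A W \<and>
    \<phi> \<in> Hom C (fst V) (fst W) \<and> \<phi> \<cdot> snd V = snd W \<cdot> (\<phi> \<otimes>\<^sub>A Idn C a)"
  by (simp add: right_modules_def right_module_hom_def)

lemma regular_module: "is_right_module C A (a, mA)"
  using alg_eqs by (simp add: is_right_module_def Hom_iff)

lemma act_module: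
  assumes V: "is_right_module C A V" and X: "X \<in> Ob C"
  shows "is_right_module C A (ActO M X V)"
proof -
  note V' = module_simps[OF V]
  have "(Idn C X \<otimes>\<^sub>A snd V) \<cdot> ((Idn C X \<otimes>\<^sub>A snd V) \<otimes>\<^sub>A Idn C a)
      = Idn C X \<otimes>\<^sub>A (snd V \<cdot> (snd V \<otimes>\<^sub>A Idn C a))"
    using V'(1-4) X by (simp add: id_tensor_assoc(3) T.bmap_comp)
  also have "\<dots> = (Idn C X \<otimes>\<^sub>A snd V) \<cdot> (Idn C (X \<otimes>\<^sub>O fst V) \<otimes>\<^sub>A mA)"
    using V' X by (simp add: id_tensor_assoc(1) T.bmap_comp)
  finally have "(Idn C X \<otimes>\<^sub>A snd V) \<cdot> ((Idn C X \<otimes>\<^sub>A snd V) \<otimes>\<^sub>A Idn C a)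
    = (Idn C X \<otimes>\<^sub>A snd V) \<cdot> (Idn C (X \<otimes>\<^sub>O fst V) \<otimes>\<^sub>A mA)" .
  moreover have "(Idn C X \<otimes>\<^sub>A snd V) \<cdot> (Idn C (X \<otimes>\<^sub>O fst V) \<otimes>\<^sub>A One A) = Idn C (X \<otimes>\<^sub>O fst V)"
    using V' X by (simp add: id_tensor_assoc(1) T.bmap_comp)
  ultimately show ?thesis
    using V' X by (simp add: is_right_module_def Hom_iff)
qed

lemma act_hom:
  assumes g: "g \<in> Hom C X X'" and f: "(V, W, \<phi>) \<in> Hom M V W"
  shows "(ActO M X V, ActO M X' W, g \<otimes>\<^sub>A \<phi>) \<in> Hom M (ActO M X V) (ActO M X' W)"
proof -
  have V: "is_right_module C A V" and W: "is_right_module C A W"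
    and \<phi>: "\<phi> \<in> Hom C (fst V) (fst W)" and e: "\<phi> \<cdot> snd V = snd W \<cdot> (\<phi> \<otimes>\<^sub>A Idn C a)"
    using f by (auto simp: Hom_M)
  note V' = module_simps[OF V] and W' = module_simps[OF W] and \<phi>' = \<phi>[unfolded Hom_iff]
    and g' = g[unfolded Hom_iff]
  have X: "X \<in> Ob C" "X' \<in> Ob C"
    using hom_ob[OF g] by simp_all
  have "(g \<otimes>\<^sub>A \<phi>) \<cdot> (Idn C X \<otimes>\<^sub>A snd V) = (Idn C X' \<otimes>\<^sub>A snd W) \<cdot> ((g \<otimes>\<^sub>A \<phi>) \<otimes>\<^sub>A Idn C a)"
    using V'(1-4) W'(1-4) \<phi>' g' X e by (simp add: tensor_assoc_ar T.bmap_comp)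
  then show ?thesis
    using act_module[OF V X(1)] act_module[OF W X(2)] g' \<phi>' by (simp add: Ar_M Hom_iff)
qed

text \<open>The action \<open>v \<otimes> a \<rightarrow> v\<close> as a module map from the free
  module. The latter is written as \<open>v\<close> acting on the regular module so that the
  balancing can move \<open>v\<close> to the other variable.\<close>

definition action_map :: "'o \<times> 'a \<Rightarrow> ('o \<times> 'a) \<times> ('o \<times> 'a) \<times> 'a" where
  "action_map V = (ActO M (fst V) (a, mA), V, snd V)"

lemma action_map_hom:
  assumes V: "is_right_module C A V"
  shows "action_map V \<in> Hom M (ActO M (fst V) (a, mA)) V"
  using assms act_module[OF regular_module] module_simps[OF V]
  by (simp add: action_map_def Ar_M Hom_iff)

text \<open>In elements, with \<sigma> written as \<open>\<sigma>' \<otimes> \<sigma>''\<close>,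
  this is \<open>v \<mapsto> v \<sigma>' \<otimes> \<sigma>''\<close>.\<close>

definition action_section :: "'a \<Rightarrow> 'o \<times> 'a \<Rightarrow> ('o \<times> 'a) \<times> ('o \<times> 'a) \<times> 'a" where
  "action_section \<sigma> V = (V, ActO M (fst V) (a, mA), (snd V \<otimes>\<^sub>A Idn C a) \<cdot> (Idn C (fst V) \<otimes>\<^sub>A \<sigma>))"

text \<open>The classical separability idempotent: an element of \<open>a \<otimes> a\<close> that
  commutes with \<open>a\<close> and multiplies to 1.\<close>

definition separability_element :: "'a \<Rightarrow> bool" where
  "separability_element \<sigma> \<longleftrightarrow> \<sigma> \<in> Hom C (Unit C) (a \<otimes>\<^sub>O a) \<and>
     (mA \<otimes>\<^sub>A Idn C a) \<cdot> (Idn C a \<otimes>\<^sub>A \<sigma>) = (Idn C a \<otimes>\<^sub>A mA) \<cdot> (\<sigma> \<otimes>\<^sub>A Idn C a) \<and>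
     mA \<cdot> \<sigma> = One A"

text \<open>The element is \<open>s \<cdot> One A\<close>. Left and right linearity each recover
  \<open>s\<close> from it, which gives the commutation with \<open>a\<close>.\<close>

lemma separable_element:
  assumes "separable C A"
  shows "\<exists>\<sigma>. separability_element \<sigma>"
proof -
  obtain s where s: "s \<in> Hom C a (a \<otimes>\<^sub>O a)"
    and l: "s \<cdot> mA = (mA \<otimes>\<^sub>A Idn C a) \<cdot> (Idn C a \<otimes>\<^sub>A s)"
    and r: "s \<cdot> mA = (Idn C a \<otimes>\<^sub>A mA) \<cdot> (s \<otimes>\<^sub>A Idn C a)"
    and ms: "mA \<cdot> s = Idn C a"
    using assms by (auto simp: separable_def bimodule_hom_def regular_bimodule_def
        tensor_square_bimodule_def)
  note s' = s[unfolded Hom_iff]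
  have "(mA \<otimes>\<^sub>A Idn C a) \<cdot> (Idn C a \<otimes>\<^sub>A (s \<cdot> One A))
      = ((mA \<otimes>\<^sub>A Idn C a) \<cdot> (Idn C a \<otimes>\<^sub>A s)) \<cdot> (Idn C a \<otimes>\<^sub>A One A)"
    using s' by (simp add: tensor_comp)
  also have "\<dots> = s"
    unfolding l[symmetric] using s' alg_eqs by simp
  finally have 1: "(mA \<otimes>\<^sub>A Idn C a) \<cdot> (Idn C a \<otimes>\<^sub>A (s \<cdot> One A)) = s" .
  have "(Idn C a \<otimes>\<^sub>A mA) \<cdot> ((s \<cdot> One A) \<otimes>\<^sub>A Idn C a)
      = ((Idn C a \<otimes>\<^sub>A mA) \<cdot> (s \<otimes>\<^sub>A Idn C a)) \<cdot> (One A \<otimes>\<^sub>A Idn C a)"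
    using s' T.bmap_comp[of "One A" s "Idn C a" "Idn C a"] by simp
  also have "\<dots> = s"
    unfolding r[symmetric] using s' alg_eqs by simp
  finally have 2: "(Idn C a \<otimes>\<^sub>A mA) \<cdot> ((s \<cdot> One A) \<otimes>\<^sub>A Idn C a) = s" .
  have "mA \<cdot> (s \<cdot> One A) = (mA \<cdot> s) \<cdot> One A"
    using s' by simp
  then have "separability_element (s \<cdot> One A)"
    unfolding separability_element_def using s' 1 2 ms by (simp add: Hom_iff)
  then show ?thesis
    by blast
qed

text \<open>
  A bimodule map \<open>\<pi> : a \<otimes> X \<otimes> a \<rightarrow> a\<close> factors as \<open>mA \<circ> \<phi>\<close> through \<open>a \<otimes> a\<close>, where
  \<open>\<phi> = (mA \<otimes> a) \<circ> (a \<otimes> g \<otimes> a)\<close> and \<open>g = \<pi> \<circ> (1 \<otimes> X \<otimes> 1)\<close>.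
\<close>

lemma relatively_projective_separable:
  assumes "relatively_projective C A"
  shows "separable C A"
proof -
  obtain X i \<pi> where X: "X \<in> Ob C"
    and i: "i \<in> Hom C a (a \<otimes>\<^sub>O X \<otimes>\<^sub>O a)" and \<pi>: "\<pi> \<in> Hom C (a \<otimes>\<^sub>O X \<otimes>\<^sub>O a) a"
    and il: "i \<cdot> mA = (mA \<otimes>\<^sub>A Idn C X \<otimes>\<^sub>A Idn C a) \<cdot> (Idn C a \<otimes>\<^sub>A i)"
    and ir: "i \<cdot> mA = (Idn C a \<otimes>\<^sub>A Idn C X \<otimes>\<^sub>A mA) \<cdot> (i \<otimes>\<^sub>A Idn C a)"
    and \<pi>l: "\<pi> \<cdot> (mA \<otimes>\<^sub>A Idn C X \<otimes>\<^sub>A Idn C a) = mA \<cdot> (Idn C a \<otimes>\<^sub>A \<pi>)"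
    and \<pi>r: "\<pi> \<cdot> (Idn C a \<otimes>\<^sub>A Idn C X \<otimes>\<^sub>A mA) = mA \<cdot> (\<pi> \<otimes>\<^sub>A Idn C a)"
    and \<pi>i: "\<pi> \<cdot> i = Idn C a"
    using assms by (auto simp: relatively_projective_def bimodule_summand_def bimodule_hom_def
        regular_bimodule_def induced_bimodule_def)
  note i' = i[unfolded Hom_iff] and \<pi>' = \<pi>[unfolded Hom_iff]
  let ?a = "Idn C a" and ?X = "Idn C X"
  have rl: "mA \<otimes>\<^sub>A ?X \<otimes>\<^sub>A ?a = mA \<otimes>\<^sub>A Idn C (X \<otimes>\<^sub>O a)"
    and rr: "?a \<otimes>\<^sub>A ?X \<otimes>\<^sub>A mA = ?a \<otimes>\<^sub>A (?X \<otimes>\<^sub>A mA)"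
    using X id_tensor_assoc(2)[of X a mA] id_tensor_assoc(1)[of a X mA] by simp_all
  define g where "g = \<pi> \<cdot> (One A \<otimes>\<^sub>A ?X \<otimes>\<^sub>A One A)"
  have g: "g \<in> Ar C" "Src C g = X" "Tgt C g = a"
    using \<pi>' X by (simp_all add: g_def)
  define \<phi> where "\<phi> = (mA \<otimes>\<^sub>A ?a) \<cdot> (?a \<otimes>\<^sub>A (g \<otimes>\<^sub>A ?a))"
  have \<phi>: "\<phi> \<in> Ar C" "Src C \<phi> = a \<otimes>\<^sub>O (X \<otimes>\<^sub>O a)" "Tgt C \<phi> = a \<otimes>\<^sub>O a"
    using g X by (simp_all add: \<phi>_def)
  \<comment> \<open>Right linearity of \<open>\<pi>\<close> absorbs the unit that \<open>g\<close>
    inserts in the last slot.\<close>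
  have mg: "mA \<cdot> (g \<otimes>\<^sub>A ?a) = \<pi> \<cdot> (One A \<otimes>\<^sub>A Idn C (X \<otimes>\<^sub>O a))"
  proof -
    have "g \<otimes>\<^sub>A ?a = (\<pi> \<otimes>\<^sub>A ?a) \<cdot> ((One A \<otimes>\<^sub>A ?X \<otimes>\<^sub>A One A) \<otimes>\<^sub>A ?a)"
      using \<pi>' X by (simp add: g_def T.bmap_comp)
    then have "mA \<cdot> (g \<otimes>\<^sub>A ?a) = (mA \<cdot> (\<pi> \<otimes>\<^sub>A ?a)) \<cdot> ((One A \<otimes>\<^sub>A ?X \<otimes>\<^sub>A One A) \<otimes>\<^sub>A ?a)"
      using \<pi>' X by simp
    also have "\<dots> = \<pi> \<cdot> (?a \<otimes>\<^sub>A (?X \<otimes>\<^sub>A mA)) \<cdot> (One A \<otimes>\<^sub>A (?X \<otimes>\<^sub>A (One A \<otimes>\<^sub>A ?a)))"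
      unfolding \<pi>r[symmetric] using \<pi>' X by (simp add: tensor_assoc_ar del: T.bmap_id)
    also have "\<dots> = \<pi> \<cdot> (One A \<otimes>\<^sub>A Idn C (X \<otimes>\<^sub>O a))"
      using \<pi>' X by (simp add: tensor_comp alg_eqs)
    finally show ?thesis .
  qed
  \<comment> \<open>After reassociating the product, \<open>mg\<close> applies; left linearity of
    \<open>\<pi>\<close> then absorbs the unit in the first slot.\<close>
  have m\<phi>: "mA \<cdot> \<phi> = \<pi>"
  proof -
    have "mA \<cdot> \<phi> = (mA \<cdot> (mA \<otimes>\<^sub>A ?a)) \<cdot> (?a \<otimes>\<^sub>A (g \<otimes>\<^sub>A ?a))"
      using g X by (simp add: \<phi>_def)
    also have "\<dots> = mA \<cdot> (?a \<otimes>\<^sub>A (\<pi> \<cdot> (One A \<otimes>\<^sub>A Idn C (X \<otimes>\<^sub>O a))))"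
      unfolding alg_eqs(1) mg[symmetric] using g X by (simp add: T.bmap_comp)
    also have "\<dots> = (mA \<cdot> (?a \<otimes>\<^sub>A \<pi>)) \<cdot> (?a \<otimes>\<^sub>A (One A \<otimes>\<^sub>A Idn C (X \<otimes>\<^sub>O a)))"
      using \<pi>' X by (simp add: T.bmap_comp)
    also have "\<dots> = \<pi> \<cdot> (mA \<otimes>\<^sub>A Idn C (X \<otimes>\<^sub>O a)) \<cdot> ((?a \<otimes>\<^sub>A One A) \<otimes>\<^sub>A Idn C (X \<otimes>\<^sub>O a))"
      unfolding \<pi>l[symmetric] rl using \<pi>' X by (simp add: tensor_assoc_ar)
    also have "\<dots> = \<pi>"
      using \<pi>' X by (simp add: T.bmap_comp alg_eqs)
    finally show ?thesis .
  qed
  \<comment> \<open>Left linearity of \<open>\<phi>\<close> is associativity of \<open>A\<close>;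
    right linearity, shown next, is interchange alone, because \<open>\<phi>\<close> leaves the last
    tensor factor untouched.\<close>
  have \<phi>l: "\<phi> \<cdot> (mA \<otimes>\<^sub>A Idn C (X \<otimes>\<^sub>O a)) = (mA \<otimes>\<^sub>A ?a) \<cdot> (?a \<otimes>\<^sub>A \<phi>)"
  proof -
    have "\<phi> \<cdot> (mA \<otimes>\<^sub>A Idn C (X \<otimes>\<^sub>O a)) = (mA \<otimes>\<^sub>A ?a) \<cdot> (mA \<otimes>\<^sub>A (g \<otimes>\<^sub>A ?a))"
      using g X by (simp add: \<phi>_def T.bmap_comp)
    also have "\<dots> = (mA \<otimes>\<^sub>A ?a) \<cdot> ((mA \<otimes>\<^sub>A ?a) \<otimes>\<^sub>A ?a) \<cdot> (Idn C (a \<otimes>\<^sub>O a) \<otimes>\<^sub>A (g \<otimes>\<^sub>A ?a))"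
      using g X T.bmap_comp[of "Idn C (a \<otimes>\<^sub>O a)" mA "g \<otimes>\<^sub>A ?a" "Idn C (a \<otimes>\<^sub>O a)"]
      by (simp add: id_tensor_assoc(2))
    also have "\<dots> = ((mA \<cdot> (mA \<otimes>\<^sub>A ?a)) \<otimes>\<^sub>A ?a) \<cdot> (Idn C (a \<otimes>\<^sub>O a) \<otimes>\<^sub>A (g \<otimes>\<^sub>A ?a))"
      using g X T.bmap_comp_assoc[of "mA \<otimes>\<^sub>A ?a" mA ?a ?a] by simp
    also have "\<dots> = ((mA \<cdot> (?a \<otimes>\<^sub>A mA)) \<otimes>\<^sub>A ?a) \<cdot> (?a \<otimes>\<^sub>A (?a \<otimes>\<^sub>A (g \<otimes>\<^sub>A ?a)))"
      using g X by (simp add: alg_eqs id_tensor_assoc(1))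
    also have "(mA \<cdot> (?a \<otimes>\<^sub>A mA)) \<otimes>\<^sub>A ?a = (mA \<otimes>\<^sub>A ?a) \<cdot> (?a \<otimes>\<^sub>A (mA \<otimes>\<^sub>A ?a))"
      using T.bmap_comp[of "?a \<otimes>\<^sub>A mA" mA ?a ?a] id_tensor_assoc(3)[of a a mA] by simp
    also have "((mA \<otimes>\<^sub>A ?a) \<cdot> (?a \<otimes>\<^sub>A (mA \<otimes>\<^sub>A ?a))) \<cdot> (?a \<otimes>\<^sub>A (?a \<otimes>\<^sub>A (g \<otimes>\<^sub>A ?a)))
        = (mA \<otimes>\<^sub>A ?a) \<cdot> (?a \<otimes>\<^sub>A (mA \<otimes>\<^sub>A ?a)) \<cdot> (?a \<otimes>\<^sub>A (?a \<otimes>\<^sub>A (g \<otimes>\<^sub>A ?a)))"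
      using g X by simp
    also have "\<dots> = (mA \<otimes>\<^sub>A ?a) \<cdot> (?a \<otimes>\<^sub>A \<phi>)"
      using g X by (simp add: \<phi>_def T.bmap_comp)
    finally show ?thesis .
  qed
  have \<phi>r: "\<phi> \<cdot> (?a \<otimes>\<^sub>A (?X \<otimes>\<^sub>A mA)) = (?a \<otimes>\<^sub>A mA) \<cdot> (\<phi> \<otimes>\<^sub>A ?a)"
  proof -
    have "\<phi> \<otimes>\<^sub>A ?a = (mA \<otimes>\<^sub>A Idn C (a \<otimes>\<^sub>O a)) \<cdot> (?a \<otimes>\<^sub>A (g \<otimes>\<^sub>A Idn C (a \<otimes>\<^sub>O a)))"
      using g X T.bmap_comp[of "?a \<otimes>\<^sub>A (g \<otimes>\<^sub>A ?a)" "mA \<otimes>\<^sub>A ?a" ?a ?a]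
      by (simp add: \<phi>_def tensor_assoc_ar)
    then have "(?a \<otimes>\<^sub>A mA) \<cdot> (\<phi> \<otimes>\<^sub>A ?a)
        = (mA \<otimes>\<^sub>A mA) \<cdot> (?a \<otimes>\<^sub>A (g \<otimes>\<^sub>A Idn C (a \<otimes>\<^sub>O a)))"
      using g X by (simp add: T.bmap_comp_assoc)
    also have "mA \<otimes>\<^sub>A mA = (mA \<otimes>\<^sub>A ?a) \<cdot> (?a \<otimes>\<^sub>A (?a \<otimes>\<^sub>A mA))"
      using T.bmap_comp[of "Idn C (a \<otimes>\<^sub>O a)" mA mA ?a] by (simp add: id_tensor_assoc(1))
    finally show ?thesis
      using g X by (simp add: \<phi>_def T.bmap_comp)
  qed
  \<comment> \<open>The bimodule section of the multiplication is \<open>\<phi> \<cdot> i\<close>: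
    composing it with \<open>mA\<close> gives \<open>\<pi> \<cdot> i\<close>, which is the
    identity.\<close>
  have "(\<phi> \<cdot> i) \<cdot> mA = (mA \<otimes>\<^sub>A ?a) \<cdot> (?a \<otimes>\<^sub>A (\<phi> \<cdot> i))"
  proof -
    have "(\<phi> \<cdot> i) \<cdot> mA = (\<phi> \<cdot> (mA \<otimes>\<^sub>A Idn C (X \<otimes>\<^sub>O a))) \<cdot> (?a \<otimes>\<^sub>A i)"
      using \<phi> i' il rl X by simp
    then show ?thesis
      unfolding \<phi>l using \<phi> i' X by (simp add: T.bmap_comp)
  qed
  moreover have "(\<phi> \<cdot> i) \<cdot> mA = (?a \<otimes>\<^sub>A mA) \<cdot> ((\<phi> \<cdot> i) \<otimes>\<^sub>A ?a)"
  proof -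
    have "i \<cdot> mA = (?a \<otimes>\<^sub>A (?X \<otimes>\<^sub>A mA)) \<cdot> (i \<otimes>\<^sub>A ?a)"
      using ir rr by simp
    then have "(\<phi> \<cdot> i) \<cdot> mA = (\<phi> \<cdot> (?a \<otimes>\<^sub>A (?X \<otimes>\<^sub>A mA))) \<cdot> (i \<otimes>\<^sub>A ?a)"
      using \<phi> i' X by simp
    then show ?thesis
      unfolding \<phi>r using \<phi> i' X by (simp add: T.bmap_comp)
  qed
  moreover have "mA \<cdot> \<phi> \<cdot> i = Idn C a"
    using comp_assoc_ar[of i \<phi> mA] m\<phi> \<pi>i \<phi> i' X by simp
  ultimately show ?thesis
    unfolding separable_def bimodule_hom_def regular_bimodule_def tensor_square_bimodule_def
    using \<phi> i' X by (intro bexI[of _ "\<phi> \<cdot> i"]) (simp_all add: Hom_iff)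
qed

section \<open>Natural sections of the action maps from a separability element\<close>

context
  fixes \<sigma>
  assumes \<sigma>: "separability_element \<sigma>"
begin

lemma \<sigma>_simps: "\<sigma> \<in> Ar C" "Src C \<sigma> = Unit C" "Tgt C \<sigma> = a \<otimes>\<^sub>O a"
  "(mA \<otimes>\<^sub>A Idn C a) \<cdot> (Idn C a \<otimes>\<^sub>A \<sigma>) = (Idn C a \<otimes>\<^sub>A mA) \<cdot> (\<sigma> \<otimes>\<^sub>A Idn C a)"
  "mA \<cdot> \<sigma> = One A"
  using \<sigma> by (simp_all add: separability_element_def Hom_iff)

text \<open>In elements: \<open>(v x) \<sigma>' \<otimes> \<sigma>'' = v (x \<sigma>') \<otimes>
  \<sigma>'' = v \<sigma>' \<otimes> \<sigma>'' x\<close>, by associativity of the action and the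
  commutation of \<sigma> with \<open>a\<close>.\<close>

lemma action_section_hom:
  assumes V: "is_right_module C A V"
  shows "action_section \<sigma> V \<in> Hom M V (ActO M (fst V) (a, mA))"
proof -
  obtain v r where Vr: "V = (v, r)"
    by (cases V)
  note V' = module_simps[OF V, unfolded Vr fst_conv snd_conv]
  note s = \<sigma>_simps(1-3)
  let ?a = "Idn C a" and ?v = "Idn C v"
  have "((r \<otimes>\<^sub>A ?a) \<cdot> (?v \<otimes>\<^sub>A \<sigma>)) \<cdot> r = (r \<otimes>\<^sub>A ?a) \<cdot> (r \<otimes>\<^sub>A \<sigma>)"
    using V' s tensor_from_unit(1)[of r \<sigma>] by simp
  also have "\<dots> = (r \<otimes>\<^sub>A ?a) \<cdot> (r \<otimes>\<^sub>A Idn C (a \<otimes>\<^sub>O a)) \<cdot> (Idn C (v \<otimes>\<^sub>O a) \<otimes>\<^sub>A \<sigma>)"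
    using V' s by (simp add: T.bmap_comp)
  also have "\<dots> = ((r \<otimes>\<^sub>A ?a) \<cdot> ((r \<otimes>\<^sub>A ?a) \<otimes>\<^sub>A ?a)) \<cdot> (Idn C (v \<otimes>\<^sub>O a) \<otimes>\<^sub>A \<sigma>)"
    using V' s by (simp add: id_tensor_assoc(2))
  also have "(r \<otimes>\<^sub>A ?a) \<cdot> ((r \<otimes>\<^sub>A ?a) \<otimes>\<^sub>A ?a) = (r \<otimes>\<^sub>A ?a) \<cdot> (?v \<otimes>\<^sub>A (mA \<otimes>\<^sub>A ?a))"
    using V' T.bmap_comp[of "r \<otimes>\<^sub>A ?a" r ?a ?a] T.bmap_comp[of "?v \<otimes>\<^sub>A mA" r ?a ?a]
      id_tensor_assoc(3)[of v a mA] by simp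
  also have "((r \<otimes>\<^sub>A ?a) \<cdot> (?v \<otimes>\<^sub>A (mA \<otimes>\<^sub>A ?a))) \<cdot> (Idn C (v \<otimes>\<^sub>O a) \<otimes>\<^sub>A \<sigma>)
      = (r \<otimes>\<^sub>A ?a) \<cdot> (?v \<otimes>\<^sub>A ((mA \<otimes>\<^sub>A ?a) \<cdot> (?a \<otimes>\<^sub>A \<sigma>)))"
    using V' s T.bmap_comp[of ?v ?v "?a \<otimes>\<^sub>A \<sigma>" "mA \<otimes>\<^sub>A ?a"] by (simp add: id_tensor_assoc(1))
  also have "\<dots> = (r \<otimes>\<^sub>A ?a) \<cdot> (?v \<otimes>\<^sub>A (?a \<otimes>\<^sub>A mA)) \<cdot> (?v \<otimes>\<^sub>A (\<sigma> \<otimes>\<^sub>A ?a))"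
    unfolding \<sigma>_simps(4)
    using V' s T.bmap_comp[of ?v ?v "\<sigma> \<otimes>\<^sub>A ?a" "?a \<otimes>\<^sub>A mA"] by simp
  also have "\<dots> = (r \<otimes>\<^sub>A ?a) \<cdot> (Idn C (v \<otimes>\<^sub>O a) \<otimes>\<^sub>A mA) \<cdot> ((?v \<otimes>\<^sub>A \<sigma>) \<otimes>\<^sub>A ?a)"
    using V' s by (simp add: id_tensor_assoc)
  also have "\<dots> = ((?v \<otimes>\<^sub>A mA) \<cdot> (r \<otimes>\<^sub>A Idn C (a \<otimes>\<^sub>O a))) \<cdot> ((?v \<otimes>\<^sub>A \<sigma>) \<otimes>\<^sub>A ?a)"
    using V' s T.bmap_comp[of "Idn C (v \<otimes>\<^sub>O a)" r mA ?a] T.bmap_comp[of r ?v "Idn C (a \<otimes>\<^sub>O a)" mA]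
      comp_assoc_ar[of "(?v \<otimes>\<^sub>A \<sigma>) \<otimes>\<^sub>A ?a" "Idn C (v \<otimes>\<^sub>O a) \<otimes>\<^sub>A mA" "r \<otimes>\<^sub>A ?a"]
    by (simp del: comp_assoc_ar)
  also have "\<dots> = (?v \<otimes>\<^sub>A mA) \<cdot> (((r \<otimes>\<^sub>A ?a) \<cdot> (?v \<otimes>\<^sub>A \<sigma>)) \<otimes>\<^sub>A ?a)"
    using V' s T.bmap_comp[of "?v \<otimes>\<^sub>A \<sigma>" "r \<otimes>\<^sub>A ?a" ?a ?a] by (simp add: id_tensor_assoc(2))
  finally show ?thesis
    using V Vr V' s act_module[OF regular_module, of v] by (simp add: action_section_def Ar_M Hom_iff)
qed

text \<open>Associativity of the action turns \<open>(v \<sigma>') \<sigma>''\<close> into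
  \<open>v (\<sigma>' \<sigma>'')\<close>, and \<sigma> multiplies to the unit.\<close>

lemma action_map_section:
  assumes V: "is_right_module C A V"
  shows "action_map V \<cdot>\<^bsub>M\<^esub> action_section \<sigma> V = Idn M V"
proof -
  note V' = module_simps[OF V] and s = \<sigma>_simps(1-3)
  let ?a = "Idn C a" and ?v = "Idn C (fst V)"
  have "snd V \<cdot> (snd V \<otimes>\<^sub>A ?a) \<cdot> (?v \<otimes>\<^sub>A \<sigma>) = (snd V \<cdot> (snd V \<otimes>\<^sub>A ?a)) \<cdot> (?v \<otimes>\<^sub>A \<sigma>)"
    using V'(1-4) s by simp
  also have "\<dots> = snd V \<cdot> (?v \<otimes>\<^sub>A (mA \<cdot> \<sigma>))"
    unfolding V'(5) using V'(1-4) s by (simp add: T.bmap_comp)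
  also have "\<dots> = ?v"
    using \<sigma>_simps(5) V' by simp
  finally show ?thesis
    by (simp add: action_map_def action_section_def)
qed

lemma action_section_natural:
  assumes f: "f \<in> Hom M V W"
  shows "action_section \<sigma> W \<cdot>\<^bsub>M\<^esub> f = ActA M (snd (snd f)) (Idn M (a, mA)) \<cdot>\<^bsub>M\<^esub> action_section \<sigma> V"
proof -
  obtain \<phi> where f: "f = (V, W, \<phi>)" and V: "is_right_module C A V" and W: "is_right_module C A W"
    and \<phi>: "\<phi> \<in> Hom C (fst V) (fst W)" and e: "\<phi> \<cdot> snd V = snd W \<cdot> (\<phi> \<otimes>\<^sub>A Idn C a)"
    using f by (auto simp: Hom_M)
  note V' = module_simps[OF V] and W' = module_simps[OF W] and \<phi>' = \<phi>[unfolded Hom_iff]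
    and s = \<sigma>_simps(1-3)
  let ?a = "Idn C a"
  have "((snd W \<otimes>\<^sub>A ?a) \<cdot> (Idn C (fst W) \<otimes>\<^sub>A \<sigma>)) \<cdot> \<phi> = (snd W \<otimes>\<^sub>A ?a) \<cdot> (\<phi> \<otimes>\<^sub>A \<sigma>)"
    using W' V' \<phi>' s tensor_from_unit(1)[of \<phi> \<sigma>] by simp
  also have "\<dots> = ((snd W \<otimes>\<^sub>A ?a) \<cdot> ((\<phi> \<otimes>\<^sub>A ?a) \<otimes>\<^sub>A ?a)) \<cdot> (Idn C (fst V) \<otimes>\<^sub>A \<sigma>)"
    using W' V' \<phi>' s T.bmap_comp[of "Idn C (fst V)" \<phi> \<sigma> "Idn C (a \<otimes>\<^sub>O a)"]
    by (simp add: id_tensor_assoc(2))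
  also have "(snd W \<otimes>\<^sub>A ?a) \<cdot> ((\<phi> \<otimes>\<^sub>A ?a) \<otimes>\<^sub>A ?a) = (\<phi> \<otimes>\<^sub>A ?a) \<cdot> (snd V \<otimes>\<^sub>A ?a)"
    using W' V' \<phi>' e by (simp add: T.bmap_comp)
  finally show ?thesis
    using f V' W' \<phi>' s by (simp add: action_section_def)
qed

text \<open>The coefficient object acts on the left of \<open>v\<close>, the section on its right.
  Together with \<open>action_map_act\<close>, this is what later makes the induced families
  compatible with the balancing.\<close>

lemma action_section_act:
  assumes V: "is_right_module C A V" and X: "X \<in> Ob C"
  shows "ActA M (Idn C X) (action_section \<sigma> V) = action_section \<sigma> (ActO M X V)"
  using module_simps[OF V] X \<sigma>_simps(1-3)
  by (simp add: action_section_def id_tensor_assoc(1,3) T.bmap_comp)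

end

lemma action_map_natural:
  assumes f: "f \<in> Hom M V W"
  shows "f \<cdot>\<^bsub>M\<^esub> action_map V = action_map W \<cdot>\<^bsub>M\<^esub> ActA M (snd (snd f)) (Idn M (a, mA))"
proof -
  obtain \<phi> where "f = (V, W, \<phi>)" "\<phi> \<in> Hom C (fst V) (fst W)"
    "\<phi> \<cdot> snd V = snd W \<cdot> (\<phi> \<otimes>\<^sub>A Idn C a)"
    using f by (auto simp: Hom_M)
  then show ?thesis
    by (simp add: action_map_def Hom_iff)
qed

lemma action_map_act:
  assumes V: "is_right_module C A V" and X: "X \<in> Ob C"
  shows "ActA M (Idn C X) (action_map V) = action_map (ActO M X V)"
  using module_simps[OF V] X by (simp add: action_map_def id_tensor_assoc(1))

declare M_simps [simp del]

sublocale FG: lin_functor M C fst "\<lambda>f. snd (snd f)"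
  by (rule forgetful_functor)

text \<open>From here on module maps are no longer unfolded into triples. These rules record that
  the modules form a strict module category, whose constraints are identities.\<close>

lemma actM_simps [simp]:
  assumes "X \<in> Ob C" "is_right_module C A V"
  shows "is_right_module C A (ActO M X V)" "fst (ActO M X V) = X \<otimes>\<^sub>O fst V"
    "ActA M (Idn C X) (Idn M V) = Idn M (ActO M X V)"
    "Y \<in> Ob C \<Longrightarrow> ActO M X (ActO M Y V) = ActO M (X \<otimes>\<^sub>O Y) V"
    "Y \<in> Ob C \<Longrightarrow> Asc M X Y V = Idn M (ActO M (X \<otimes>\<^sub>O Y) V)"
  using act_module[OF assms(2,1)] assms(1) module_simps[OF assms(2)]
  by (simp_all add: M_simps id_tensor_assoc(1))

lemma actM_unit [simp]:
  assumes "is_right_module C A V"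
  shows "ActO M (Unit C) V = V" "Unt M V = Idn M V"
  using module_simps[OF assms] by (simp_all add: M_simps)

lemma actM_ar [simp]:
  assumes "g \<in> Ar C" "h \<in> Ar M"
  shows "ActA M g h \<in> Ar M" "Src M (ActA M g h) = ActO M (Src C g) (Src M h)"
    "Tgt M (ActA M g h) = ActO M (Tgt C g) (Tgt M h)"
    "snd (snd (ActA M g h)) = g \<otimes>\<^sub>A snd (snd h)"
proof -
  obtain V W \<phi> where h: "h = (V, W, \<phi>)"
    by (cases h)
  have "(V, W, \<phi>) \<in> Hom M V W" "g \<in> Hom C (Src C g) (Tgt C g)"
    using assms h by (simp_all add: Hom_iff M_simps)
  from act_hom[OF this(2,1)]
  show "ActA M g h \<in> Ar M" "Src M (ActA M g h) = ActO M (Src C g) (Src M h)"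
    "Tgt M (ActA M g h) = ActO M (Tgt C g) (Tgt M h)"
    "snd (snd (ActA M g h)) = g \<otimes>\<^sub>A snd (snd h)"
    using h by (simp_all add: M_simps Hom_iff)
qed

end


section \<open>Balanced functors\<close>

locale algebra_action = finite_braided_tensor_category C + tensor_algebra C A + N: module_category C N
  for C :: "('o, 'a, 'k::field, 'z) brmoncat_scheme" (structure) and A :: "('o, 'a) alg"
    and N :: "('n, 'b, 'k, 'o, 'a, 'y) modcat_scheme"
begin

sublocale N: linear_category N
  using N.finite by (simp add: finite_category_def)

sublocale NA: bilin_functor C N N "ActO N" "ActA N"
  using N.action_biexact by unfold_locales (simp add: biexact_def)

lemma braid_simps [simp]:
  assumes "x \<in> Ob C" "y \<in> Ob C"
  shows "Brd C x y \<in> Ar C" "Src C (Brd C x y) = x \<otimes>\<^sub>O y" "Tgt C (Brd C x y) = y \<otimes>\<^sub>O x"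
  using braid_hom[OF assms] by (simp_all add: Hom_iff)

lemma asc_simps [simp]:
  assumes "X \<in> Ob C" "Y \<in> Ob C" "n \<in> Ob N"
  shows "Asc N X Y n \<in> Ar N" "Src N (Asc N X Y n) = X \<rhd>\<^sub>O\<^bsub>N\<^esub> (Y \<rhd>\<^sub>O\<^bsub>N\<^esub> n)"
    "Tgt N (Asc N X Y n) = (X \<otimes>\<^sub>O Y) \<rhd>\<^sub>O\<^bsub>N\<^esub> n"
  using N.asc_hom[OF assms] by (simp_all add: Hom_iff)

lemma unt_simps [simp]:
  assumes "n \<in> Ob N"
  shows "Unt N n \<in> Ar N" "Src N (Unt N n) = Unit C \<rhd>\<^sub>O\<^bsub>N\<^esub> n" "Tgt N (Unt N n) = n"
  using N.unt_hom[OF assms] by (simp_all add: Hom_iff)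

lemma right_asc_simps [simp]:
  assumes "X \<in> Ob C" "Y \<in> Ob C" "n \<in> Ob N"
  shows "right_asc C N n X Y \<in> Ar N" "Src N (right_asc C N n X Y) = Y \<rhd>\<^sub>O\<^bsub>N\<^esub> (X \<rhd>\<^sub>O\<^bsub>N\<^esub> n)"
    "Tgt N (right_asc C N n X Y) = (X \<otimes>\<^sub>O Y) \<rhd>\<^sub>O\<^bsub>N\<^esub> n"
  using assms by (simp_all add: right_asc_def)

lemma right_asc_iso:
  assumes "X \<in> Ob C" "Y \<in> Ob C" "n \<in> Ob N"
  shows "is_iso N (right_asc C N n X Y)"
proof -
  interpret L: lin_functor C N "\<lambda>x. x \<rhd>\<^sub>O\<^bsub>N\<^esub> n" "\<lambda>f. f \<rhd>\<^sub>A\<^bsub>N\<^esub> Idn N n"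
    using assms by (intro NA.bmap_left_functor)
  show ?thesis
    unfolding right_asc_def using assms
    by (intro N.iso_comp N.asc_iso L.map_iso braid_iso) simp_all
qed

lemma right_asc_natural:
  assumes "f \<in> Hom N n n'" "g \<in> Hom C X X'" "h \<in> Hom C Y Y'"
  shows "right_asc C N n' X' Y' \<cdot>\<^bsub>N\<^esub> (h \<rhd>\<^sub>A\<^bsub>N\<^esub> (g \<rhd>\<^sub>A\<^bsub>N\<^esub> f))
    = ((g \<otimes>\<^sub>A h) \<rhd>\<^sub>A\<^bsub>N\<^esub> f) \<cdot>\<^bsub>N\<^esub> right_asc C N n X Y"
proof -
  have ar: "f \<in> Ar N" "Src N f = n" "Tgt N f = n'" "g \<in> Ar C" "Src C g = X" "Tgt C g = X'"
    "h \<in> Ar C" "Src C h = Y" "Tgt C h = Y'"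
    using assms by (simp_all add: Hom_iff)
  have ob: "n \<in> Ob N" "n' \<in> Ob N" "X \<in> Ob C" "X' \<in> Ob C" "Y \<in> Ob C" "Y' \<in> Ob C"
    using N.hom_ob[OF assms(1)] hom_ob[OF assms(2)] hom_ob[OF assms(3)] by simp_all
  have "right_asc C N n' X' Y' \<cdot>\<^bsub>N\<^esub> (h \<rhd>\<^sub>A\<^bsub>N\<^esub> (g \<rhd>\<^sub>A\<^bsub>N\<^esub> f))
      = (Brd C Y' X' \<rhd>\<^sub>A\<^bsub>N\<^esub> Idn N n') \<cdot>\<^bsub>N\<^esub> ((h \<otimes>\<^sub>A g) \<rhd>\<^sub>A\<^bsub>N\<^esub> f) \<cdot>\<^bsub>N\<^esub> Asc N Y X n"
    using ar ob N.asc_natural[OF assms(3,2,1)] by (simp add: right_asc_def)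
  also have "\<dots> = ((Brd C Y' X' \<cdot> (h \<otimes>\<^sub>A g)) \<rhd>\<^sub>A\<^bsub>N\<^esub> f) \<cdot>\<^bsub>N\<^esub> Asc N Y X n"
    using ar ob by (simp add: NA.bmap_comp_assoc)
  also have "\<dots> = ((g \<otimes>\<^sub>A h) \<rhd>\<^sub>A\<^bsub>N\<^esub> f) \<cdot>\<^bsub>N\<^esub> right_asc C N n X Y"
    unfolding braid_natural[OF assms(3,2)] using ar ob by (simp add: right_asc_def NA.bmap_comp_assoc)
  finally show ?thesis .
qed

text \<open>Naturality of the braiding of \<open>v\<close> along \<open>Brd C Y X\<close>; the
  hexagons split both sides into the same three crossings.\<close>

lemma yang_baxter:
  assumes "X \<in> Ob C" "Y \<in> Ob C" "v \<in> Ob C"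
  shows "Brd C v (X \<otimes>\<^sub>O Y) \<cdot> (Idn C v \<otimes>\<^sub>A Brd C Y X)
    = Brd C (Y \<otimes>\<^sub>O v) X \<cdot> (Brd C v Y \<otimes>\<^sub>A Idn C X)"
proof -
  have "Brd C v (X \<otimes>\<^sub>O Y) \<cdot> (Idn C v \<otimes>\<^sub>A Brd C Y X)
      = (Brd C Y X \<otimes>\<^sub>A Idn C v) \<cdot> Brd C v (Y \<otimes>\<^sub>O X)"
    using assms by (intro braid_natural) (simp_all add: Hom_iff)
  then show ?thesis
    using assms by (simp add: hexagon1[of v Y X] hexagon2[of Y v X])
qed

text \<open>The pentagon for the right action of \<open>C\<close> on \<open>N\<close>, and at the
  same time the associativity axiom for the balancing of \<open>(n, v) \<mapsto> v \<rhd> n\<close>.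
  Naturality of the associator collects all braidings on the left, where the Yang-Baxter equation
  exchanges them; the remaining associators are related by the pentagon of \<open>N\<close>.\<close>

lemma right_asc_assoc:
  assumes "X \<in> Ob C" "Y \<in> Ob C" "v \<in> Ob C" "n \<in> Ob N"
  shows "right_asc C N n (X \<otimes>\<^sub>O Y) v \<cdot>\<^bsub>N\<^esub> (Idn C v \<rhd>\<^sub>A\<^bsub>N\<^esub> right_asc C N n X Y)
    = right_asc C N n X (Y \<otimes>\<^sub>O v) \<cdot>\<^bsub>N\<^esub> right_asc C N (X \<rhd>\<^sub>O\<^bsub>N\<^esub> n) Y v"
proof -
  let ?n = "Idn N n"
  have nat1: "Asc N v (X \<otimes>\<^sub>O Y) n \<cdot>\<^bsub>N\<^esub> (Idn C v \<rhd>\<^sub>A\<^bsub>N\<^esub> (Brd C Y X \<rhd>\<^sub>A\<^bsub>N\<^esub> ?n))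
      = ((Idn C v \<otimes>\<^sub>A Brd C Y X) \<rhd>\<^sub>A\<^bsub>N\<^esub> ?n) \<cdot>\<^bsub>N\<^esub> Asc N v (Y \<otimes>\<^sub>O X) n"
    using assms by (intro N.asc_natural) (simp_all add: Hom_iff)
  have nat2: "Asc N (Y \<otimes>\<^sub>O v) X n \<cdot>\<^bsub>N\<^esub> (Brd C v Y \<rhd>\<^sub>A\<^bsub>N\<^esub> Idn N (X \<rhd>\<^sub>O\<^bsub>N\<^esub> n))
      = ((Brd C v Y \<otimes>\<^sub>A Idn C X) \<rhd>\<^sub>A\<^bsub>N\<^esub> ?n) \<cdot>\<^bsub>N\<^esub> Asc N (v \<otimes>\<^sub>O Y) X n"
    using N.asc_natural[of "Brd C v Y" "v \<otimes>\<^sub>O Y" "Y \<otimes>\<^sub>O v" "Idn C X" X X ?n n n] assms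
    by (simp add: Hom_iff)
  have "right_asc C N n (X \<otimes>\<^sub>O Y) v \<cdot>\<^bsub>N\<^esub> (Idn C v \<rhd>\<^sub>A\<^bsub>N\<^esub> right_asc C N n X Y)
      = (Brd C v (X \<otimes>\<^sub>O Y) \<rhd>\<^sub>A\<^bsub>N\<^esub> ?n) \<cdot>\<^bsub>N\<^esub>
        (Asc N v (X \<otimes>\<^sub>O Y) n \<cdot>\<^bsub>N\<^esub> (Idn C v \<rhd>\<^sub>A\<^bsub>N\<^esub> (Brd C Y X \<rhd>\<^sub>A\<^bsub>N\<^esub> ?n))) \<cdot>\<^bsub>N\<^esub>
        (Idn C v \<rhd>\<^sub>A\<^bsub>N\<^esub> Asc N Y X n)"
    using assms NA.bmap_comp[of "Idn C v" "Idn C v" "Asc N Y X n" "Brd C Y X \<rhd>\<^sub>A\<^bsub>N\<^esub> ?n"]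
    by (simp add: right_asc_def)
  also have "\<dots> = ((Brd C v (X \<otimes>\<^sub>O Y) \<cdot> (Idn C v \<otimes>\<^sub>A Brd C Y X)) \<rhd>\<^sub>A\<^bsub>N\<^esub> ?n) \<cdot>\<^bsub>N\<^esub>
      (Asc N v (Y \<otimes>\<^sub>O X) n \<cdot>\<^bsub>N\<^esub> (Idn C v \<rhd>\<^sub>A\<^bsub>N\<^esub> Asc N Y X n))"
    unfolding nat1 using assms by (simp add: NA.bmap_comp_assoc)
  also have "\<dots> = ((Brd C (Y \<otimes>\<^sub>O v) X \<cdot> (Brd C v Y \<otimes>\<^sub>A Idn C X)) \<rhd>\<^sub>A\<^bsub>N\<^esub> ?n) \<cdot>\<^bsub>N\<^esub>
      (Asc N (v \<otimes>\<^sub>O Y) X n \<cdot>\<^bsub>N\<^esub> Asc N v Y (X \<rhd>\<^sub>O\<^bsub>N\<^esub> n))"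
    unfolding yang_baxter[OF assms(1-3)] N.pentagon[OF assms(3,2,1,4)] ..
  also have "\<dots> = (Brd C (Y \<otimes>\<^sub>O v) X \<rhd>\<^sub>A\<^bsub>N\<^esub> ?n) \<cdot>\<^bsub>N\<^esub>
      (((Brd C v Y \<otimes>\<^sub>A Idn C X) \<rhd>\<^sub>A\<^bsub>N\<^esub> ?n) \<cdot>\<^bsub>N\<^esub> Asc N (v \<otimes>\<^sub>O Y) X n) \<cdot>\<^bsub>N\<^esub>
      Asc N v Y (X \<rhd>\<^sub>O\<^bsub>N\<^esub> n)"
    using assms by (simp add: NA.bmap_comp_assoc)
  also have "\<dots> = right_asc C N n X (Y \<otimes>\<^sub>O v) \<cdot>\<^bsub>N\<^esub> right_asc C N (X \<rhd>\<^sub>O\<^bsub>N\<^esub> n) Y v"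
    unfolding nat2[symmetric] using assms by (simp add: right_asc_def)
  finally show ?thesis .
qed

text \<open>A hexagon with two unit objects makes this braiding idempotent, and an idempotent
  isomorphism is the identity.\<close>

lemma braid_unit:
  assumes "x \<in> Ob C"
  shows "Brd C x (Unit C) = Idn C x"
proof (rule iso_cancel_left[OF braid_iso])
  show "Brd C x (Unit C) \<cdot> Brd C x (Unit C) = Brd C x (Unit C) \<cdot> Idn C x"
    using hexagon1[of x "Unit C" "Unit C"] assms by simp
qed (use assms in simp_all)

lemma right_asc_unit:
  assumes "v \<in> Ob C" "n \<in> Ob N"
  shows "right_asc C N n (Unit C) v = Idn C v \<rhd>\<^sub>A\<^bsub>N\<^esub> Unt N n"
  using assms N.triangle[OF assms] N.asc_hom[of v "Unit C" n]
  by (simp add: right_asc_def braid_unit Hom_iff)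

text \<open>Read from the right, the functor is \<open>n \<lhd> v\<close>, so its balancing
  \<open>(n \<lhd> X) \<lhd> v \<rightarrow> n \<lhd> (X \<otimes> v)\<close> is the right
  associator itself. Right exactness in the module variable combines right exactness of the
  forgetful functor with exactness of the action on \<open>n\<close>.\<close>

lemma canonical_balanced:
  "balanced_functor C N M N (\<lambda>n m. fst m \<rhd>\<^sub>O\<^bsub>N\<^esub> n) (\<lambda>f h. snd (snd h) \<rhd>\<^sub>A\<^bsub>N\<^esub> f)
     (\<lambda>n X m. right_asc C N n X (fst m))"
  unfolding balanced_functor_def right_biexact_def
proof (intro conjI ballI allI)
  note bil = NA.bilinear[unfolded bilinear_bifunctor_def]
  show "bilinear_bifunctor N M N (\<lambda>n m. fst m \<rhd>\<^sub>O\<^bsub>N\<^esub> n) (\<lambda>f h. snd (snd h) \<rhd>\<^sub>A\<^bsub>N\<^esub> f)"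
    unfolding bilinear_bifunctor_def
  proof (intro conjI ballI allI)
    fix x x' f f' g
    assume "f \<in> Hom N x x'" "f' \<in> Hom N x x'" "g \<in> Ar M"
    then show "snd (snd g) \<rhd>\<^sub>A\<^bsub>N\<^esub> Add N f f'
        = Add N (snd (snd g) \<rhd>\<^sub>A\<^bsub>N\<^esub> f) (snd (snd g) \<rhd>\<^sub>A\<^bsub>N\<^esub> f')"
      using bil[THEN conjunct2, THEN conjunct2, THEN conjunct2, THEN conjunct2, THEN conjunct1]
        FG.map_simps(1) by blast
  next
    fix y y' f g g'
    assume f: "f \<in> Ar N" and g: "g \<in> Hom M y y'" "g' \<in> Hom M y y'"
    have "snd (snd (Add M g g')) = Add C (snd (snd g)) (snd (snd g'))"
      using FG.linear g unfolding linear_functor_def by blast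
    then show "snd (snd (Add M g g')) \<rhd>\<^sub>A\<^bsub>N\<^esub> f
        = Add N (snd (snd g) \<rhd>\<^sub>A\<^bsub>N\<^esub> f) (snd (snd g') \<rhd>\<^sub>A\<^bsub>N\<^esub> f)"
      using bil[THEN conjunct2, THEN conjunct2, THEN conjunct2, THEN conjunct1]
        FG.map_hom[OF g(1)] FG.map_hom[OF g(2)] f by metis
  next
    fix c f g
    assume f: "f \<in> Ar N" and g: "g \<in> Ar M"
    have "snd (snd (Scl M c g)) = Scl C c (snd (snd g))"
      using FG.linear g unfolding linear_functor_def by blast
    then show "snd (snd g) \<rhd>\<^sub>A\<^bsub>N\<^esub> Scl N c f = Scl N c (snd (snd g) \<rhd>\<^sub>A\<^bsub>N\<^esub> f)"
      "snd (snd (Scl M c g)) \<rhd>\<^sub>A\<^bsub>N\<^esub> f = Scl N c (snd (snd g) \<rhd>\<^sub>A\<^bsub>N\<^esub> f)"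
      using bil[THEN conjunct2, THEN conjunct2, THEN conjunct2, THEN conjunct2, THEN conjunct2]
        FG.map_simps(1)[OF g] f by metis+
  qed (simp_all add: Hom_iff NA.bmap_comp module_simps(1))
next
  fix n
  assume n: "n \<in> Ob N"
  have "right_exact_functor C N (\<lambda>x. x \<rhd>\<^sub>O\<^bsub>N\<^esub> n) (\<lambda>f. f \<rhd>\<^sub>A\<^bsub>N\<^esub> Idn N n)"
    using N.action_biexact n by (simp add: biexact_def exact_functor_def)
  then show "right_exact_functor M N (\<lambda>m. fst m \<rhd>\<^sub>O\<^bsub>N\<^esub> n) (\<lambda>h. snd (snd h) \<rhd>\<^sub>A\<^bsub>N\<^esub> Idn N n)"
    using right_exact_functor_comp[OF forgetful_functor NA.bmap_left_functor[OF n]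
        forgetful_right_exact] by simp
next
  fix m
  assume m: "m \<in> Ob M"
  then show "right_exact_functor N N (\<lambda>n. fst m \<rhd>\<^sub>O\<^bsub>N\<^esub> n) (\<lambda>f. snd (snd (Idn M m)) \<rhd>\<^sub>A\<^bsub>N\<^esub> f)"
    using N.action_biexact module_simps(1) FG.map_id[of m] by (simp add: biexact_def exact_functor_def)
next
  fix n X m
  assume "n \<in> Ob N" "X \<in> Ob C" "m \<in> Ob M"
  then show "right_asc C N n X (fst m) \<in> Hom N (fst m \<rhd>\<^sub>O\<^bsub>N\<^esub> X \<rhd>\<^sub>O\<^bsub>N\<^esub> n) (fst (ActO M X m) \<rhd>\<^sub>O\<^bsub>N\<^esub> n)"
    "is_iso N (right_asc C N n X (fst m))"
    using module_simps(1) by (simp_all add: Hom_iff right_asc_iso)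
next
  fix n n' X X' m m' f g h
  assume f: "f \<in> Hom N n n'" and g: "g \<in> Hom C X X'" and h: "h \<in> Hom M m m'"
  show "right_asc C N n' X' (fst m') \<cdot>\<^bsub>N\<^esub> (snd (snd h) \<rhd>\<^sub>A\<^bsub>N\<^esub> g \<rhd>\<^sub>A\<^bsub>N\<^esub> f)
    = (snd (snd (ActA M g h)) \<rhd>\<^sub>A\<^bsub>N\<^esub> f) \<cdot>\<^bsub>N\<^esub> right_asc C N n X (fst m)"
    using right_asc_natural[OF f g FG.map_hom[OF h]] g h by (simp add: Hom_iff)
next
  fix n X Y m
  assume "n \<in> Ob N" "X \<in> Ob C" "Y \<in> Ob C" "m \<in> Ob M"
  then show "right_asc C N n (X \<otimes>\<^sub>O Y) (fst m) \<cdot>\<^bsub>N\<^esub> (snd (snd (Idn M m)) \<rhd>\<^sub>A\<^bsub>N\<^esub> right_asc C N n X Y)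
    = (snd (snd (Asc M X Y m)) \<rhd>\<^sub>A\<^bsub>N\<^esub> Idn N n) \<cdot>\<^bsub>N\<^esub> right_asc C N n X (fst (ActO M Y m)) \<cdot>\<^bsub>N\<^esub>
      right_asc C N (X \<rhd>\<^sub>O\<^bsub>N\<^esub> n) Y (fst m)"
    using right_asc_assoc[of X Y "fst m" n] module_simps(1)[of m] FG.map_id[of m]
      FG.map_id[of "ActO M (X \<otimes>\<^sub>O Y) m"] by simp
next
  fix n m
  assume "n \<in> Ob N" "m \<in> Ob M"
  then show "(snd (snd (Unt M m)) \<rhd>\<^sub>A\<^bsub>N\<^esub> Idn N n) \<cdot>\<^bsub>N\<^esub> right_asc C N n (Unit C) (fst m)
    = snd (snd (Idn M m)) \<rhd>\<^sub>A\<^bsub>N\<^esub> Unt N n"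
    using module_simps(1)[of m] FG.map_id[of m] by (simp add: right_asc_unit)
qed

end

section \<open>Calculus of balanced functors out of \<open>N\<close> and the right modules\<close>

locale balanced = algebra_action C A N + D: linear_category D
  for C :: "('o, 'a, 'k::field, 'z) brmoncat_scheme" (structure) and A :: "('o, 'a) alg"
    and N :: "('n, 'b, 'k, 'o, 'a, 'y) modcat_scheme" and D :: "('d, 'e, 'k, 'w) lincat_scheme" +
  fixes GO :: "'n \<Rightarrow> 'o \<times> 'a \<Rightarrow> 'd" and GA :: "'b \<Rightarrow> ('o \<times> 'a) \<times> ('o \<times> 'a) \<times> 'a \<Rightarrow> 'e"
    and b :: "'n \<Rightarrow> 'o \<Rightarrow> 'o \<times> 'a \<Rightarrow> 'e"
  assumes balanced: "balanced_functor C N M D GO GA b"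
begin

sublocale G: bilin_functor N M D GO GA
  using balanced by unfold_locales (simp add: balanced_functor_def right_biexact_def)

lemma bal_simps [simp]:
  assumes "n \<in> Ob N" "X \<in> Ob C" "is_right_module C A m"
  shows "b n X m \<in> Ar D" "Src D (b n X m) = GO (X \<rhd>\<^sub>O\<^bsub>N\<^esub> n) m"
    "Tgt D (b n X m) = GO n (ActO M X m)" "is_iso D (b n X m)"
  using balanced assms by (simp_all add: balanced_functor_def Hom_iff)

lemma bal_natural:
  assumes "f \<in> Hom N n n'" "g \<in> Hom C X X'" "h \<in> Hom M m m'"
  shows "b n' X' m' \<cdot>\<^bsub>D\<^esub> GA (g \<rhd>\<^sub>A\<^bsub>N\<^esub> f) h = GA f (ActA M g h) \<cdot>\<^bsub>D\<^esub> b n X m"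
  using balanced[unfolded balanced_functor_def, THEN conjunct2, THEN conjunct2, THEN conjunct1]
    assms by blast

lemma bal_assoc:
  assumes "n \<in> Ob N" "X \<in> Ob C" "Y \<in> Ob C" "is_right_module C A m"
  shows "b n (X \<otimes>\<^sub>O Y) m \<cdot>\<^bsub>D\<^esub> GA (right_asc C N n X Y) (Idn M m)
    = b n X (ActO M Y m) \<cdot>\<^bsub>D\<^esub> b (X \<rhd>\<^sub>O\<^bsub>N\<^esub> n) Y m"
proof -
  have "b n (X \<otimes>\<^sub>O Y) m \<cdot>\<^bsub>D\<^esub> GA (right_asc C N n X Y) (Idn M m)
      = GA (Idn N n) (Asc M X Y m) \<cdot>\<^bsub>D\<^esub> b n X (ActO M Y m) \<cdot>\<^bsub>D\<^esub> b (X \<rhd>\<^sub>O\<^bsub>N\<^esub> n) Y m"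
    using balanced assms by (simp add: balanced_functor_def del: actM_simps actM_unit)
  then show ?thesis
    using assms by simp
qed

lemma bal_unit:
  assumes "n \<in> Ob N" "is_right_module C A m"
  shows "b n (Unit C) m = GA (Unt N n) (Idn M m)"
proof -
  have "GA (Idn N n) (Unt M m) \<cdot>\<^bsub>D\<^esub> b n (Unit C) m = GA (Unt N n) (Idn M m)"
    using balanced assms by (simp add: balanced_functor_def del: actM_simps actM_unit)
  then show ?thesis
    using assms by simp
qed

lemma right_exact_left: "m \<in> Ob M \<Longrightarrow> right_exact_functor N D (\<lambda>n. GO n m) (\<lambda>f. GA f (Idn M m))"
  and right_exact_right: "n \<in> Ob N \<Longrightarrow> right_exact_functor M D (GO n) (GA (Idn N n))"
  using balanced by (simp_all add: balanced_functor_def right_biexact_def)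

text \<open>Postcomposition with an equivalence into an admissible target makes a balanced functor
  accessible to the universal property.\<close>

lemma balanced_comp:
  assumes "lin_functor D E KO KA" and K: "right_exact_functor D E KO KA"
  shows "balanced_functor C N M E (\<lambda>n m. KO (GO n m)) (\<lambda>f h. KA (GA f h)) (\<lambda>n X m. KA (b n X m))"
proof -
  interpret K: lin_functor D E KO KA by fact
  note lin = K.linear[unfolded linear_functor_def]
    and bil = G.bilinear[unfolded bilinear_bifunctor_def]
  show ?thesis
    unfolding balanced_functor_def right_biexact_def
  proof (intro conjI ballI allI)
    show "bilinear_bifunctor N M E (\<lambda>n m. KO (GO n m)) (\<lambda>f h. KA (GA f h))"
      unfolding bilinear_bifunctor_def
    proof (intro conjI ballI allI)
      fix x x' f f' g
      assume f: "f \<in> Hom N x x'" "f' \<in> Hom N x x'" and g: "g \<in> Ar M"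
      have "GA (Add N f f') g = Add D (GA f g) (GA f' g)"
        using bil f g by blast
      moreover have "GA f g \<in> Hom D (GO x (Src M g)) (GO x' (Tgt M g))"
        "GA f' g \<in> Hom D (GO x (Src M g)) (GO x' (Tgt M g))"
        using f g by (simp_all add: Hom_iff)
      ultimately show "KA (GA (Add N f f') g) = Add E (KA (GA f g)) (KA (GA f' g))"
        using lin by simp
    next
      fix y y' f g g'
      assume f: "f \<in> Ar N" and g: "g \<in> Hom M y y'" "g' \<in> Hom M y y'"
      have "GA f (Add M g g') = Add D (GA f g) (GA f g')"
        using bil f g by blast
      moreover have "GA f g \<in> Hom D (GO (Src N f) y) (GO (Tgt N f) y')"
        "GA f g' \<in> Hom D (GO (Src N f) y) (GO (Tgt N f) y')"
        using f g by (simp_all add: Hom_iff)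
      ultimately show "KA (GA f (Add M g g')) = Add E (KA (GA f g)) (KA (GA f g'))"
        using lin by simp
    next
      fix c f g
      assume f: "f \<in> Ar N" and g: "g \<in> Ar M"
      have "GA (Scl N c f) g = Scl D c (GA f g)" "GA f (Scl M c g) = Scl D c (GA f g)"
        using bil f g by blast+
      then show "KA (GA (Scl N c f) g) = Scl E c (KA (GA f g))"
        "KA (GA f (Scl M c g)) = Scl E c (KA (GA f g))"
        using lin f g by simp_all
    next
      fix x x' x'' y y' y'' f f' g g'
      assume "f \<in> Hom N x x'" "f' \<in> Hom N x' x''" "g \<in> Hom M y y'" "g' \<in> Hom M y' y''"
      then show "KA (GA (f' \<cdot>\<^bsub>N\<^esub> f) (g' \<cdot>\<^bsub>M\<^esub> g)) = KA (GA f' g') \<cdot>\<^bsub>E\<^esub> KA (GA f g)"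
        using K.map_comp[of "GA f g" "GA f' g'"] by (simp add: Hom_iff G.bmap_comp)
    qed (simp_all add: Hom_iff)
  next
    fix n
    assume n: "n \<in> Ob N"
    show "right_exact_functor M E (\<lambda>m. KO (GO n m)) (\<lambda>h. KA (GA (Idn N n) h))"
      using right_exact_functor_comp[OF G.bmap_right_functor[OF n] assms(1) right_exact_right[OF n] K] .
  next
    fix m
    assume m: "m \<in> Ob M"
    show "right_exact_functor N E (\<lambda>n. KO (GO n m)) (\<lambda>f. KA (GA f (Idn M m)))"
      using right_exact_functor_comp[OF G.bmap_left_functor[OF m] assms(1) right_exact_left[OF m] K] .
  next
    fix n X m
    assume "n \<in> Ob N" "X \<in> Ob C" "m \<in> Ob M"
    then show "KA (b n X m) \<in> Hom E (KO (GO (X \<rhd>\<^sub>O\<^bsub>N\<^esub> n) m)) (KO (GO n (ActO M X m)))"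
      "is_iso E (KA (b n X m))"
      by (simp_all add: Hom_iff K.map_iso)
  next
    fix n n' X X' m m' f g h
    assume fgh: "f \<in> Hom N n n'" "g \<in> Hom C X X'" "h \<in> Hom M m m'"
    then have ob: "n \<in> Ob N" "n' \<in> Ob N" "X \<in> Ob C" "X' \<in> Ob C" "m \<in> Ob M" "m' \<in> Ob M"
      using N.hom_ob hom_ob M.hom_ob by blast+
    have "KA (b n' X' m' \<cdot>\<^bsub>D\<^esub> GA (g \<rhd>\<^sub>A\<^bsub>N\<^esub> f) h) = KA (GA f (ActA M g h) \<cdot>\<^bsub>D\<^esub> b n X m)"
      using bal_natural[OF fgh] by simp
    then show "KA (b n' X' m') \<cdot>\<^bsub>E\<^esub> KA (GA (g \<rhd>\<^sub>A\<^bsub>N\<^esub> f) h) = KA (GA f (ActA M g h)) \<cdot>\<^bsub>E\<^esub> KA (b n X m)"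
      using fgh ob by (simp add: Hom_iff)
  next
    fix n X Y m
    assume ob: "n \<in> Ob N" "X \<in> Ob C" "Y \<in> Ob C" "m \<in> Ob M"
    have "KA (b n (X \<otimes>\<^sub>O Y) m \<cdot>\<^bsub>D\<^esub> GA (right_asc C N n X Y) (Idn M m))
        = KA (b n X (ActO M Y m) \<cdot>\<^bsub>D\<^esub> b (X \<rhd>\<^sub>O\<^bsub>N\<^esub> n) Y m)"
      using bal_assoc ob by simp
    then show "KA (b n (X \<otimes>\<^sub>O Y) m) \<cdot>\<^bsub>E\<^esub> KA (GA (right_asc C N n X Y) (Idn M m))
      = KA (GA (Idn N n) (Asc M X Y m)) \<cdot>\<^bsub>E\<^esub> KA (b n X (ActO M Y m)) \<cdot>\<^bsub>E\<^esub>
        KA (b (X \<rhd>\<^sub>O\<^bsub>N\<^esub> n) Y m)"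
      using ob by simp
  next
    fix n m
    assume ob: "n \<in> Ob N" "m \<in> Ob M"
    then show "KA (GA (Idn N n) (Unt M m)) \<cdot>\<^bsub>E\<^esub> KA (b n (Unit C) m) = KA (GA (Unt N n) (Idn M m))"
      by (simp add: bal_unit)
  qed
qed

end

section \<open>The relative Deligne product\<close>

lemma balanced_transD:
  assumes "balanced_trans C N M D GO GA b HO HA c t"
  shows "\<lbrakk>n \<in> Ob N; m \<in> Ob M\<rbrakk> \<Longrightarrow> t n m \<in> Hom D (GO n m) (HO n m)"
    and "\<lbrakk>f \<in> Hom N n n'; h \<in> Hom M m m'\<rbrakk> \<Longrightarrow> t n' m' \<cdot>\<^bsub>D\<^esub> GA f h = HA f h \<cdot>\<^bsub>D\<^esub> t n m"
    and "\<lbrakk>n \<in> Ob N; X \<in> Ob C; m \<in> Ob M\<rbrakk>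
      \<Longrightarrow> c n X m \<cdot>\<^bsub>D\<^esub> t (X \<rhd>\<^sub>O\<^bsub>N\<^esub> n) m = t n (X \<rhd>\<^sub>O\<^bsub>M\<^esub> m) \<cdot>\<^bsub>D\<^esub> b n X m"
  using assms unfolding balanced_trans_def by blast+

locale deligne = algebra_action C A N + P: module_category C P
  for C :: "('o, 'a, 'k::field, 'z) brmoncat_scheme" (structure) and A :: "('o, 'a) alg"
    and N :: "('n, 'b, 'k, 'o, 'a, 'y) modcat_scheme" and P :: "('p, 'q, 'k, 'o, 'a, 'w) modcat_scheme" +
  fixes BO :: "'n \<Rightarrow> 'o \<times> 'a \<Rightarrow> 'p" and BA :: "'b \<Rightarrow> ('o \<times> 'a) \<times> ('o \<times> 'a) \<times> 'a \<Rightarrow> 'q"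
    and b :: "'n \<Rightarrow> 'o \<Rightarrow> 'o \<times> 'a \<Rightarrow> 'q" and s :: "'o \<Rightarrow> 'n \<Rightarrow> 'o \<times> 'a \<Rightarrow> 'q"
  assumes universal: "universal_balanced C N M P BO BA b"
    and induced: "induced_action C N M P BO BA b s"
begin

sublocale P: linear_category P
  using P.finite by (simp add: finite_category_def)

sublocale PA: bilin_functor C P P "ActO P" "ActA P"
  using P.action_biexact by unfold_locales (simp add: biexact_def)

sublocale B: balanced C A N P BO BA b
  using universal by unfold_locales (simp add: universal_balanced_def)

text \<open>
  Universality is postulated only for targets of the types of \<open>fd_mod_cat\<close>. Composition with an
  equivalence extends it to finite categories of arbitrary types.
\<close>

lemma universal_factorisation:
  fixes E :: "('d, 'e, 'k, 'v) lincat_scheme"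
  assumes E: "finite_category E" and G: "balanced_functor C N M E GO GA g"
  obtains FO FA t where "lin_functor P E FO FA" "right_exact_functor P E FO FA"
    "balanced_trans C N M E (\<lambda>n m. FO (BO n m)) (\<lambda>f h. FA (BA f h)) (\<lambda>n X m. FA (b n X m))
       GO GA g t"
    "\<And>n m. \<lbrakk>n \<in> Ob N; is_right_module C A m\<rbrakk> \<Longrightarrow> is_iso E (t n m)"
proof -
  obtain D :: "('k fd_mod, 'k fd_mod_arrow, 'k) lincat" and KO KA LO LA \<alpha>
    where D: "finite_category D" and K: "lin_functor E D KO KA" and L: "lin_functor D E LO LA"
      and Kr: "right_exact_functor E D KO KA" and Lr: "right_exact_functor D E LO LA"
      and \<alpha>: "natural_iso E E (\<lambda>x. x) (\<lambda>f. f) (\<lambda>x. LO (KO x)) (\<lambda>f. LA (KA f)) \<alpha>"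
    using finite_categoryE[OF E] by blast
  interpret K: lin_functor E D KO KA by (rule K)
  interpret L: lin_functor D E LO LA by (rule L)
  interpret G: balanced C A N E GO GA g
    by unfold_locales (rule G)
  have E': "lin_functor E E (\<lambda>x. x) (\<lambda>f. f)"
    by unfold_locales (simp add: linear_functor_def)
  \<comment> \<open>The factorisation is found in \<open>D\<close>; \<beta> brings its comparison
    isomorphisms back to \<open>E\<close>.\<close>
  define \<beta> where "\<beta> x = inv_arrow E (\<alpha> x)" for x
  have \<beta>: "natural_iso E E (\<lambda>x. LO (KO x)) (\<lambda>f. LA (KA f)) (\<lambda>x. x) (\<lambda>f. f) \<beta>"
    using natural_iso_inv[OF E' lin_functor_comp[OF K L] \<alpha>] by (simp add: \<beta>_def[abs_def])
  have \<beta>_ar: "\<beta> x \<in> Ar E" "Src E (\<beta> x) = LO (KO x)" "Tgt E (\<beta> x) = x" "is_iso E (\<beta> x)"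
    if "x \<in> Ob E" for x
    using \<beta> that by (simp_all add: natural_iso_def natural_trans_def Hom_iff)
  have \<beta>_nat: "\<beta> (Tgt E f) \<cdot>\<^bsub>E\<^esub> LA (KA f) = f \<cdot>\<^bsub>E\<^esub> \<beta> (Src E f)" if "f \<in> Ar E" for f
    using \<beta> that by (simp add: natural_iso_def natural_trans_def Hom_iff)
  obtain FO FA t where F: "right_exact_functor P D FO FA"
    and t: "balanced_trans C N M D (\<lambda>n m. FO (BO n m)) (\<lambda>f h. FA (BA f h)) (\<lambda>n X m. FA (b n X m))
       (\<lambda>n m. KO (GO n m)) (\<lambda>f h. KA (GA f h)) (\<lambda>n X m. KA (g n X m)) t"
    and iso: "\<forall>n \<in> Ob N. \<forall>m \<in> Ob M. is_iso D (t n m)"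
    using universal D G.balanced_comp[OF K Kr] unfolding universal_balanced_def by meson
  interpret F: lin_functor P D FO FA
    using F by unfold_locales (simp add: right_exact_functor_def)
  have t_ar: "t n m \<in> Ar D" "Src D (t n m) = FO (BO n m)" "Tgt D (t n m) = KO (GO n m)"
    if "n \<in> Ob N" "is_right_module C A m" for n m
    using balanced_transD(1)[OF t, of n m] that by (simp_all add: Hom_iff)
  define t' where "t' n m = \<beta> (GO n m) \<cdot>\<^bsub>E\<^esub> LA (t n m)" for n m
  \<comment> \<open>Naturality and compatibility with the balancing are squares of the same shape,
    so one computation transports both.\<close>
  have key: "t' n' m' \<cdot>\<^bsub>E\<^esub> LA (FA p) = h \<cdot>\<^bsub>E\<^esub> t' n m"
    if p: "p \<in> Hom P (BO n m) (BO n' m')" and h: "h \<in> Hom E (GO n m) (GO n' m')"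
      and ob: "n \<in> Ob N" "n' \<in> Ob N" "is_right_module C A m" "is_right_module C A m'"
      and eq: "t n' m' \<cdot>\<^bsub>D\<^esub> FA p = KA h \<cdot>\<^bsub>D\<^esub> t n m" for n n' m m' p h
  proof -
    have "t' n' m' \<cdot>\<^bsub>E\<^esub> LA (FA p) = \<beta> (GO n' m') \<cdot>\<^bsub>E\<^esub> LA (t n' m' \<cdot>\<^bsub>D\<^esub> FA p)"
      using p ob t_ar \<beta>_ar by (simp add: t'_def Hom_iff)
    also have "\<dots> = (\<beta> (GO n' m') \<cdot>\<^bsub>E\<^esub> LA (KA h)) \<cdot>\<^bsub>E\<^esub> LA (t n m)"
      unfolding eq using h ob t_ar \<beta>_ar by (simp add: Hom_iff)
    also have "\<dots> = h \<cdot>\<^bsub>E\<^esub> t' n m"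
      using \<beta>_nat[of h] h ob t_ar \<beta>_ar by (simp add: Hom_iff t'_def)
    finally show ?thesis .
  qed
  have "balanced_trans C N M E (\<lambda>n m. LO (FO (BO n m))) (\<lambda>f h. LA (FA (BA f h)))
      (\<lambda>n X m. LA (FA (b n X m))) GO GA g t'"
    unfolding balanced_trans_def
  proof (intro conjI ballI allI)
    fix n m
    assume "n \<in> Ob N" "m \<in> Ob M"
    then show "t' n m \<in> Hom E (LO (FO (BO n m))) (GO n m)"
      using t_ar \<beta>_ar by (simp add: t'_def Hom_iff)
  next
    fix n n' m m' f h
    assume fh: "f \<in> Hom N n n'" "h \<in> Hom M m m'"
    then have ob: "n \<in> Ob N" "n' \<in> Ob N" "is_right_module C A m" "is_right_module C A m'"
      using N.hom_ob[OF fh(1)] M.hom_ob[OF fh(2)] by simp_all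
    show "t' n' m' \<cdot>\<^bsub>E\<^esub> LA (FA (BA f h)) = GA f h \<cdot>\<^bsub>E\<^esub> t' n m"
      using balanced_transD(2)[OF t fh] fh ob by (intro key) (simp_all add: Hom_iff)
  next
    fix n X m
    assume "n \<in> Ob N" "X \<in> Ob C" "m \<in> Ob M"
    then show "g n X m \<cdot>\<^bsub>E\<^esub> t' (X \<rhd>\<^sub>O\<^bsub>N\<^esub> n) m = t' n (ActO M X m) \<cdot>\<^bsub>E\<^esub> LA (FA (b n X m))"
      using balanced_transD(3)[OF t] by (intro key[symmetric]) (simp_all add: Hom_iff)
  qed
  moreover have "is_iso E (t' n m)" if "n \<in> Ob N" "is_right_module C A m" for n m
    using that iso t_ar \<beta>_ar unfolding t'_def by (intro K.A.iso_comp L.map_iso) simp_all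
  ultimately show ?thesis
    using that[OF lin_functor_comp[OF F.lin_functor_axioms L]
        right_exact_functor_comp[OF F.lin_functor_axioms L F Lr]] by blast
qed

lemma balanced_trans_map:
  assumes "lin_functor E D KO KA" "lin_functor P E FO FA" "lin_functor P E FO' FA'"
    and t: "balanced_trans C N M E (\<lambda>n m. FO (BO n m)) (\<lambda>f h. FA (BA f h)) (\<lambda>n X m. FA (b n X m))
       (\<lambda>n m. FO' (BO n m)) (\<lambda>f h. FA' (BA f h)) (\<lambda>n X m. FA' (b n X m)) t"
  shows "balanced_trans C N M D
       (\<lambda>n m. KO (FO (BO n m))) (\<lambda>f h. KA (FA (BA f h))) (\<lambda>n X m. KA (FA (b n X m)))
       (\<lambda>n m. KO (FO' (BO n m))) (\<lambda>f h. KA (FA' (BA f h))) (\<lambda>n X m. KA (FA' (b n X m)))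
       (\<lambda>n m. KA (t n m))"
  unfolding balanced_trans_def
proof (intro conjI ballI allI)
  interpret K: lin_functor E D KO KA by fact
  interpret F: lin_functor P E FO FA by fact
  interpret F': lin_functor P E FO' FA' by fact
  have t_ar: "t n m \<in> Ar E" "Src E (t n m) = FO (BO n m)" "Tgt E (t n m) = FO' (BO n m)"
    if "n \<in> Ob N" "is_right_module C A m" for n m
    using balanced_transD(1)[OF t, of n m] that by (simp_all add: Hom_iff)
  {
    fix n m
    assume "n \<in> Ob N" "m \<in> Ob M"
    then show "KA (t n m) \<in> Hom D (KO (FO (BO n m))) (KO (FO' (BO n m)))"
      using t_ar by (simp add: Hom_iff)
  next
    fix n n' m m' f h
    assume fh: "f \<in> Hom N n n'" "h \<in> Hom M m m'"
    then have ob: "n \<in> Ob N" "n' \<in> Ob N" "is_right_module C A m" "is_right_module C A m'"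
      using N.hom_ob[OF fh(1)] M.hom_ob[OF fh(2)] by simp_all
    have "KA (t n' m' \<cdot>\<^bsub>E\<^esub> FA (BA f h)) = KA (FA' (BA f h) \<cdot>\<^bsub>E\<^esub> t n m)"
      using balanced_transD(2)[OF t fh] by simp
    then show "KA (t n' m') \<cdot>\<^bsub>D\<^esub> KA (FA (BA f h)) = KA (FA' (BA f h)) \<cdot>\<^bsub>D\<^esub> KA (t n m)"
      using fh ob t_ar by (simp add: Hom_iff)
  next
    fix n X m
    assume ob: "n \<in> Ob N" "X \<in> Ob C" "m \<in> Ob M"
    then have "KA (FA' (b n X m) \<cdot>\<^bsub>E\<^esub> t (X \<rhd>\<^sub>O\<^bsub>N\<^esub> n) m) = KA (t n (ActO M X m) \<cdot>\<^bsub>E\<^esub> FA (b n X m))"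
      using balanced_transD(3)[OF t] by simp
    then show "KA (FA' (b n X m)) \<cdot>\<^bsub>D\<^esub> KA (t (X \<rhd>\<^sub>O\<^bsub>N\<^esub> n) m)
      = KA (t n (ActO M X m)) \<cdot>\<^bsub>D\<^esub> KA (FA (b n X m))"
      using ob t_ar by simp
  }
qed

text \<open>The second part is the device for proving equations on \<open>P\<close>: two natural
  transformations coincide once they agree on the objects \<open>BO n m\<close> with a balanced
  family. Existence is transported through the equivalence with an admissible target, and uniqueness
  follows from its faithfulness.\<close>

lemma universal_full_faithful:
  fixes E :: "('d, 'e, 'k, 'v) lincat_scheme"
  assumes E: "finite_category E" and F: "lin_functor P E FO FA" and F': "lin_functor P E FO' FA'"
    and Fr: "right_exact_functor P E FO FA" and Fr': "right_exact_functor P E FO' FA'"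
    and t: "balanced_trans C N M E (\<lambda>n m. FO (BO n m)) (\<lambda>f h. FA (BA f h)) (\<lambda>n X m. FA (b n X m))
       (\<lambda>n m. FO' (BO n m)) (\<lambda>f h. FA' (BA f h)) (\<lambda>n X m. FA' (b n X m)) t"
  shows "\<exists>r. natural_trans P E FO FA FO' FA' r \<and>
      (\<forall>n m. n \<in> Ob N \<and> is_right_module C A m \<longrightarrow> r (BO n m) = t n m)" (is ?thesis1)
    and "\<lbrakk>natural_trans P E FO FA FO' FA' r;
        \<And>n m. \<lbrakk>n \<in> Ob N; is_right_module C A m\<rbrakk> \<Longrightarrow> r (BO n m) = t n m;
        natural_trans P E FO FA FO' FA' r';
        \<And>n m. \<lbrakk>n \<in> Ob N; is_right_module C A m\<rbrakk> \<Longrightarrow> r' (BO n m) = t n m; p \<in> Ob P\<rbrakk>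
      \<Longrightarrow> r p = r' p"
proof -
  obtain D :: "('k fd_mod, 'k fd_mod_arrow, 'k) lincat" and KO KA LO LA \<alpha>
    where D: "finite_category D" and K: "lin_functor E D KO KA" and L: "lin_functor D E LO LA"
      and Kr: "right_exact_functor E D KO KA" and Lr: "right_exact_functor D E LO LA"
      and \<alpha>: "natural_iso E E (\<lambda>x. x) (\<lambda>f. f) (\<lambda>x. LO (KO x)) (\<lambda>f. LA (KA f)) \<alpha>"
    using finite_categoryE[OF E] by blast
  interpret K: lin_functor E D KO KA by (rule K)
  interpret L: lin_functor D E LO LA by (rule L)
  interpret F: lin_functor P E FO FA by (rule F)
  interpret F': lin_functor P E FO' FA' by (rule F')
  have \<alpha>_ar: "\<alpha> x \<in> Ar E" "Src E (\<alpha> x) = x" "Tgt E (\<alpha> x) = LO (KO x)" "is_iso E (\<alpha> x)"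
    if "x \<in> Ob E" for x
    using \<alpha> that by (simp_all add: natural_iso_def natural_trans_def Hom_iff)
  note inv = K.A.iso_inv[OF \<alpha>_ar(4)]
  have \<alpha>_nat: "\<alpha> y \<cdot>\<^bsub>E\<^esub> f = LA (KA f) \<cdot>\<^bsub>E\<^esub> \<alpha> x" if "f \<in> Hom E x y" for f x y
    using \<alpha> that by (simp add: natural_iso_def natural_trans_def)
  let ?H = "natural_trans P D (\<lambda>x. KO (FO x)) (\<lambda>f. KA (FA f)) (\<lambda>x. KO (FO' x)) (\<lambda>f. KA (FA' f))"
  have "\<exists>r. ?H r \<and> (\<forall>n \<in> Ob N. \<forall>m \<in> Ob M. r (BO n m) = KA (t n m)) \<and>
      (\<forall>r'. ?H r' \<and> (\<forall>n \<in> Ob N. \<forall>m \<in> Ob M. r' (BO n m) = KA (t n m)) \<longrightarrow>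
        (\<forall>p \<in> Ob P. r' p = r p))"
    using universal[unfolded universal_balanced_def, THEN conjunct2, THEN conjunct2, rule_format,
        OF D, THEN conjunct2, rule_format, OF conjI[OF right_exact_functor_comp[OF F K Fr Kr]
          conjI[OF right_exact_functor_comp[OF F' K Fr' Kr] balanced_trans_map[OF K F F' t]]]] .
  then obtain q where q: "?H q" "\<forall>n \<in> Ob N. \<forall>m \<in> Ob M. q (BO n m) = KA (t n m)"
    and uniq: "\<And>r' p. \<lbrakk>?H r'; \<forall>n \<in> Ob N. \<forall>m \<in> Ob M. r' (BO n m) = KA (t n m); p \<in> Ob P\<rbrakk>
      \<Longrightarrow> r' p = q p"
    by blast
  show ?thesis1
  proof (intro exI conjI allI impI)
    \<comment> \<open>The transformation \<open>q\<close> lives in \<open>D\<close>; its image under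
      \<open>LA\<close> is conjugated by the unit of the equivalence.\<close>
    let ?r = "\<lambda>p. inv_arrow E (\<alpha> (FO' p)) \<cdot>\<^bsub>E\<^esub> LA (q p) \<cdot>\<^bsub>E\<^esub> \<alpha> (FO p)"
    have q_ar: "q p \<in> Ar D" "Src D (q p) = KO (FO p)" "Tgt D (q p) = KO (FO' p)"
      if "p \<in> Ob P" for p
      using q(1) that by (simp_all add: natural_trans_def Hom_iff)
    show "natural_trans P E FO FA FO' FA' ?r"
      unfolding natural_trans_def
    proof (intro conjI ballI allI)
      show "?r p \<in> Hom E (FO p) (FO' p)" if "p \<in> Ob P" for p
        using that q_ar \<alpha>_ar inv by (simp add: Hom_iff)
      fix x y f
      assume f: "f \<in> Hom P x y"
      have xy: "x \<in> Ob P" "y \<in> Ob P"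
        using P.hom_ob[OF f] by simp_all
      have "LA (q y) \<cdot>\<^bsub>E\<^esub> LA (KA (FA f)) = LA (KA (FA' f)) \<cdot>\<^bsub>E\<^esub> LA (q x)"
      proof -
        have "LA (q y \<cdot>\<^bsub>D\<^esub> KA (FA f)) = LA (KA (FA' f) \<cdot>\<^bsub>D\<^esub> q x)"
          using q(1) f by (simp add: natural_trans_def)
        then show ?thesis
          using f xy q_ar by (simp add: Hom_iff)
      qed
      note LAq = this
      have "\<alpha> (FO' y) \<cdot>\<^bsub>E\<^esub> (?r y \<cdot>\<^bsub>E\<^esub> FA f) = LA (q y) \<cdot>\<^bsub>E\<^esub> \<alpha> (FO y) \<cdot>\<^bsub>E\<^esub> FA f"
        using f xy q_ar \<alpha>_ar inv by (simp add: Hom_iff K.A.iso_inv_comp)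
      also have "\<dots> = (LA (q y) \<cdot>\<^bsub>E\<^esub> LA (KA (FA f))) \<cdot>\<^bsub>E\<^esub> \<alpha> (FO x)"
        using \<alpha>_nat[OF F.map_hom[OF f]] f xy q_ar \<alpha>_ar by (simp add: Hom_iff)
      also have "\<dots> = LA (KA (FA' f)) \<cdot>\<^bsub>E\<^esub> LA (q x) \<cdot>\<^bsub>E\<^esub> \<alpha> (FO x)"
        unfolding LAq using f xy q_ar \<alpha>_ar by (simp add: Hom_iff)
      also have "\<dots> = LA (KA (FA' f)) \<cdot>\<^bsub>E\<^esub> \<alpha> (FO' x) \<cdot>\<^bsub>E\<^esub> ?r x"
        using f xy q_ar \<alpha>_ar inv by (simp add: Hom_iff K.A.iso_inv_comp)
      also have "\<dots> = (LA (KA (FA' f)) \<cdot>\<^bsub>E\<^esub> \<alpha> (FO' x)) \<cdot>\<^bsub>E\<^esub> ?r x"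
        using f xy q_ar \<alpha>_ar inv by (simp add: Hom_iff)
      also have "\<dots> = \<alpha> (FO' y) \<cdot>\<^bsub>E\<^esub> (FA' f \<cdot>\<^bsub>E\<^esub> ?r x)"
        unfolding \<alpha>_nat[OF F'.map_hom[OF f], symmetric]
        using f xy q_ar \<alpha>_ar inv by (simp add: Hom_iff)
      finally have eq: "\<alpha> (FO' y) \<cdot>\<^bsub>E\<^esub> (?r y \<cdot>\<^bsub>E\<^esub> FA f) = \<alpha> (FO' y) \<cdot>\<^bsub>E\<^esub> (FA' f \<cdot>\<^bsub>E\<^esub> ?r x)" .
      show "?r y \<cdot>\<^bsub>E\<^esub> FA f = FA' f \<cdot>\<^bsub>E\<^esub> ?r x"
        by (rule K.A.iso_cancel_left[OF \<alpha>_ar(4)[of "FO' y"] _ _ _ _ eq])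
          (use f xy q_ar \<alpha>_ar inv in \<open>simp_all add: Hom_iff\<close>)
    qed
    fix n m
    assume nm: "n \<in> Ob N \<and> is_right_module C A m"
    then have tH: "t n m \<in> Hom E (FO (BO n m)) (FO' (BO n m))"
      using balanced_transD(1)[OF t] by simp
    moreover have "q (BO n m) = KA (t n m)"
      using nm q(2) Ob_M by blast
    ultimately show "?r (BO n m) = t n m"
      using nm \<alpha>_nat[OF tH] \<alpha>_ar K.A.iso_inv_comp(1)[OF \<alpha>_ar(4)[of "FO' (BO n m)"], of "t n m"]
      by (simp add: Hom_iff)
  qed
  assume r: "natural_trans P E FO FA FO' FA' r" "natural_trans P E FO FA FO' FA' r'"
    and eq: "\<And>n m. \<lbrakk>n \<in> Ob N; is_right_module C A m\<rbrakk> \<Longrightarrow> r (BO n m) = t n m"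
      "\<And>n m. \<lbrakk>n \<in> Ob N; is_right_module C A m\<rbrakk> \<Longrightarrow> r' (BO n m) = t n m" and p: "p \<in> Ob P"
  have nat: "?H (\<lambda>p. KA (u p))" if u: "natural_trans P E FO FA FO' FA' u" for u
    unfolding natural_trans_def
  proof (intro conjI ballI allI)
    show "KA (u p) \<in> Hom D (KO (FO p)) (KO (FO' p))" if "p \<in> Ob P" for p
      using u that by (simp add: natural_trans_def K.map_hom)
    fix x y f
    assume f: "f \<in> Hom P x y"
    have "u x \<in> Hom E (FO x) (FO' x)" "u y \<in> Hom E (FO y) (FO' y)"
      using u P.hom_ob[OF f] by (simp_all add: natural_trans_def)
    moreover have "KA (u y \<cdot>\<^bsub>E\<^esub> FA f) = KA (FA' f \<cdot>\<^bsub>E\<^esub> u x)"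
      using u f by (simp add: natural_trans_def)
    ultimately show "KA (u y) \<cdot>\<^bsub>D\<^esub> KA (FA f) = KA (FA' f) \<cdot>\<^bsub>D\<^esub> KA (u x)"
      using f by (simp add: Hom_iff)
  qed
  have "\<forall>n \<in> Ob N. \<forall>m \<in> Ob M. KA (r (BO n m)) = KA (t n m)"
    "\<forall>n \<in> Ob N. \<forall>m \<in> Ob M. KA (r' (BO n m)) = KA (t n m)"
    by (intro ballI; simp add: eq)+
  then have "KA (r p) = KA (r' p)"
    using uniq[OF nat[OF r(1)] _ p] uniq[OF nat[OF r(2)] _ p] by metis
  moreover have "r p \<in> Hom E (FO p) (FO' p)" "r' p \<in> Hom E (FO p) (FO' p)"
    using r p by (simp_all add: natural_trans_def)
  ultimately show "r p = r' p"
    using equivalence_faithful[OF K L \<alpha>] by blast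
qed

end

section \<open>The regular module and its action map\<close>

context tensor_algebra
begin

abbreviation "R \<equiv> (a, mA)"

lemma regular_simps [simp]: "is_right_module C A R"
  by (rule regular_module)

lemma action_map_simps [simp]:
  assumes "is_right_module C A m"
  shows "action_map m \<in> Ar M" "Src M (action_map m) = ActO M (fst m) R" "Tgt M (action_map m) = m"
  using action_map_hom[OF assms] by (simp_all add: Hom_iff)

lemma action_section_simps [simp]:
  assumes "separability_element \<sigma>" "is_right_module C A m"
  shows "action_section \<sigma> m \<in> Ar M" "Src M (action_section \<sigma> m) = m" "Tgt M (action_section \<sigma> m) = ActO M (fst m) R"
  using action_section_hom[OF assms] by (simp_all add: Hom_iff)

text \<open>The left unit law of \<open>A\<close>, which becomes the algebraic content of the
  triangle identity between \<open>F\<close> and \<open>U\<close>.\<close>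

lemma action_map_unit: "action_map R \<cdot>\<^bsub>M\<^esub> ActA M (One A) (Idn M R) = Idn M R"
  by (simp add: action_map_def M_simps alg_eqs)

lemma module_ob [simp]: "is_right_module C A m \<Longrightarrow> fst m \<in> Ob C"
  by (rule module_simps(1))

end

text \<open>
  \<open>U : P \<rightarrow> N\<close> forgets the action of \<open>A\<close>. It is right adjoint to \<open>n \<mapsto> B (n, A)\<close>.
\<close>

locale deligne_forgetful = deligne C A N P BO BA b s + U: lin_functor P N UO UA
  for C :: "('o, 'a, 'k::field, 'z) brmoncat_scheme" (structure) and A :: "('o, 'a) alg"
    and N :: "('n, 'b, 'k, 'o, 'a, 'y) modcat_scheme" and P :: "('p, 'q, 'k, 'o, 'a, 'w) modcat_scheme"
    and BO BA b s UO UA +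
  fixes u :: "'n \<Rightarrow> 'o \<times> 'a \<Rightarrow> 'b"
  assumes U_right_exact: "right_exact_functor P N UO UA"
    and u_trans: "balanced_trans C N M N
      (\<lambda>n m. UO (BO n m)) (\<lambda>f h. UA (BA f h)) (\<lambda>n X m. UA (b n X m))
      (\<lambda>n m. fst m \<rhd>\<^sub>O\<^bsub>N\<^esub> n) (\<lambda>f h. snd (snd h) \<rhd>\<^sub>A\<^bsub>N\<^esub> f) (\<lambda>n X m. right_asc C N n X (fst m)) u"
    and u_iso: "\<lbrakk>n \<in> Ob N; is_right_module C A m\<rbrakk> \<Longrightarrow> is_iso N (u n m)"
begin

section \<open>Counit and section of the counit, given on the objects \<open>BO n m\<close>\<close>

lemma u_simps [simp]:
  assumes "n \<in> Ob N" "is_right_module C A m"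
  shows "u n m \<in> Ar N" "Src N (u n m) = UO (BO n m)" "Tgt N (u n m) = fst m \<rhd>\<^sub>O\<^bsub>N\<^esub> n"
  using balanced_transD(1)[OF u_trans, of n m] assms by (simp_all add: Hom_iff)

sublocale F: lin_functor N P "\<lambda>n. BO n R" "\<lambda>f. BA f (Idn M R)"
  by (rule B.G.bmap_left_functor) simp

sublocale FU: lin_functor P P "\<lambda>p. BO (UO p) R" "\<lambda>f. BA (UA f) (Idn M R)"
  by (rule lin_functor_comp[OF U.lin_functor_axioms F.lin_functor_axioms])

lemma id_functor: "lin_functor P P (\<lambda>p. p) (\<lambda>f. f)"
  by unfold_locales (simp add: linear_functor_def)

lemma FU_right_exact: "right_exact_functor P P (\<lambda>p. BO (UO p) R) (\<lambda>f. BA (UA f) (Idn M R))"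
  by (rule right_exact_functor_comp[OF U.lin_functor_axioms F.lin_functor_axioms U_right_exact
        B.right_exact_left]) simp

text \<open>Identifies \<open>F (U (B (n, m)))\<close> with \<open>B\<close> of \<open>n\<close> and
  the free module on \<open>m\<close>: \<open>u\<close> computes \<open>U\<close>, and the balancing
  moves the underlying object of \<open>m\<close> to the second variable.\<close>

definition free_iso :: "'n \<Rightarrow> 'o \<times> 'a \<Rightarrow> 'q" where
  "free_iso n m = b n (fst m) R \<cdot>\<^bsub>P\<^esub> BA (u n m) (Idn M R)"

lemma free_iso_simps [simp]:
  assumes "n \<in> Ob N" "is_right_module C A m"
  shows "free_iso n m \<in> Ar P" "Src P (free_iso n m) = BO (UO (BO n m)) R"
    "Tgt P (free_iso n m) = BO n (ActO M (fst m) R)" "is_iso P (free_iso n m)"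
  using assms u_iso[OF assms] by (simp_all add: free_iso_def P.iso_comp F.map_iso)

lemma free_iso_natural:
  assumes f: "f \<in> Hom N n n'" and h: "h \<in> Hom M m m'"
  shows "free_iso n' m' \<cdot>\<^bsub>P\<^esub> BA (UA (BA f h)) (Idn M R)
    = BA f (ActA M (snd (snd h)) (Idn M R)) \<cdot>\<^bsub>P\<^esub> free_iso n m"
proof -
  note ar = f[unfolded Hom_iff] h[unfolded Hom_iff]
  have ob: "n \<in> Ob N" "n' \<in> Ob N" "is_right_module C A m" "is_right_module C A m'"
    using N.hom_ob[OF f] M.hom_ob[OF h] by simp_all
  have R: "Idn M R \<in> Hom M R R"
    using M.id_hom[of R] by simp
  have "free_iso n' m' \<cdot>\<^bsub>P\<^esub> BA (UA (BA f h)) (Idn M R)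
      = b n' (fst m') R \<cdot>\<^bsub>P\<^esub> BA (u n' m' \<cdot>\<^bsub>N\<^esub> UA (BA f h)) (Idn M R)"
    using ar ob by (simp add: free_iso_def)
  also have "\<dots> = (b n' (fst m') R \<cdot>\<^bsub>P\<^esub> BA (snd (snd h) \<rhd>\<^sub>A\<^bsub>N\<^esub> f) (Idn M R)) \<cdot>\<^bsub>P\<^esub> BA (u n m) (Idn M R)"
    unfolding balanced_transD(2)[OF u_trans f h] using ar ob by simp
  also have "\<dots> = BA f (ActA M (snd (snd h)) (Idn M R)) \<cdot>\<^bsub>P\<^esub> free_iso n m"
    unfolding B.bal_natural[OF f FG.map_hom[OF h] R] using ar ob by (simp add: free_iso_def)
  finally show ?thesis .
qed

text \<open>\<open>u\<close> turns the image of the balancing under \<open>U\<close> into the right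
  associator, and \<open>bal_assoc\<close> turns that associator into the balancing at the free
  module.\<close>

lemma free_iso_balanced:
  assumes "n \<in> Ob N" "X \<in> Ob C" "is_right_module C A m"
  shows "free_iso n (ActO M X m) \<cdot>\<^bsub>P\<^esub> BA (UA (b n X m)) (Idn M R)
    = b n X (ActO M (fst m) R) \<cdot>\<^bsub>P\<^esub> free_iso (X \<rhd>\<^sub>O\<^bsub>N\<^esub> n) m"
proof -
  have "free_iso n (ActO M X m) \<cdot>\<^bsub>P\<^esub> BA (UA (b n X m)) (Idn M R)
      = b n (X \<otimes>\<^sub>O fst m) R \<cdot>\<^bsub>P\<^esub> BA (u n (ActO M X m) \<cdot>\<^bsub>N\<^esub> UA (b n X m)) (Idn M R)"
    using assms by (simp add: free_iso_def)
  also have "u n (ActO M X m) \<cdot>\<^bsub>N\<^esub> UA (b n X m)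
      = right_asc C N n X (fst m) \<cdot>\<^bsub>N\<^esub> u (X \<rhd>\<^sub>O\<^bsub>N\<^esub> n) m"
    using balanced_transD(3)[OF u_trans] assms by simp
  also have "b n (X \<otimes>\<^sub>O fst m) R \<cdot>\<^bsub>P\<^esub> BA (right_asc C N n X (fst m) \<cdot>\<^bsub>N\<^esub> u (X \<rhd>\<^sub>O\<^bsub>N\<^esub> n) m) (Idn M R)
      = (b n (X \<otimes>\<^sub>O fst m) R \<cdot>\<^bsub>P\<^esub> BA (right_asc C N n X (fst m)) (Idn M R)) \<cdot>\<^bsub>P\<^esub>
        BA (u (X \<rhd>\<^sub>O\<^bsub>N\<^esub> n) m) (Idn M R)"
    using assms by simp
  also have "\<dots> = b n X (ActO M (fst m) R) \<cdot>\<^bsub>P\<^esub> free_iso (X \<rhd>\<^sub>O\<^bsub>N\<^esub> n) m"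
    using assms by (simp add: B.bal_assoc free_iso_def)
  finally show ?thesis .
qed

text \<open>On \<open>BO n m\<close> the counit is the action map of \<open>m\<close>, read through
  \<open>free_iso\<close>. Naturality and C-linearity of action maps make this a balanced
  transformation, which full faithfulness extends to all of \<open>P\<close>.\<close>

lemma counit:
  "\<exists>\<epsilon>. natural_trans P P (\<lambda>p. BO (UO p) R) (\<lambda>f. BA (UA f) (Idn M R)) (\<lambda>p. p) (\<lambda>f. f) \<epsilon> \<and>
    (\<forall>n m. n \<in> Ob N \<and> is_right_module C A m \<longrightarrow> \<epsilon> (BO n m) = BA (Idn N n) (action_map m) \<cdot>\<^bsub>P\<^esub> free_iso n m)"
proof (rule universal_full_faithful(1)[OF P.finite FU.lin_functor_axioms id_functor
      FU_right_exact right_exact_id])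
  show "balanced_trans C N M P (\<lambda>n m. BO (UO (BO n m)) R) (\<lambda>f h. BA (UA (BA f h)) (Idn M R))
     (\<lambda>n X m. BA (UA (b n X m)) (Idn M R)) BO BA b (\<lambda>n m. BA (Idn N n) (action_map m) \<cdot>\<^bsub>P\<^esub> free_iso n m)"
    unfolding balanced_trans_def
  proof (intro conjI ballI allI)
    fix n m
    assume "n \<in> Ob N" "m \<in> Ob M"
    then show "BA (Idn N n) (action_map m) \<cdot>\<^bsub>P\<^esub> free_iso n m \<in> Hom P (BO (UO (BO n m)) R) (BO n m)"
      by (simp add: Hom_iff)
  next
    fix n n' m m' f h
    assume f: "f \<in> Hom N n n'" and h: "h \<in> Hom M m m'"
    note ar = f[unfolded Hom_iff] h[unfolded Hom_iff]
    have ob: "n \<in> Ob N" "n' \<in> Ob N" "is_right_module C A m" "is_right_module C A m'"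
      using N.hom_ob[OF f] M.hom_ob[OF h] by simp_all
    have "(BA (Idn N n') (action_map m') \<cdot>\<^bsub>P\<^esub> free_iso n' m') \<cdot>\<^bsub>P\<^esub> BA (UA (BA f h)) (Idn M R)
        = BA (Idn N n') (action_map m') \<cdot>\<^bsub>P\<^esub> BA f (ActA M (snd (snd h)) (Idn M R)) \<cdot>\<^bsub>P\<^esub> free_iso n m"
      using free_iso_natural[OF f h] ar ob by simp
    also have "\<dots> = BA f (action_map m' \<cdot>\<^bsub>M\<^esub> ActA M (snd (snd h)) (Idn M R)) \<cdot>\<^bsub>P\<^esub> free_iso n m"
      using ar ob by (simp add: B.G.bmap_comp_assoc)
    also have "\<dots> = BA f h \<cdot>\<^bsub>P\<^esub> BA (Idn N n) (action_map m) \<cdot>\<^bsub>P\<^esub> free_iso n m"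
      unfolding action_map_natural[OF h, symmetric] using ar ob by (simp add: B.G.bmap_comp_assoc)
    finally show "(BA (Idn N n') (action_map m') \<cdot>\<^bsub>P\<^esub> free_iso n' m') \<cdot>\<^bsub>P\<^esub> BA (UA (BA f h)) (Idn M R)
      = BA f h \<cdot>\<^bsub>P\<^esub> BA (Idn N n) (action_map m) \<cdot>\<^bsub>P\<^esub> free_iso n m" .
  next
    fix n X m
    assume "n \<in> Ob N" "X \<in> Ob C" "m \<in> Ob M"
    then have ob: "n \<in> Ob N" "X \<in> Ob C" "is_right_module C A m"
      by simp_all
    have nat: "b n X m \<cdot>\<^bsub>P\<^esub> BA (Idn N (X \<rhd>\<^sub>O\<^bsub>N\<^esub> n)) (action_map m)
        = BA (Idn N n) (action_map (ActO M X m)) \<cdot>\<^bsub>P\<^esub> b n X (ActO M (fst m) R)"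
      using B.bal_natural[OF N.id_hom id_hom action_map_hom, of n X m] ob action_map_act[of m X] by simp
    have "b n X m \<cdot>\<^bsub>P\<^esub> BA (Idn N (X \<rhd>\<^sub>O\<^bsub>N\<^esub> n)) (action_map m) \<cdot>\<^bsub>P\<^esub> free_iso (X \<rhd>\<^sub>O\<^bsub>N\<^esub> n) m
        = (b n X m \<cdot>\<^bsub>P\<^esub> BA (Idn N (X \<rhd>\<^sub>O\<^bsub>N\<^esub> n)) (action_map m)) \<cdot>\<^bsub>P\<^esub> free_iso (X \<rhd>\<^sub>O\<^bsub>N\<^esub> n) m"
      using ob by simp
    also have "\<dots> = BA (Idn N n) (action_map (ActO M X m)) \<cdot>\<^bsub>P\<^esub>
        b n X (ActO M (fst m) R) \<cdot>\<^bsub>P\<^esub> free_iso (X \<rhd>\<^sub>O\<^bsub>N\<^esub> n) m"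
      unfolding nat using ob by simp
    also have "\<dots> = (BA (Idn N n) (action_map (ActO M X m)) \<cdot>\<^bsub>P\<^esub> free_iso n (ActO M X m)) \<cdot>\<^bsub>P\<^esub>
        BA (UA (b n X m)) (Idn M R)"
      using free_iso_balanced[OF ob] ob by simp
    finally show "b n X m \<cdot>\<^bsub>P\<^esub> BA (Idn N (X \<rhd>\<^sub>O\<^bsub>N\<^esub> n)) (action_map m) \<cdot>\<^bsub>P\<^esub> free_iso (X \<rhd>\<^sub>O\<^bsub>N\<^esub> n) m
      = (BA (Idn N n) (action_map (ActO M X m)) \<cdot>\<^bsub>P\<^esub> free_iso n (ActO M X m)) \<cdot>\<^bsub>P\<^esub>
        BA (UA (b n X m)) (Idn M R)" .
  qed
qed

text \<open>The counterpart for the sections of the action maps. The squares for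
  \<open>free_iso\<close> are inverted, since the transformation now runs towards the free
  modules.\<close>

lemma counit_section:
  assumes \<sigma>: "separability_element \<sigma>"
  shows "\<exists>\<theta>. natural_trans P P (\<lambda>p. p) (\<lambda>f. f) (\<lambda>p. BO (UO p) R) (\<lambda>f. BA (UA f) (Idn M R)) \<theta> \<and>
    (\<forall>n m. n \<in> Ob N \<and> is_right_module C A m \<longrightarrow>
      \<theta> (BO n m) = inv_arrow P (free_iso n m) \<cdot>\<^bsub>P\<^esub> BA (Idn N n) (action_section \<sigma> m))"
proof (rule universal_full_faithful(1)[OF P.finite id_functor FU.lin_functor_axioms
      right_exact_id FU_right_exact])
  note inv = P.iso_inv[OF free_iso_simps(4)]
  show "balanced_trans C N M P BO BA b (\<lambda>n m. BO (UO (BO n m)) R)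
     (\<lambda>f h. BA (UA (BA f h)) (Idn M R)) (\<lambda>n X m. BA (UA (b n X m)) (Idn M R))
     (\<lambda>n m. inv_arrow P (free_iso n m) \<cdot>\<^bsub>P\<^esub> BA (Idn N n) (action_section \<sigma> m))"
    unfolding balanced_trans_def
  proof (intro conjI ballI allI)
    fix n m
    assume "n \<in> Ob N" "m \<in> Ob M"
    then show "inv_arrow P (free_iso n m) \<cdot>\<^bsub>P\<^esub> BA (Idn N n) (action_section \<sigma> m)
      \<in> Hom P (BO n m) (BO (UO (BO n m)) R)"
      using inv \<sigma> by (simp add: Hom_iff)
  next
    fix n n' m m' f h
    assume f: "f \<in> Hom N n n'" and h: "h \<in> Hom M m m'"
    note ar = f[unfolded Hom_iff] h[unfolded Hom_iff]
    have ob: "n \<in> Ob N" "n' \<in> Ob N" "is_right_module C A m" "is_right_module C A m'"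
      using N.hom_ob[OF f] M.hom_ob[OF h] by simp_all
    have sq: "inv_arrow P (free_iso n' m') \<cdot>\<^bsub>P\<^esub> BA f (ActA M (snd (snd h)) (Idn M R))
        = BA (UA (BA f h)) (Idn M R) \<cdot>\<^bsub>P\<^esub> inv_arrow P (free_iso n m)"
      using ar ob by (intro P.iso_square free_iso_natural[OF f h]) (simp_all add: Hom_iff)
    have "(inv_arrow P (free_iso n' m') \<cdot>\<^bsub>P\<^esub> BA (Idn N n') (action_section \<sigma> m')) \<cdot>\<^bsub>P\<^esub> BA f h
        = inv_arrow P (free_iso n' m') \<cdot>\<^bsub>P\<^esub> BA f (action_section \<sigma> m' \<cdot>\<^bsub>M\<^esub> h)"
      using ar ob inv \<sigma> by (simp add: B.G.bmap_comp)
    also have "\<dots> = (inv_arrow P (free_iso n' m') \<cdot>\<^bsub>P\<^esub> BA f (ActA M (snd (snd h)) (Idn M R))) \<cdot>\<^bsub>P\<^esub>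
        BA (Idn N n) (action_section \<sigma> m)"
      unfolding action_section_natural[OF \<sigma> h] using ar ob inv \<sigma> by (simp add: B.G.bmap_comp)
    also have "\<dots> = BA (UA (BA f h)) (Idn M R) \<cdot>\<^bsub>P\<^esub> inv_arrow P (free_iso n m) \<cdot>\<^bsub>P\<^esub>
        BA (Idn N n) (action_section \<sigma> m)"
      unfolding sq using ar ob inv \<sigma> by simp
    finally show "(inv_arrow P (free_iso n' m') \<cdot>\<^bsub>P\<^esub> BA (Idn N n') (action_section \<sigma> m')) \<cdot>\<^bsub>P\<^esub> BA f h
      = BA (UA (BA f h)) (Idn M R) \<cdot>\<^bsub>P\<^esub> inv_arrow P (free_iso n m) \<cdot>\<^bsub>P\<^esub> BA (Idn N n) (action_section \<sigma> m)" .
  next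
    fix n X m
    assume "n \<in> Ob N" "X \<in> Ob C" "m \<in> Ob M"
    then have ob: "n \<in> Ob N" "X \<in> Ob C" "is_right_module C A m"
      by simp_all
    have nat: "b n X (ActO M (fst m) R) \<cdot>\<^bsub>P\<^esub> BA (Idn N (X \<rhd>\<^sub>O\<^bsub>N\<^esub> n)) (action_section \<sigma> m)
        = BA (Idn N n) (action_section \<sigma> (ActO M X m)) \<cdot>\<^bsub>P\<^esub> b n X m"
      using B.bal_natural[OF N.id_hom id_hom action_section_hom[OF \<sigma>], of n X m] ob
        action_section_act[OF \<sigma>, of m X] by simp
    have sq: "inv_arrow P (free_iso n (ActO M X m)) \<cdot>\<^bsub>P\<^esub> b n X (ActO M (fst m) R)
        = BA (UA (b n X m)) (Idn M R) \<cdot>\<^bsub>P\<^esub> inv_arrow P (free_iso (X \<rhd>\<^sub>O\<^bsub>N\<^esub> n) m)"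
      using ob by (intro P.iso_square free_iso_balanced) (simp_all add: Hom_iff)
    have "BA (UA (b n X m)) (Idn M R) \<cdot>\<^bsub>P\<^esub> inv_arrow P (free_iso (X \<rhd>\<^sub>O\<^bsub>N\<^esub> n) m) \<cdot>\<^bsub>P\<^esub>
          BA (Idn N (X \<rhd>\<^sub>O\<^bsub>N\<^esub> n)) (action_section \<sigma> m)
        = (inv_arrow P (free_iso n (ActO M X m)) \<cdot>\<^bsub>P\<^esub> b n X (ActO M (fst m) R)) \<cdot>\<^bsub>P\<^esub>
          BA (Idn N (X \<rhd>\<^sub>O\<^bsub>N\<^esub> n)) (action_section \<sigma> m)"
      unfolding sq using ob inv \<sigma> by simp
    also have "\<dots> = inv_arrow P (free_iso n (ActO M X m)) \<cdot>\<^bsub>P\<^esub>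
        BA (Idn N n) (action_section \<sigma> (ActO M X m)) \<cdot>\<^bsub>P\<^esub> b n X m"
      using nat ob inv \<sigma> by simp
    finally show "BA (UA (b n X m)) (Idn M R) \<cdot>\<^bsub>P\<^esub> inv_arrow P (free_iso (X \<rhd>\<^sub>O\<^bsub>N\<^esub> n) m) \<cdot>\<^bsub>P\<^esub>
          BA (Idn N (X \<rhd>\<^sub>O\<^bsub>N\<^esub> n)) (action_section \<sigma> m)
      = (inv_arrow P (free_iso n (ActO M X m)) \<cdot>\<^bsub>P\<^esub> BA (Idn N n) (action_section \<sigma> (ActO M X m))) \<cdot>\<^bsub>P\<^esub> b n X m"
      using ob inv \<sigma> by simp
  qed
qed

lemma exact_if_separable:
  assumes \<sigma>: "separability_element \<sigma>" and exact: "exact_module_category C N"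
  shows "exact_module_category C P"
proof -
  obtain \<epsilon> where \<epsilon>: "natural_trans P P (\<lambda>p. BO (UO p) R) (\<lambda>f. BA (UA f) (Idn M R)) (\<lambda>p. p) (\<lambda>f. f) \<epsilon>"
    and \<epsilon>B: "\<And>n m. \<lbrakk>n \<in> Ob N; is_right_module C A m\<rbrakk>
      \<Longrightarrow> \<epsilon> (BO n m) = BA (Idn N n) (action_map m) \<cdot>\<^bsub>P\<^esub> free_iso n m"
    using counit by blast
  obtain \<theta> where \<theta>: "natural_trans P P (\<lambda>p. p) (\<lambda>f. f) (\<lambda>p. BO (UO p) R) (\<lambda>f. BA (UA f) (Idn M R)) \<theta>"
    and \<theta>B: "\<And>n m. \<lbrakk>n \<in> Ob N; is_right_module C A m\<rbrakk>
      \<Longrightarrow> \<theta> (BO n m) = inv_arrow P (free_iso n m) \<cdot>\<^bsub>P\<^esub> BA (Idn N n) (action_section \<sigma> m)"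
    using counit_section[OF \<sigma>] by blast
  have \<epsilon>_ar: "\<epsilon> p \<in> Ar P" "Src P (\<epsilon> p) = BO (UO p) R" "Tgt P (\<epsilon> p) = p" if "p \<in> Ob P" for p
    using \<epsilon> that by (simp_all add: natural_trans_def Hom_iff)
  have \<theta>_ar: "\<theta> p \<in> Ar P" "Src P (\<theta> p) = p" "Tgt P (\<theta> p) = BO (UO p) R" if "p \<in> Ob P" for p
    using \<theta> that by (simp_all add: natural_trans_def Hom_iff)
  have \<epsilon>_nat: "\<epsilon> (Tgt P f) \<cdot>\<^bsub>P\<^esub> BA (UA f) (Idn M R) = f \<cdot>\<^bsub>P\<^esub> \<epsilon> (Src P f)" if "f \<in> Ar P" for f
    using \<epsilon> that by (simp add: natural_trans_def Hom_iff)
  have \<theta>_nat: "\<theta> (Tgt P f) \<cdot>\<^bsub>P\<^esub> f = BA (UA f) (Idn M R) \<cdot>\<^bsub>P\<^esub> \<theta> (Src P f)" if "f \<in> Ar P" for f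
    using \<theta> that by (simp add: natural_trans_def Hom_iff)

  \<comment> \<open>Both sides are natural endomorphisms of the identity functor of
    \<open>P\<close>, so it suffices to compare them on \<open>BO n m\<close>. There
    \<open>free_iso\<close> cancels against its inverse and \<open>action_map_section\<close>
    remains.\<close>
  have split: "\<epsilon> p \<cdot>\<^bsub>P\<^esub> \<theta> p = Idn P p" if p: "p \<in> Ob P" for p
  proof (rule universal_full_faithful(2)[OF P.finite id_functor id_functor
        right_exact_id right_exact_id, where t = "\<lambda>n m. Idn P (BO n m)", OF _ _ _ _ _ p])
    show "balanced_trans C N M P BO BA b BO BA b (\<lambda>n m. Idn P (BO n m))"
      unfolding balanced_trans_def
    proof (intro conjI ballI allI)
      fix n n' m m' f h
      assume "f \<in> Hom N n n'" "h \<in> Hom M m m'"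
      then show "Idn P (BO n' m') \<cdot>\<^bsub>P\<^esub> BA f h = BA f h \<cdot>\<^bsub>P\<^esub> Idn P (BO n m)"
        by (simp add: Hom_iff)
    qed (simp_all add: Hom_iff)
    show "natural_trans P P (\<lambda>p. p) (\<lambda>f. f) (\<lambda>p. p) (\<lambda>f. f) (Idn P)"
      by (simp add: natural_trans_def Hom_iff)
    show "natural_trans P P (\<lambda>p. p) (\<lambda>f. f) (\<lambda>p. p) (\<lambda>f. f) (\<lambda>p. \<epsilon> p \<cdot>\<^bsub>P\<^esub> \<theta> p)"
      unfolding natural_trans_def
    proof (intro conjI ballI allI)
      show "\<epsilon> x \<cdot>\<^bsub>P\<^esub> \<theta> x \<in> Hom P x x" if "x \<in> Ob P" for x
        using that \<epsilon>_ar \<theta>_ar by (simp add: Hom_iff)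
      fix x y f
      assume f: "f \<in> Hom P x y"
      have xy: "x \<in> Ob P" "y \<in> Ob P" and f': "f \<in> Ar P" "Src P f = x" "Tgt P f = y"
        using P.hom_ob[OF f] f by (simp_all add: Hom_iff)
      have "(\<epsilon> y \<cdot>\<^bsub>P\<^esub> \<theta> y) \<cdot>\<^bsub>P\<^esub> f = (\<epsilon> y \<cdot>\<^bsub>P\<^esub> BA (UA f) (Idn M R)) \<cdot>\<^bsub>P\<^esub> \<theta> x"
        using \<theta>_nat[OF f'(1)] f' xy \<epsilon>_ar \<theta>_ar by simp
      also have "\<dots> = f \<cdot>\<^bsub>P\<^esub> \<epsilon> x \<cdot>\<^bsub>P\<^esub> \<theta> x"
        using \<epsilon>_nat[OF f'(1), unfolded f'(2,3)] f' xy \<epsilon>_ar \<theta>_ar by simp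
      finally show "(\<epsilon> y \<cdot>\<^bsub>P\<^esub> \<theta> y) \<cdot>\<^bsub>P\<^esub> f = f \<cdot>\<^bsub>P\<^esub> \<epsilon> x \<cdot>\<^bsub>P\<^esub> \<theta> x" .
    qed
    show "\<epsilon> (BO n m) \<cdot>\<^bsub>P\<^esub> \<theta> (BO n m) = Idn P (BO n m)"
      if nm: "n \<in> Ob N" "is_right_module C A m" for n m
    proof -
      note inv = P.iso_inv[OF free_iso_simps(4)[OF nm]]
      have "\<epsilon> (BO n m) \<cdot>\<^bsub>P\<^esub> \<theta> (BO n m) = BA (Idn N n) (action_map m) \<cdot>\<^bsub>P\<^esub> BA (Idn N n) (action_section \<sigma> m)"
        using nm inv \<sigma> by (simp add: \<epsilon>B \<theta>B P.iso_inv_comp)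
      also have "\<dots> = BA (Idn N n) (action_map m \<cdot>\<^bsub>M\<^esub> action_section \<sigma> m)"
        using nm \<sigma> by (simp add: B.G.bmap_comp)
      also have "\<dots> = Idn P (BO n m)"
        using nm by (simp add: action_map_section[OF \<sigma> nm(2)])
      finally show ?thesis .
    qed
  qed simp

  \<comment> \<open>A lifting problem for \<open>F x\<close> is transposed to \<open>N\<close>,
    solved there because \<open>U\<close> preserves epimorphisms, and transposed back.\<close>
  have F_projective: "projective_object P (BO x R)" if x: "projective_object N x" for x
    unfolding projective_object_def
  proof (intro conjI allI impI)
    have xo: "x \<in> Ob N"
      using x by (simp add: projective_object_def)
    then show "BO x R \<in> Ob P"
      by simp
    let ?one = "One A \<rhd>\<^sub>A\<^bsub>N\<^esub> Idn N x"
    \<comment> \<open>The unit of the adjunction at \<open>x\<close>: from \<open>x\<close> to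
      \<open>1 \<rhd> x\<close>, along the unit of \<open>A\<close> to \<open>a \<rhd> x\<close>,
      and back through \<open>u\<close> to \<open>U (F x)\<close>.\<close>
    define \<eta> where "\<eta> = inv_arrow N (u x R) \<cdot>\<^bsub>N\<^esub> ?one \<cdot>\<^bsub>N\<^esub> inv_arrow N (Unt N x)"
    note uinv = N.iso_inv[OF u_iso[OF xo regular_module]] and tinv = N.iso_inv[OF N.unt_iso[OF xo]]
    have \<eta>: "\<eta> \<in> Ar N" "Src N \<eta> = x" "Tgt N \<eta> = UO (BO x R)"
      using xo uinv tinv by (simp_all add: \<eta>_def)
    have triangle: "\<epsilon> (BO x R) \<cdot>\<^bsub>P\<^esub> BA \<eta> (Idn M R) = Idn P (BO x R)"
    proof -
      have "u x R \<cdot>\<^bsub>N\<^esub> \<eta> = ?one \<cdot>\<^bsub>N\<^esub> inv_arrow N (Unt N x)"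
        using xo uinv tinv N.iso_inv_comp(2)[OF u_iso[OF xo regular_module]] by (simp add: \<eta>_def)
      then have "BA (u x R) (Idn M R) \<cdot>\<^bsub>P\<^esub> BA \<eta> (Idn M R)
          = BA ?one (Idn M R) \<cdot>\<^bsub>P\<^esub> BA (inv_arrow N (Unt N x)) (Idn M R)"
        using xo \<eta> tinv F.map_comp[of \<eta> "u x R"] F.map_comp[of "inv_arrow N (Unt N x)" ?one] by simp
      then have "\<epsilon> (BO x R) \<cdot>\<^bsub>P\<^esub> BA \<eta> (Idn M R) = BA (Idn N x) (action_map R) \<cdot>\<^bsub>P\<^esub>
          (b x a R \<cdot>\<^bsub>P\<^esub> BA ?one (Idn M R)) \<cdot>\<^bsub>P\<^esub> BA (inv_arrow N (Unt N x)) (Idn M R)"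
        using xo \<eta> tinv by (simp add: \<epsilon>B free_iso_def)
      \<comment> \<open>Naturality of the balancing in \<open>One A\<close> moves the unit of
        \<open>A\<close> from the \<open>N\<close> variable to the module variable, where the action
        map absorbs it. What is left, \<open>b x (Unit C) R\<close>, is the unit constraint of
        \<open>N\<close>, which cancels against its inverse in \<eta>.\<close>
      also have "b x a R \<cdot>\<^bsub>P\<^esub> BA ?one (Idn M R)
          = BA (Idn N x) (ActA M (One A) (Idn M R)) \<cdot>\<^bsub>P\<^esub> b x (Unit C) R"
        using xo by (intro B.bal_natural) (simp_all add: Hom_iff)
      also have "BA (Idn N x) (action_map R) \<cdot>\<^bsub>P\<^esub>
          (BA (Idn N x) (ActA M (One A) (Idn M R)) \<cdot>\<^bsub>P\<^esub> b x (Unit C) R) \<cdot>\<^bsub>P\<^esub>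
          BA (inv_arrow N (Unt N x)) (Idn M R)
        = BA (Idn N x) (action_map R \<cdot>\<^bsub>M\<^esub> ActA M (One A) (Idn M R)) \<cdot>\<^bsub>P\<^esub>
          BA (Unt N x) (Idn M R) \<cdot>\<^bsub>P\<^esub> BA (inv_arrow N (Unt N x)) (Idn M R)"
        using xo tinv by (simp add: B.G.bmap_comp_assoc B.bal_unit)
      also have "\<dots> = Idn P (BO x R)"
      proof -
        have "BA (Unt N x) (Idn M R) \<cdot>\<^bsub>P\<^esub> BA (inv_arrow N (Unt N x)) (Idn M R) = Idn P (BO x R)"
          using xo tinv by (simp flip: F.map_comp)
        then show ?thesis
          unfolding action_map_unit using xo by simp
      qed
      finally show ?thesis .
    qed
    fix e f
    assume ef: "epi_arrow P e \<and> f \<in> Hom P (BO x R) (Tgt P e)"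
    then have e: "e \<in> Ar P" and f: "f \<in> Ar P" "Src P f = BO x R" "Tgt P f = Tgt P e"
      by (simp_all add: epi_arrow_def Hom_iff)
    obtain z where "zero_object P z"
      using finite_category_zero_object[OF P.finite] by blast
    then have "epi_arrow N (UA e)"
      using U.right_exact_epi[OF U_right_exact] ef by blast
    moreover have "UA f \<cdot>\<^bsub>N\<^esub> \<eta> \<in> Hom N x (Tgt N (UA e))"
      using e f \<eta> by (simp add: Hom_iff)
    ultimately obtain g where g: "g \<in> Hom N x (UO (Src P e))" "UA e \<cdot>\<^bsub>N\<^esub> g = UA f \<cdot>\<^bsub>N\<^esub> \<eta>"
      using x e unfolding projective_object_def by (metis U.map_simps(2))
    note g' = g(1)[unfolded Hom_iff]
    \<comment> \<open>The lift of \<open>f\<close> is \<open>\<epsilon>\<close> composed with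
      \<open>F g\<close>; naturality of \<epsilon> at \<open>e\<close> and at \<open>f\<close>
      reduces the claim to the triangle identity.\<close>
    have "e \<cdot>\<^bsub>P\<^esub> \<epsilon> (Src P e) \<cdot>\<^bsub>P\<^esub> BA g (Idn M R) = (e \<cdot>\<^bsub>P\<^esub> \<epsilon> (Src P e)) \<cdot>\<^bsub>P\<^esub> BA g (Idn M R)"
      using e g' \<epsilon>_ar by simp
    also have "\<dots> = \<epsilon> (Tgt P e) \<cdot>\<^bsub>P\<^esub> BA (UA e \<cdot>\<^bsub>N\<^esub> g) (Idn M R)"
      unfolding \<epsilon>_nat[OF e, symmetric] using e g' \<epsilon>_ar by simp
    also have "\<dots> = (\<epsilon> (Tgt P f) \<cdot>\<^bsub>P\<^esub> BA (UA f) (Idn M R)) \<cdot>\<^bsub>P\<^esub> BA \<eta> (Idn M R)"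
      unfolding g(2) using e f \<eta> \<epsilon>_ar by simp
    also have "\<dots> = f \<cdot>\<^bsub>P\<^esub> \<epsilon> (BO x R) \<cdot>\<^bsub>P\<^esub> BA \<eta> (Idn M R)"
      unfolding \<epsilon>_nat[OF f(1)] using f xo \<eta> \<epsilon>_ar by simp
    also have "\<dots> = f"
      unfolding triangle using f by simp
    finally show "\<exists>g \<in> Hom P (BO x R) (Src P e). e \<cdot>\<^bsub>P\<^esub> g = f"
      using e g' \<epsilon>_ar by (intro bexI[of _ "\<epsilon> (Src P e) \<cdot>\<^bsub>P\<^esub> BA g (Idn M R)"]) (simp_all add: Hom_iff)
  qed

  have "projective_object P (q \<rhd>\<^sub>O\<^bsub>P\<^esub> p)" if q: "projective_object C q" and p: "p \<in> Ob P" for q p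
  proof -
    have qo: "q \<in> Ob C"
      using q by (simp add: projective_object_def)
    \<comment> \<open>The induced action moves \<open>q\<close> into the first variable of
      \<open>B\<close>, where exactness of \<open>N\<close> makes \<open>q \<rhd> U p\<close>
      projective. Conjugating with this isomorphism exhibits \<open>q \<rhd> p\<close> as a retract
      of \<open>F (q \<rhd> U p)\<close>.\<close>
    let ?s = "s q (UO p) R"
    have s: "is_iso P ?s" "?s \<in> Ar P" "Src P ?s = q \<rhd>\<^sub>O\<^bsub>P\<^esub> BO (UO p) R"
      "Tgt P ?s = BO (q \<rhd>\<^sub>O\<^bsub>N\<^esub> UO p) R"
      using induced qo p by (simp_all add: induced_action_def Hom_iff)
    note inv = P.iso_inv[OF s(1)]
    have "projective_object P (BO (q \<rhd>\<^sub>O\<^bsub>N\<^esub> UO p) R)"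
      using exact q p by (intro F_projective) (simp add: exact_module_category_def)
    moreover have "?s \<cdot>\<^bsub>P\<^esub> (Idn C q \<rhd>\<^sub>A\<^bsub>P\<^esub> \<theta> p) \<in> Hom P (q \<rhd>\<^sub>O\<^bsub>P\<^esub> p) (BO (q \<rhd>\<^sub>O\<^bsub>N\<^esub> UO p) R)"
      "(Idn C q \<rhd>\<^sub>A\<^bsub>P\<^esub> \<epsilon> p) \<cdot>\<^bsub>P\<^esub> inv_arrow P ?s \<in> Hom P (BO (q \<rhd>\<^sub>O\<^bsub>N\<^esub> UO p) R) (q \<rhd>\<^sub>O\<^bsub>P\<^esub> p)"
      using qo p s inv \<epsilon>_ar \<theta>_ar by (simp_all add: Hom_iff)
    moreover have "((Idn C q \<rhd>\<^sub>A\<^bsub>P\<^esub> \<epsilon> p) \<cdot>\<^bsub>P\<^esub> inv_arrow P ?s) \<cdot>\<^bsub>P\<^esub> ?s \<cdot>\<^bsub>P\<^esub> (Idn C q \<rhd>\<^sub>A\<^bsub>P\<^esub> \<theta> p)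
        = Idn P (q \<rhd>\<^sub>O\<^bsub>P\<^esub> p)"
      using qo p s(2-4) inv \<epsilon>_ar \<theta>_ar split[OF p]
      by (simp add: P.iso_inv_comp[OF s(1)] PA.bmap_comp)
    ultimately show ?thesis
      by (rule P.projective_retract)
  qed
  then show ?thesis
    using P.module_category_axioms by (simp add: exact_module_category_def)
qed

end

text \<open>\<open>U\<close> arises by factoring the canonical balanced functor through the given
  product, with \<open>N\<close> itself as target; this is where universality is used for a target
  of arbitrary types.\<close>

lemma separable_fully_exact:
  fixes C :: "('o, 'a, 'k::field, 'z) brmoncat_scheme" and A :: "('o, 'a) alg"
  assumes "finite_braided_tensor_category C" "is_algebra C A" and sep: "separable C A"
  shows "fully_exact_algebra TYPE('n \<times> 'b \<times> 'p \<times> 'q) C A"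
  unfolding fully_exact_algebra_def fully_exact_def
proof (intro allI impI, elim conjE)
  fix N :: "('n, 'b, 'k, 'o, 'a) modcat" and P :: "('p, 'q, 'k, 'o, 'a) modcat"
  assume N: "exact_module_category C N" and P: "relative_deligne_product C N (right_modules C A) P"
  interpret C: finite_braided_tensor_category C by fact
  interpret TA: tensor_algebra C A
    by unfold_locales fact
  interpret N: module_category C N
    using N by (simp add: exact_module_category_def)
  interpret P: module_category C P
    using P by (simp add: relative_deligne_product_def)
  obtain BO BA b s where "universal_balanced C N (right_modules C A) P BO BA b"
    "induced_action C N (right_modules C A) P BO BA b s"
    using P by (auto simp: relative_deligne_product_def)
  then interpret deligne C A N P BO BA b s
    by unfold_locales
  show "exact_module_category C P"
  proof (rule universal_factorisation[OF N.finite canonical_balanced])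
    fix UO UA u
    assume "lin_functor P N UO UA" "right_exact_functor P N UO UA"
      "balanced_trans C N TA.M N (\<lambda>n m. UO (BO n m)) (\<lambda>f h. UA (BA f h)) (\<lambda>n X m. UA (b n X m))
        (\<lambda>n m. fst m \<rhd>\<^sub>O\<^bsub>N\<^esub> n) (\<lambda>f h. snd (snd h) \<rhd>\<^sub>A\<^bsub>N\<^esub> f) (\<lambda>n X m. right_asc C N n X (fst m)) u"
      "\<And>n m. \<lbrakk>n \<in> Ob N; is_right_module C A m\<rbrakk> \<Longrightarrow> is_iso N (u n m)"
    then interpret deligne_forgetful C A N P BO BA b s UO UA u
      by (intro deligne_forgetful.intro deligne_axioms deligne_forgetful_axioms.intro)
    show ?thesis
      using TA.separable_element[OF sep] exact_if_separable[OF _ N] by blast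
  qed
qed

theorem proposition5p16:
  fixes C :: "('o, 'a, 'k::field) brmoncat" and A :: "('o, 'a) alg"
  assumes "finite_braided_tensor_category C" and "is_algebra C A"
  shows "(relatively_projective C A \<longrightarrow> fully_exact_algebra TYPE('n \<times> 'b \<times> 'p \<times> 'q) C A) \<and>
         (separable C A \<longrightarrow> fully_exact_algebra TYPE('n \<times> 'b \<times> 'p \<times> 'q) C A)"
proof -
  interpret C: finite_braided_tensor_category C by fact
  interpret tensor_algebra C A
    by unfold_locales fact
  show ?thesis
    using separable_fully_exact[OF assms] relatively_projective_separable by blast
qed

end
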